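(* Let $G=SU(2)\times SU(2)\times SU(2)$ and let $H=SU(2)$ be embedded diagonally in $G$ via $h\mapsto(h,h,h)$. Let $\widetilde Z_{G,H}^3(s)=\int_H\zeta_G(s,(h,h,h))\,dh$, with $dh$ the normalized Haar measure on $H$ and $(h,h,h)\in G$ the diagonal element, defined by this integral for $\operatorname{Re}(s)$ sufficiently large. Then for $\operatorname{Re}(s)>0$, $$\widetilde Z_{G,H}^3(s)=\sum_{m_1,m_2,m_3\ge0}\bigl((m_1+m_2+1)(m_2+m_3+1)(m_3+m_1+1)\bigr)^{-s-1}$$ (the series converging absolutely there), and $\widetilde Z_{G,H}^3(s)$ has a meromorphic continuation to all of $\mathbb{C}$.
   Context: For a compact semisimple Lie group $K$, $\widehat K$ is the set of equivalence classes of irreducible unitary representations of $K$, and for $k\in K$ the Witten $L$-function is $\zeta_K(s,k)=\sum_{\rho\in\widehat K}\frac{\operatorname{tr}(\rho(k))}{(\deg\rho)^{s+1}}$, absolutely convergent for $\operatorname{Re}(s)$ sufficiently large. *)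

theory Defs
  imports
    "HOL-Complex_Analysis.Complex_Analysis"
    "HOL-Probability.Probability_Measure"
    "HOL-Algebra.Group"
    "Jordan_Normal_Form.Schur_Decomposition"
begin

text \<open>
  Two matrix libraries are used. Elements of \<open>SU(2)\<close> have type \<open>complex^2^2\<close>, which carries the
  topology; representations take values in the JNF type \<open>mat\<close>, where the size of a matrix is
  a natural number and not a type. A topological group is a group in the sense of HOL-Algebra
  whose carrier has the subspace topology of its ambient type.
\<close>

section \<open>Irreducible unitary representations\<close>

definition unitary_group :: "nat \<Rightarrow> complex mat monoid" where
  "unitary_group n =
     \<lparr>carrier = {U \<in> carrier_mat n n. U * mat_adjoint U = 1\<^sub>m n}, mult = (*), one = 1\<^sub>m n\<rparr>"

text \<open>
  All representations are finite-dimensional; for a compact group this is no restriction on the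
  irreducible unitary ones. Up to unitary equivalence the representation space is \<open>\<complex>\<^sup>n\<close>.
\<close>

definition unitary_rep :: "('g::topological_space) monoid \<Rightarrow> nat \<Rightarrow> ('g \<Rightarrow> complex mat) \<Rightarrow> bool" where
  "unitary_rep K n \<rho> \<longleftrightarrow>
     \<rho> \<in> hom K (unitary_group n) \<and>
     (\<forall>i<n. \<forall>j<n. continuous_on (carrier K) (\<lambda>g. \<rho> g $$ (i, j)))"

definition irreducible_unitary_rep ::
    "('g::topological_space) monoid \<Rightarrow> nat \<Rightarrow> ('g \<Rightarrow> complex mat) \<Rightarrow> bool" where
  "irreducible_unitary_rep K n \<rho> \<longleftrightarrow>
     unitary_rep K n \<rho> \<and> n > 0 \<and>
     (\<forall>W. VectorSpace.subspace class_ring W (module_vec TYPE(complex) n) \<and>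
          (\<forall>g\<in>carrier K. \<forall>w\<in>W. \<rho> g *\<^sub>v w \<in> W) \<longrightarrow>
          W = {0\<^sub>v n} \<or> W = carrier_vec n)"

definition irreps :: "('g::topological_space) monoid \<Rightarrow> ('g \<Rightarrow> complex mat) set" where
  "irreps K = {\<rho>. \<exists>n. irreducible_unitary_rep K n \<rho>}"

text \<open>
  The values of \<open>\<rho>\<close> outside \<open>carrier K\<close> do not matter in the following relation, so functions that
  agree on \<open>carrier K\<close> lie in the same class.
\<close>

definition rep_equivalence ::
    "('g::topological_space) monoid \<Rightarrow> (('g \<Rightarrow> complex mat) \<times> ('g \<Rightarrow> complex mat)) set" where
  "rep_equivalence K =
     {(\<rho>, \<sigma>). \<exists>n. irreducible_unitary_rep K n \<rho> \<and> irreducible_unitary_rep K n \<sigma> \<and>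
        (\<exists>U\<in>carrier (unitary_group n). \<forall>g\<in>carrier K. U * \<rho> g = \<sigma> g * U)}"

definition unitary_dual :: "('g::topological_space) monoid \<Rightarrow> ('g \<Rightarrow> complex mat) set set" where
  "unitary_dual K = irreps K // rep_equivalence K"

text \<open>
  Degree and character do not depend on the representative of the class, so any choice will do.
\<close>

definition rep_of :: "('g \<Rightarrow> complex mat) set \<Rightarrow> 'g \<Rightarrow> complex mat" where
  "rep_of C = (SOME \<rho>. \<rho> \<in> C)"

definition class_degree :: "'g monoid \<Rightarrow> ('g \<Rightarrow> complex mat) set \<Rightarrow> nat" where
  "class_degree K C = dim_row (rep_of C \<one>\<^bsub>K\<^esub>)"

definition class_character :: "('g \<Rightarrow> complex mat) set \<Rightarrow> 'g \<Rightarrow> complex" where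
  "class_character C k = (\<Sum>i<dim_row (rep_of C k). rep_of C k $$ (i, i))"

section \<open>The Witten L-function\<close>

definition witten_term ::
    "'g monoid \<Rightarrow> complex \<Rightarrow> 'g \<Rightarrow> ('g \<Rightarrow> complex mat) set \<Rightarrow> complex" where
  "witten_term K s k C = class_character C k / of_nat (class_degree K C) powr (s + 1)"

definition witten_L_converges ::
    "('g::topological_space) monoid \<Rightarrow> complex \<Rightarrow> 'g \<Rightarrow> bool" where
  "witten_L_converges K s k \<longleftrightarrow> (\<lambda>C. norm (witten_term K s k C)) summable_on unitary_dual K"

definition witten_L :: "('g::topological_space) monoid \<Rightarrow> complex \<Rightarrow> 'g \<Rightarrow> complex" where
  "witten_L K s k = (\<Sum>\<^sub>\<infinity>C\<in>unitary_dual K. witten_term K s k C)"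

section \<open>Normalized Haar measure\<close>

text \<open>
  Left-invariant Borel probability measures on \<open>K\<close>. On a compact metrizable group, such as
  \<open>SU(2)\<close>, there is exactly one, and it is automatically regular and right-invariant.
\<close>

definition normalized_haar_measure ::
    "('g::topological_space) monoid \<Rightarrow> 'g measure \<Rightarrow> bool" where
  "normalized_haar_measure K \<mu> \<longleftrightarrow>
     prob_space \<mu> \<and> space \<mu> = carrier K \<and>
     sets \<mu> = sets (restrict_space borel (carrier K)) \<and>
     (\<forall>g\<in>carrier K. distr \<mu> \<mu> (\<lambda>x. g \<otimes>\<^bsub>K\<^esub> x) = \<mu>)"

section \<open>The groups\<close>

definition conj_transpose :: "complex^2^2 \<Rightarrow> complex^2^2" where
  "conj_transpose A = (\<chi> i j. cnj (vec_nth (vec_nth A j) i))"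

definition SU2 :: "(complex^2^2) monoid" where
  "SU2 = \<lparr>carrier = {A. A ** conj_transpose A = Finite_Cartesian_Product.mat 1 \<and>
                        Determinants.det A = 1},
          mult = (**), one = Finite_Cartesian_Product.mat 1\<rparr>"

definition SU2_cubed :: "((complex^2^2) \<times> (complex^2^2) \<times> (complex^2^2)) monoid" where
  "SU2_cubed = SU2 \<times>\<times> (SU2 \<times>\<times> SU2)"

definition diag3 :: "'a \<Rightarrow> 'a \<times> 'a \<times> 'a" where
  "diag3 h = (h, h, h)"

text \<open>
  The integral \<open>\<integral>\<^sub>H \<zeta>\<^sub>G(s, (h,h,h)) dh\<close>. It is used only for \<open>Re s\<close> large, where the series defining the
  integrand converges at every point.
\<close>

definition diagonal_integral :: "(complex^2^2) measure \<Rightarrow> complex \<Rightarrow> complex" where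
  "diagonal_integral \<mu> s = (\<integral>h. witten_L SU2_cubed s (diag3 h) \<partial>\<mu>)"

definition triple_term :: "complex \<Rightarrow> nat \<times> nat \<times> nat \<Rightarrow> complex" where
  "triple_term s = (\<lambda>(m1, m2, m3).
     of_nat ((m1 + m2 + 1) * (m2 + m3 + 1) * (m3 + m1 + 1)) powr (- s - 1))"

end

theory Submission
  imports Defs "Jordan_Normal_Form.Spectral_Radius"
begin

text \<open>
  The irreducible representations of \<open>SU(2)\<close> are the symmetric powers of the standard one; the one of
  degree \<open>n + 1\<close> has as character a Chebyshev polynomial of the trace. Tensor products of three of them
  are irreducible and pairwise inequivalent, and they exhaust the dual of \<open>SU(2)\<^sup>3\<close>: the character
  of a further irreducible representation would be a continuous function of the three traces
  orthogonal to all polynomials. By the Clebsch-Gordan rule the character with indices \<open>(a, b, c)\<close> has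
  integral 1 over the diagonal if \<open>(a, b, c) = (m1 + m2, m2 + m3, m3 + m1)\<close>, and 0 otherwise. This
  gives the series, with \<open>u = s + 1\<close>.

  For the continuation, a triple with even sum either has this form or one entry exceeds the sum of the
  other two. Hence the series equals \<open>(\<zeta>(u)\<^sup>3 + \<eta>(u)\<^sup>3) / 2 - 3 D(u)\<close>, where \<open>\<eta>\<close> is the alternating
  zeta series and \<open>\<Gamma>(u) D(u)\<close> is the Mellin transform at \<open>u\<close> of \<open>L(u, x)\<^sup>2 / (2 sinh x)\<close> for
  \<open>L(u, x) = \<Sum>n\<ge>1. n powr (-u) * exp (-n x)\<close>. With the alternating analogue \<open>A\<close> of \<open>L\<close> one has
  \<open>L(u, x) = 2 powr (1 - u) * L(u, 2 x) + A(u, x)\<close>, and \<open>A\<close> has an asymptotic power series at \<open>x = 0\<close>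
  with entire coefficients. The scaling relation turns into a linear equation for the Mellin integrals of
  \<open>L\<close> and \<open>L\<^sup>2\<close> near 0, which yields their meromorphic continuation.
\<close>

section \<open>Holomorphic parameter integrals\<close>

text \<open>The obstacle is the behaviour of \<open>L(u, x)\<close> at \<open>x = 0\<close>: besides
  integer powers of \<open>x\<close> it contains a term in \<open>x powr (u - 1)\<close>, and the
  two kinds of terms collide at the positive integers \<open>u\<close>. So \<open>L\<close> has no
  expansion with coefficients holomorphic in \<open>u\<close>. The scaling relation avoids writing
  that term down: near 0 the function \<open>L\<close> enters only through the bounded
  \<open>A\<close> and through its own values at \<open>2 x\<close>. The unknown integral then
  stands on both sides of an equation, and solving for it produces the poles. For the square, the
  relation leaves \<open>2 A L - A^2\<close>, which is linear in \<open>L\<close> and therefore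
  already settled. The kernel \<open>1 / (2 sinh x)\<close> is the geometric sum over the excess
  \<open>2 + 2 j\<close> of a dominant entry over the sum of the other two. On each half-plane
  finitely many terms of the expansions suffice; the continuations to growing half-planes are glued
  at the end. The identity with the Haar integral is obtained for \<open>Re s > 1\<close>: bounding
  a character by its degree costs one power, whereas the final series converges absolutely for
  \<open>Re s > 0\<close>.\<close>

lemma holomorphic_on_lebesgue_integral:
  fixes f :: "complex \<Rightarrow> 'a \<Rightarrow> complex"
  assumes "open U"
    and meas: "\<And>u. u \<in> U \<Longrightarrow> f u \<in> borel_measurable M"
    and hol: "\<And>x. x \<in> space M \<Longrightarrow> (\<lambda>u. f u x) holomorphic_on U"
    and dom: "\<And>u. u \<in> U \<Longrightarrow> \<exists>r g. r > 0 \<and> integrable M g \<and>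
       (\<forall>w\<in>ball u r \<inter> U. \<forall>x\<in>space M. norm (f w x) \<le> g x)"
  shows "(\<lambda>u. \<integral>x. f u x \<partial>M) holomorphic_on U"
proof -
  have "\<exists>D. ((\<lambda>u. \<integral>x. f u x \<partial>M) has_field_derivative D) (at u)" if u: "u \<in> U" for u
  proof -
    obtain r0 g where r0: "r0 > 0" and g: "integrable M g"
      and bd0: "\<And>w x. w \<in> ball u r0 \<inter> U \<Longrightarrow> x \<in> space M \<Longrightarrow> norm (f w x) \<le> g x"
      using dom[OF u] by blast
    obtain r1 where r1: "r1 > 0" "ball u r1 \<subseteq> U"
      using \<open>open U\<close> u open_contains_ball by blast
    \<comment> \<open>Halving leaves a margin: for \<open>w\<close> in \<open>ball u r\<close> the
      closed disc of radius \<open>r / 2\<close> around \<open>w\<close> stays inside the region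
      dominated by \<open>g\<close>. Cauchy's inequality then bounds the derivative, and hence the
      difference quotients, by an integrable function.\<close>
    define r where "r = min r0 r1 / 2"
    have r: "r > 0" and rU: "\<And>w. dist u w < 2 * r \<Longrightarrow> w \<in> U"
      and bd: "\<And>w x. dist u w < 2 * r \<Longrightarrow> x \<in> space M \<Longrightarrow> norm (f w x) \<le> g x"
      using r0 r1 bd0 by (auto simp: r_def)
    have der_bd: "norm (deriv (\<lambda>u. f u x) w) \<le> g x / (r / 2)" if "x \<in> space M" "w \<in> ball u r" for x w
    proof -
      have sub: "dist u z < 2 * r" if "z \<in> cball w (r/2)" for z
      proof -
        have "dist u z \<le> dist u w + dist w z" by (rule dist_triangle)
        also have "\<dots> < 2 * r" using that \<open>w \<in> ball u r\<close> r by auto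
        finally show ?thesis .
      qed
      have "norm ((deriv ^^ 1) (\<lambda>u. f u x) w) \<le> fact 1 * g x / (r/2) ^ 1"
      proof (rule Cauchy_inequality)
        show "(\<lambda>u. f u x) holomorphic_on ball w (r/2)"
          by (rule holomorphic_on_subset[OF hol[OF that(1)]]) (use sub rU in auto)
        show "continuous_on (cball w (r/2)) (\<lambda>u. f u x)"
          by (intro holomorphic_on_imp_continuous_on holomorphic_on_subset[OF hol[OF that(1)]])
             (use sub rU in auto)
        show "norm (f z x) \<le> g x" if "norm (w - z) = r/2" for z
          by (rule bd[OF sub \<open>x \<in> space M\<close>]) (use that in \<open>auto simp: dist_norm\<close>)
      qed (use r in auto)
      then show ?thesis by simp
    qed
    have lip: "norm (f w x - f u x) \<le> g x / (r / 2) * norm (w - u)" if "x \<in> space M" "w \<in> ball u r" for x w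
    proof (rule field_differentiable_bound[where S = "ball u r" and f' = "deriv (\<lambda>u. f u x)"])
      show "((\<lambda>u. f u x) has_field_derivative deriv (\<lambda>u. f u x) z) (at z within ball u r)"
        if "z \<in> ball u r" for z
      proof -
        have "z \<in> U" using rU[of z] that r by auto
        from has_field_derivative_at_within[OF holomorphic_derivI[OF hol[OF \<open>x \<in> space M\<close>] \<open>open U\<close> this]]
        show ?thesis .
      qed
    qed (use that r der_bd in auto)
    have "((\<lambda>w. ((\<integral>x. f w x \<partial>M) - (\<integral>x. f u x \<partial>M)) / (w - u)) \<longlongrightarrow>
            (\<integral>x. deriv (\<lambda>u. f u x) u \<partial>M)) (at u within ball u r)"
      unfolding tendsto_at_iff_sequentially comp_def
    proof safe
      fix X assume X: "\<forall>i. X i \<in> ball u r - {u}" "X \<longlonglongrightarrow> u"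
      have int: "integrable M (f w)" if "w \<in> ball u r" for w
        by (rule Bochner_Integration.integrable_bound[OF g])
           (use that rU[of w] r meas bd[of w] in \<open>auto intro!: AE_I2 order.trans[OF _ abs_ge_self]\<close>)
      have lim: "(\<lambda>i. (f (X i) x - f u x) / (X i - u)) \<longlonglongrightarrow> deriv (\<lambda>u. f u x) u" if "x \<in> space M" for x
      proof -
        have "((\<lambda>u. f u x) has_field_derivative deriv (\<lambda>u. f u x) u) (at u)"
          by (rule holomorphic_derivI[OF hol[OF that] \<open>open U\<close> u])
        then have "((\<lambda>y. (f y x - f u x) / (y - u)) \<longlongrightarrow> deriv (\<lambda>u. f u x) u) (at u)"
          by (simp add: has_field_derivative_iff)
        then show ?thesis
          using X unfolding tendsto_at_iff_sequentially comp_def by auto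
      qed
      have m1: "(\<lambda>x. (f (X i) x - f u x) / (X i - u)) \<in> borel_measurable M" for i
      proof (intro borel_measurable_divide borel_measurable_diff meas u rU)
        have "X i \<in> ball u r" using X(1) by blast
        then show "dist u (X i) < 2 * r" using r by auto
      qed auto
      have "(\<lambda>i. \<integral>x. (f (X i) x - f u x) / (X i - u) \<partial>M) \<longlonglongrightarrow> (\<integral>x. deriv (\<lambda>u. f u x) u \<partial>M)"
      proof (rule integral_dominated_convergence[where w = "\<lambda>x. g x / (r/2)"])
        show "(\<lambda>x. deriv (\<lambda>u. f u x) u) \<in> borel_measurable M"
          by (rule borel_measurable_LIMSEQ_metric[OF m1 lim])
        show "AE x in M. norm ((f (X i) x - f u x) / (X i - u)) \<le> g x / (r/2)" for i
        proof (rule AE_I2)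
          fix x assume "x \<in> space M"
          from lip[OF this, of "X i"] X(1) have "norm (f (X i) x - f u x) \<le> g x / (r / 2) * norm (X i - u)"
            by blast
          moreover have "norm (X i - u) > 0" using X(1) by auto
          ultimately show "norm ((f (X i) x - f u x) / (X i - u)) \<le> g x / (r/2)"
            by (simp add: norm_divide divide_le_eq)
        qed
        show "AE x in M. (\<lambda>i. (f (X i) x - f u x) / (X i - u)) \<longlonglongrightarrow> deriv (\<lambda>u. f u x) u"
          using lim by auto
      qed (use g m1 in auto)
      moreover have "(\<integral>x. (f (X i) x - f u x) / (X i - u) \<partial>M) =
          ((\<integral>x. f (X i) x \<partial>M) - (\<integral>x. f u x \<partial>M)) / (X i - u)" for i
        using int[of "X i"] int[of u] X(1) r by (simp add: Bochner_Integration.integral_diff)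
      ultimately show "(\<lambda>i. ((\<integral>x. f (X i) x \<partial>M) - (\<integral>x. f u x \<partial>M)) / (X i - u))
          \<longlonglongrightarrow> (\<integral>x. deriv (\<lambda>u. f u x) u \<partial>M)" by (simp only:)
    qed
    then have "((\<lambda>u. \<integral>x. f u x \<partial>M) has_field_derivative (\<integral>x. deriv (\<lambda>u. f u x) u \<partial>M)) (at u within ball u r)"
      by (simp add: has_field_derivative_iff)
    then show ?thesis
      using r at_within_open[of u "ball u r"] by auto
  qed
  then show ?thesis
    unfolding holomorphic_on_def field_differentiable_def
    using has_field_derivative_at_within by blast
qed

text \<open>Meromorphy leaves the values at isolated points free, so the identity theorem makes two
  of the given continuations agree only on punctured neighbourhoods. The glued function picks an
  index \<open>m z\<close> at every point; near a given point it coincides, off that point, with one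
  fixed continuation.\<close>

lemma meromorphic_on_exhaustion:
  fixes f :: "complex \<Rightarrow> complex" and a :: real
  assumes "\<And>M::nat. \<exists>g. g meromorphic_on {z. Re z > - real M} \<and> (\<forall>z. Re z > a \<longrightarrow> g z = f z)"
  shows "\<exists>Z. Z meromorphic_on UNIV \<and> (\<forall>z. Re z > a \<longrightarrow> Z z = f z)"
proof -
  define H where "H = (\<lambda>M::nat. {z::complex. Re z > - real M})"
  obtain g where g: "\<And>M. g M meromorphic_on H M" and gf: "\<And>M z. Re z > a \<Longrightarrow> g M z = f z"
    using assms unfolding H_def by metis
  have opn: "open (H M)" for M unfolding H_def by (rule open_halfspace_Re_gt)
  have con: "connected (H M)" for M
    unfolding H_def by (intro convex_connected convex_halfspace_Re_gt)
  have agree: "\<forall>\<^sub>F w in at z. g M w = g N w" if z: "z \<in> H M" "M \<le> N" for z M N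
  proof -
    have HN: "H M \<subseteq> H N" using that by (auto simp: H_def)
    define d where "d = (\<lambda>w. g M w - g N w)"
    have d: "d meromorphic_on H M"
      unfolding d_def using g[of M] meromorphic_on_subset[OF g[of N] HN] by (intro meromorphic_intros)
    \<comment> \<open>A point around which both functions equal \<open>f\<close>; the
      \<open>max 0 a\<close> places it in every half-plane \<open>H M\<close>, including
      \<open>H 0\<close>.\<close>
    define c :: complex where "c = of_real (max 0 a + 1)"
    have cH: "c \<in> H M" by (auto simp: H_def c_def)
    have ev0: "\<forall>\<^sub>F w in at c. d w = 0"
    proof -
      have "\<forall>\<^sub>F w in at c. w \<in> {z. Re z > a}"
        by (rule eventually_at_in_open') (auto simp: c_def open_halfspace_Re_gt)
      then show ?thesis by eventually_elim (auto simp: d_def gf)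
    qed
    have evr: "\<forall>\<^sub>F w in at y. remove_sings d w = d w" if "y \<in> H M" for y
      using d that unfolding meromorphic_on_altdef by (blast intro: eventually_remove_sings_eq_at)
    have "\<forall>\<^sub>F w in at c. remove_sings d w = 0"
      using evr[OF cH] ev0 by eventually_elim simp
    then have fr: "\<exists>\<^sub>F w in at c. remove_sings d w = 0"
      by (intro eventually_frequently) auto
    \<comment> \<open>After its singularities are removed the difference is nicely meromorphic, and
      for such functions the identity theorem holds at every point.\<close>
    have zero: "remove_sings d w = 0" if "w \<in> H M" for w
      by (rule frequently_eq_meromorphic_imp_constant[OF fr remove_sings_nicely_meromorphic[OF d] opn con cH that])
    have "\<forall>\<^sub>F w in at z. w \<in> H M"
      using z opn by (intro eventually_at_in_open') auto
    then show ?thesis using evr[OF z(1)]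
      by eventually_elim (use zero in \<open>auto simp: d_def\<close>)
  qed
  \<comment> \<open>The \<open>+ 2\<close> is room for moving by less than 1: a point
    \<open>w\<close> near \<open>z0\<close> satisfies \<open>m w \<le> N\<close>, and
    \<open>z0\<close> itself lies in \<open>H (m w)\<close>. So only finitely many of the
    \<open>g M\<close> enter \<open>Z\<close> near \<open>z0\<close>.\<close>
  define m where "m = (\<lambda>z. nat \<lceil>\<bar>Re z\<bar>\<rceil> + 2)"
  define Z where "Z = (\<lambda>z. g (m z) z)"
  have "Z meromorphic_on UNIV"
  proof (subst meromorphic_on_meromorphic_at, safe)
    fix z0 :: complex
    define N where "N = m z0 + 2"
    have z0N: "z0 \<in> H N" unfolding H_def N_def m_def by (simp, linarith)
    have "\<forall>\<^sub>F w in at z0. \<forall>M\<in>{M. M \<le> N \<and> z0 \<in> H M}. g M w = g N w"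
    proof (rule eventually_ball_finite)
      show "finite {M. M \<le> N \<and> z0 \<in> H M}"
        by (rule finite_subset[of _ "{..N}"]) auto
      show "\<forall>M\<in>{M. M \<le> N \<and> z0 \<in> H M}. \<forall>\<^sub>F w in at z0. g M w = g N w"
      proof
        fix M assume "M \<in> {M. M \<le> N \<and> z0 \<in> H M}"
        then have 1: "z0 \<in> H M" and 2: "M \<le> N" by blast+
        show "\<forall>\<^sub>F w in at z0. g M w = g N w" by (rule agree[OF 1 2])
      qed
    qed
    moreover have "\<forall>\<^sub>F w in at z0. w \<in> ball z0 1"
      by (rule eventually_at_in_open') auto
    ultimately have "\<forall>\<^sub>F w in at z0. Z w = g N w"
    proof eventually_elim
      case (elim w)
      have "\<bar>Re w - Re z0\<bar> < 1"
        using elim(2) abs_Re_le_cmod[of "w - z0"] by (auto simp: dist_norm norm_minus_commute)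
      then have "m w \<le> N" "z0 \<in> H (m w)"
        unfolding H_def N_def m_def by (simp_all, linarith+)
      then show ?case using elim(1) by (auto simp: Z_def)
    qed
    then show "Z meromorphic_on {z0}"
      using meromorphic_on_cong[of "{z0}" Z "g N" "{z0}"] meromorphic_on_subset[OF g[of N]] z0N by auto
  qed
  then show ?thesis using gf by (auto simp: Z_def)
qed

section \<open>Mellin transforms on the unit interval\<close>

definition half_plane :: "nat \<Rightarrow> complex set" where
  "half_plane M = {z. Re z > - real M}"

lemma open_half_plane [simp]: "open (half_plane M)"
  unfolding half_plane_def by (rule open_halfspace_Re_gt)

lemma in_half_plane: "Re u > 1 \<Longrightarrow> u \<in> half_plane M"
  by (simp add: half_plane_def)

text \<open>Blow-up of order at most \<open>N\<close> at the origin, locally uniformly in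
  \<open>u\<close>. The interval extends to 2 because the scaling relation evaluates functions at
  \<open>2 * x\<close> for \<open>x < 1\<close>.\<close>

definition growth :: "nat \<Rightarrow> nat \<Rightarrow> (complex \<Rightarrow> real \<Rightarrow> complex) \<Rightarrow> bool" where
  "growth M N \<Phi> \<longleftrightarrow>
     (\<forall>u\<in>half_plane M. continuous_on {0<..2} (\<Phi> u)) \<and>
     (\<forall>x\<in>{0<..2}. (\<lambda>u. \<Phi> u x) holomorphic_on half_plane M) \<and>
     (\<forall>u\<in>half_plane M. \<exists>r C. r > 0 \<and>
        (\<forall>w\<in>ball u r \<inter> half_plane M. \<forall>x\<in>{0<..2}. norm (\<Phi> w x) * x ^ N \<le> C))"

text \<open>The first clause allows \<open>N\<close> to depend on the half-plane; the second gives
  actual boundedness where \<open>Re u > 1\<close>, so that the Mellin integrals converge there for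
  every shift.\<close>

definition tame :: "nat \<Rightarrow> (complex \<Rightarrow> real \<Rightarrow> complex) \<Rightarrow> bool" where
  "tame M \<Phi> \<longleftrightarrow> (\<exists>N. growth M N \<Phi>) \<and>
     (\<forall>u. Re u > 1 \<longrightarrow> (\<exists>C. \<forall>x\<in>{0<..2}. norm (\<Phi> u x) \<le> C))"

text \<open>An asymptotic power series at 0, locally uniform in \<open>u\<close>. Coefficients and
  remainder are chosen anew for each order \<open>K\<close>, which is enough since each application
  fixes one order.\<close>

definition expands :: "nat \<Rightarrow> (complex \<Rightarrow> real \<Rightarrow> complex) \<Rightarrow> bool" where
  "expands M F \<longleftrightarrow> (\<forall>K::nat. \<exists>e R. (\<forall>k<K. e k holomorphic_on half_plane M) \<and> growth M 0 R \<and>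
     (\<forall>u\<in>half_plane M. \<forall>x\<in>{0<..2}.
        F u x = (\<Sum>k<K. e k u * of_real x ^ k) + of_real x ^ K * R u x))"

text \<open>The final kernel contains \<open>x powr (u - 1) / (2 sinh x)\<close>, that is,
  \<open>x powr (u - 2)\<close> times the regular factor \<open>x / (2 sinh x)\<close>; this is the
  origin of the \<open>- 2\<close>. The shift \<open>j\<close> absorbs the powers of
  \<open>x\<close> from expansions.\<close>

definition mellin_term :: "(complex \<Rightarrow> real \<Rightarrow> complex) \<Rightarrow> nat \<Rightarrow> complex \<Rightarrow> real \<Rightarrow> complex" where
  "mellin_term \<Phi> j u x = of_real x powr (u - 2 + of_nat j) * \<Phi> u x"

text \<open>Quantifying over all shifts \<open>j\<close> makes the property stable under
  multiplication by powers of \<open>x\<close>. Only the unit interval matters here; the rest of the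
  half-line is treated separately.\<close>

definition continuable :: "nat \<Rightarrow> (complex \<Rightarrow> real \<Rightarrow> complex) \<Rightarrow> bool" where
  "continuable M \<Phi> \<longleftrightarrow> (\<forall>j. \<exists>g. g meromorphic_on half_plane M \<and>
     (\<forall>u. Re u > 1 \<longrightarrow> g u = (LINT x:{0<..<1}|lborel. mellin_term \<Phi> j u x)))"

section \<open>Algebra of the growth classes\<close>

lemma growth_mult:
  assumes "growth M N \<Phi>" "growth M N' \<Psi>"
  shows "growth M (N + N') (\<lambda>u x. \<Phi> u x * \<Psi> u x)"
  unfolding growth_def
proof (intro conjI ballI)
  fix u assume u: "u \<in> half_plane M"
  obtain r C where r: "r > 0" "\<And>w x. w \<in> ball u r \<inter> half_plane M \<Longrightarrow> x \<in> {0<..2} \<Longrightarrow> norm (\<Phi> w x) * x ^ N \<le> C"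
    using assms(1) u unfolding growth_def by blast
  obtain r' C' where r': "r' > 0" "\<And>w x. w \<in> ball u r' \<inter> half_plane M \<Longrightarrow> x \<in> {0<..2} \<Longrightarrow> norm (\<Psi> w x) * x ^ N' \<le> C'"
    using assms(2) u unfolding growth_def by blast
  show "\<exists>r C. r > 0 \<and> (\<forall>w\<in>ball u r \<inter> half_plane M. \<forall>x\<in>{0<..2}. norm (\<Phi> w x * \<Psi> w x) * x ^ (N+N') \<le> C)"
  proof (intro exI conjI ballI)
    fix w x assume w: "w \<in> ball u (min r r') \<inter> half_plane M" and x: "x \<in> {0<..2::real}"
    have "norm (\<Phi> w x * \<Psi> w x) * x ^ (N+N') = (norm (\<Phi> w x) * x ^ N) * (norm (\<Psi> w x) * x ^ N')"
      by (simp add: norm_mult power_add)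
    also have "\<dots> \<le> C * C'"
    proof (rule mult_mono')
      show "norm (\<Phi> w x) * x ^ N \<le> C" using r(2)[of w x] w x by simp
      show "norm (\<Psi> w x) * x ^ N' \<le> C'" using r'(2)[of w x] w x by simp
    qed (use x in auto)
    finally show "norm (\<Phi> w x * \<Psi> w x) * x ^ (N+N') \<le> C * C'" .
  qed (use r r' in simp)
qed (use assms in \<open>auto simp: growth_def intro!: continuous_intros holomorphic_intros\<close>)

lemma growth_mono:
  assumes "growth M N \<Phi>" "N \<le> N'"
  shows "growth M N' \<Phi>"
  unfolding growth_def
proof (intro conjI ballI)
  fix u assume u: "u \<in> half_plane M"
  obtain r C where r: "r > 0" "\<And>w x. w \<in> ball u r \<inter> half_plane M \<Longrightarrow> x \<in> {0<..2} \<Longrightarrow> norm (\<Phi> w x) * x ^ N \<le> C"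
    using assms(1) u unfolding growth_def by blast
  show "\<exists>r C. r > 0 \<and> (\<forall>w\<in>ball u r \<inter> half_plane M. \<forall>x\<in>{0<..2}. norm (\<Phi> w x) * x ^ N' \<le> C)"
  proof (intro exI conjI ballI)
    fix w x assume w: "w \<in> ball u r \<inter> half_plane M" and x: "x \<in> {0<..2::real}"
    have "norm (\<Phi> w x) * x ^ N' = (norm (\<Phi> w x) * x ^ N) * x ^ (N' - N)"
      using assms(2) by (simp add: power_add[symmetric])
    also have "\<dots> \<le> C * 2 ^ (N' - N)"
      using r(2)[OF w x] x by (intro mult_mono' power_mono) auto
    finally show "norm (\<Phi> w x) * x ^ N' \<le> C * 2 ^ (N' - N)" .
  qed (use r in simp)
qed (use assms in \<open>auto simp: growth_def\<close>)

lemma growth_add: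
  assumes "growth M N \<Phi>" "growth M N \<Psi>"
  shows "growth M N (\<lambda>u x. \<Phi> u x + \<Psi> u x)"
  unfolding growth_def
proof (intro conjI ballI)
  fix u assume u: "u \<in> half_plane M"
  obtain r C where r: "r > 0" "\<And>w x. w \<in> ball u r \<inter> half_plane M \<Longrightarrow> x \<in> {0<..2} \<Longrightarrow> norm (\<Phi> w x) * x ^ N \<le> C"
    using assms(1) u unfolding growth_def by blast
  obtain r' C' where r': "r' > 0" "\<And>w x. w \<in> ball u r' \<inter> half_plane M \<Longrightarrow> x \<in> {0<..2} \<Longrightarrow> norm (\<Psi> w x) * x ^ N \<le> C'"
    using assms(2) u unfolding growth_def by blast
  show "\<exists>r C. r > 0 \<and> (\<forall>w\<in>ball u r \<inter> half_plane M. \<forall>x\<in>{0<..2}. norm (\<Phi> w x + \<Psi> w x) * x ^ N \<le> C)"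
  proof (intro exI conjI ballI)
    fix w x assume w: "w \<in> ball u (min r r') \<inter> half_plane M" and x: "x \<in> {0<..2::real}"
    have "norm (\<Phi> w x + \<Psi> w x) * x ^ N \<le> (norm (\<Phi> w x) + norm (\<Psi> w x)) * x ^ N"
      using x by (intro mult_right_mono norm_triangle_ineq) auto
    also have "\<dots> \<le> C + C'"
      using r(2)[of w x] r'(2)[of w x] w x by (simp add: distrib_right)
    finally show "norm (\<Phi> w x + \<Psi> w x) * x ^ N \<le> C + C'" .
  qed (use r r' in simp)
qed (use assms in \<open>auto simp: growth_def intro!: continuous_intros holomorphic_intros\<close>)

lemma growth_const:
  assumes "c holomorphic_on half_plane M"
  shows "growth M 0 (\<lambda>u x. c u)"
  unfolding growth_def
proof (intro conjI ballI)
  fix u assume u: "u \<in> half_plane M"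
  have "continuous_on (half_plane M) c" by (rule holomorphic_on_imp_continuous_on[OF assms])
  then have "isCont c u" using u by (simp add: continuous_on_eq_continuous_at)
  then have "\<exists>r>0. \<forall>w. dist w u < r \<longrightarrow> dist (c w) (c u) < 1"
    unfolding continuous_at_eps_delta by (rule allE[where x = 1]) simp
  then obtain r where r: "r > 0" "\<And>w. dist w u < r \<Longrightarrow> dist (c w) (c u) < 1"
    by blast
  show "\<exists>r C. r > 0 \<and> (\<forall>w\<in>ball u r \<inter> half_plane M. \<forall>x\<in>{0<..2::real}. norm (c w) * x ^ 0 \<le> C)"
  proof (intro exI conjI ballI)
    fix w and x :: real assume w: "w \<in> ball u r \<inter> half_plane M"
    then have "norm (c w - c u) < 1" using r(2)[of w] by (auto simp: dist_norm norm_minus_commute)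
    then show "norm (c w) * x ^ 0 \<le> norm (c u) + 1"
      using norm_triangle_sub[of "c w" "c u"] by simp
  qed (use r in simp)
qed (use assms in \<open>auto intro!: continuous_intros\<close>)

lemma tame_mult:
  assumes "tame M \<Phi>" "tame M \<Psi>"
  shows "tame M (\<lambda>u x. \<Phi> u x * \<Psi> u x)"
  unfolding tame_def
proof (intro conjI allI impI)
  show "\<exists>N. growth M N (\<lambda>u x. \<Phi> u x * \<Psi> u x)"
    using assms growth_mult unfolding tame_def by blast
  fix u :: complex assume u: "Re u > 1"
  obtain C C' where "\<And>x. x \<in> {0<..2} \<Longrightarrow> norm (\<Phi> u x) \<le> C" "\<And>x. x \<in> {0<..2} \<Longrightarrow> norm (\<Psi> u x) \<le> C'"
    using assms u unfolding tame_def by metis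
  then show "\<exists>C. \<forall>x\<in>{0<..2}. norm (\<Phi> u x * \<Psi> u x) \<le> C"
    by (intro exI[of _ "C * C'"]) (auto simp: norm_mult intro!: mult_mono')
qed

lemma tame_add:
  assumes "tame M \<Phi>" "tame M \<Psi>"
  shows "tame M (\<lambda>u x. \<Phi> u x + \<Psi> u x)"
  unfolding tame_def
proof (intro conjI allI impI)
  obtain N N' where "growth M N \<Phi>" "growth M N' \<Psi>" using assms unfolding tame_def by blast
  then have "growth M (max N N') (\<lambda>u x. \<Phi> u x + \<Psi> u x)"
    by (intro growth_add) (auto elim: growth_mono)
  then show "\<exists>N. growth M N (\<lambda>u x. \<Phi> u x + \<Psi> u x)" by blast
  fix u :: complex assume u: "Re u > 1"
  obtain C C' where "\<And>x. x \<in> {0<..2} \<Longrightarrow> norm (\<Phi> u x) \<le> C" "\<And>x. x \<in> {0<..2} \<Longrightarrow> norm (\<Psi> u x) \<le> C'"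
    using assms u unfolding tame_def by metis
  then show "\<exists>C. \<forall>x\<in>{0<..2}. norm (\<Phi> u x + \<Psi> u x) \<le> C"
    by (intro exI[of _ "C + C'"]) (auto intro!: norm_triangle_mono)
qed

lemma growth_0_imp_tame:
  assumes "growth M 0 \<Phi>"
  shows "tame M \<Phi>"
  unfolding tame_def
proof (intro conjI allI impI)
  fix u :: complex assume u: "Re u > 1"
  then have u: "u \<in> half_plane M" by (rule in_half_plane)
  then obtain r C where "r > 0" and "\<forall>w\<in>ball u r \<inter> half_plane M. \<forall>x\<in>{0<..2}. norm (\<Phi> w x) * x ^ 0 \<le> C"
    using assms unfolding growth_def by blast
  moreover have "u \<in> ball u r \<inter> half_plane M" using u \<open>r > 0\<close> by simp
  ultimately have "\<forall>x\<in>{0<..2}. norm (\<Phi> u x) * x ^ 0 \<le> C" by blast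
  then have "\<forall>x\<in>{0<..2}. norm (\<Phi> u x) \<le> C" by simp
  then show "\<exists>C. \<forall>x\<in>{0<..2}. norm (\<Phi> u x) \<le> C" by blast
qed (use assms in blast)

lemma tame_const:
  assumes "c holomorphic_on half_plane M"
  shows "tame M (\<lambda>u x. c u)"
  by (rule growth_0_imp_tame[OF growth_const[OF assms]])

lemma expands_imp_tame:
  assumes "expands M F"
  shows "tame M F"
proof -
  \<comment> \<open>At order 0 the sum is empty and the expansion reads
    \<open>F = R\<close>.\<close>
  obtain R where R: "growth M 0 R" "\<And>u x. u \<in> half_plane M \<Longrightarrow> x \<in> {0<..2} \<Longrightarrow> F u x = R u x"
    using assms unfolding expands_def by (drule_tac spec[of _ 0]) auto
  have "growth M 0 F"
    unfolding growth_def
  proof (intro conjI ballI)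
    fix u assume u: "u \<in> half_plane M"
    show "continuous_on {0<..2} (F u)"
    proof (subst continuous_on_cong[OF refl R(2)[OF u]])
      show "continuous_on {0<..2} (R u)" using R(1) u unfolding growth_def by blast
    qed
    obtain r C where "r > 0" "\<forall>w\<in>ball u r \<inter> half_plane M. \<forall>x\<in>{0<..2}. norm (R w x) * x ^ 0 \<le> C"
      using R(1) u unfolding growth_def by blast
    then show "\<exists>r C. r > 0 \<and> (\<forall>w\<in>ball u r \<inter> half_plane M. \<forall>x\<in>{0<..2}. norm (F w x) * x ^ 0 \<le> C)"
      using R(2) by auto
  next
    fix x :: real assume x: "x \<in> {0<..2}"
    have "(\<lambda>u. R u x) holomorphic_on half_plane M" using R(1) x unfolding growth_def by blast
    then show "(\<lambda>u. F u x) holomorphic_on half_plane M"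
      by (rule holomorphic_transform) (rule R(2)[OF _ x, symmetric])
  qed
  then show ?thesis by (rule growth_0_imp_tame)
qed

section \<open>Mellin integrals over the intervals (0, 1) and (1, 2)\<close>

lemma set_integrable_powr_unit_interval:
  fixes c :: real
  assumes "c > -1"
  shows "set_integrable lborel {0<..<1} (\<lambda>x. x powr c)"
proof -
  have 1: "((\<lambda>x. x powr c) has_integral (1 powr (c + 1) / (c + 1))) {0..1}"
    using has_integral_powr_from_0[of c 1] assms by simp
  then have "(\<lambda>x. x powr c) absolutely_integrable_on {0..1}"
    by (intro nonnegative_absolutely_integrable_1) (auto simp: has_integral_integrable)
  then have "(\<lambda>x. x powr c) absolutely_integrable_on {0<..<1}"
    by (rule set_integrable_subset) auto
  then show ?thesis
    unfolding set_integrable_def by (subst (asm) integrable_completion) auto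
qed

lemma norm_of_real_powr: "x > 0 \<Longrightarrow> norm (complex_of_real x powr z) = x powr Re z"
  by (simp add: norm_powr_real_powr)

lemma mellin_term_measurable:
  assumes "tame M \<Phi>" "u \<in> half_plane M" "A \<in> sets borel" "A \<subseteq> {0<..2}"
  shows "set_borel_measurable borel A (mellin_term \<Phi> j u)"
proof -
  have "continuous_on {0<..2} (mellin_term \<Phi> j u)"
    using assms(1,2) unfolding mellin_term_def tame_def growth_def
    by (auto intro!: continuous_intros)
  then have "continuous_on A (mellin_term \<Phi> j u)"
    using assms(4) continuous_on_subset by blast
  then show ?thesis
    unfolding set_borel_measurable_def by (rule borel_measurable_continuous_on_indicator[OF assms(3)])
qed

lemma mellin_term_integrable:
  assumes "tame M \<Phi>" "Re u > 1"
  shows "set_integrable lborel {0<..<1} (mellin_term \<Phi> j u)"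
    and "set_integrable lborel {1..<2} (mellin_term \<Phi> j u)"
proof -
  obtain C where C: "\<And>x. x \<in> {0<..2} \<Longrightarrow> norm (\<Phi> u x) \<le> C"
    using assms unfolding tame_def by blast
  have C0: "C \<ge> 0" using order.trans[OF norm_ge_zero C[of 1]] by simp
  show "set_integrable lborel {0<..<1} (mellin_term \<Phi> j u)"
  proof (rule set_integrable_bound)
    show "set_integrable lborel {0<..<1} (\<lambda>x. C * x powr (Re u - 2))"
      using assms(2) by (intro set_integrable_mult_right) (auto intro!: set_integrable_powr_unit_interval)
    show "set_borel_measurable lborel {0<..<1} (mellin_term \<Phi> j u)"
      using mellin_term_measurable[OF assms(1) in_half_plane[OF assms(2)], of "{0<..<1}" j]
      by (simp add: set_borel_measurable_def greaterThanLessThan_subseteq_greaterThanAtMost_iff)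
    have "norm (mellin_term \<Phi> j u x) \<le> norm (C * x powr (Re u - 2))" if "x \<in> {0<..<1}" for x
    proof -
      have "norm (mellin_term \<Phi> j u x) = x powr (Re u - 2 + j) * norm (\<Phi> u x)"
        using that by (simp add: mellin_term_def norm_mult norm_of_real_powr)
      also have "\<dots> \<le> x powr (Re u - 2) * C"
        using that C[of x] by (intro mult_mono powr_mono') auto
      finally show ?thesis using C0 by (simp add: mult.commute)
    qed
    then show "AE x in lborel. x \<in> {0<..<1} \<longrightarrow> norm (mellin_term \<Phi> j u x) \<le> norm (C * x powr (Re u - 2))"
      by auto
  qed
  have "continuous_on {1..2} (mellin_term \<Phi> j u)"
    using in_half_plane[OF assms(2), of M] assms(1) unfolding mellin_term_def tame_def growth_def
    by (auto intro!: continuous_intros elim!: continuous_on_subset)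
  then have "set_integrable lborel {1..2} (mellin_term \<Phi> j u)"
    by (rule borel_integrable_atLeastAtMost')
  then show "set_integrable lborel {1..<2} (mellin_term \<Phi> j u)"
    by (rule set_integrable_subset) auto
qed

lemma continuable_add:
  assumes "tame M \<Phi>" "tame M \<Psi>" "continuable M \<Phi>" "continuable M \<Psi>"
  shows "continuable M (\<lambda>u x. \<Phi> u x + \<Psi> u x)"
  unfolding continuable_def
proof
  fix j
  obtain g where g: "g meromorphic_on half_plane M" "\<And>u. Re u > 1 \<Longrightarrow> g u = (LINT x:{0<..<1}|lborel. mellin_term \<Phi> j u x)"
    using assms(3) unfolding continuable_def by blast
  obtain h where h: "h meromorphic_on half_plane M" "\<And>u. Re u > 1 \<Longrightarrow> h u = (LINT x:{0<..<1}|lborel. mellin_term \<Psi> j u x)"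
    using assms(4) unfolding continuable_def by blast
  have "mellin_term (\<lambda>u x. \<Phi> u x + \<Psi> u x) j u = (\<lambda>x. mellin_term \<Phi> j u x + mellin_term \<Psi> j u x)" for u
    by (auto simp: mellin_term_def algebra_simps)
  then have "g u + h u = (LINT x:{0<..<1}|lborel. mellin_term (\<lambda>u x. \<Phi> u x + \<Psi> u x) j u x)" if "Re u > 1" for u
    using that by (simp add: g(2) h(2) set_integral_add(2) mellin_term_integrable(1)[OF assms(1)] mellin_term_integrable(1)[OF assms(2)])
  then show "\<exists>g. g meromorphic_on half_plane M \<and>
     (\<forall>u. Re u > 1 \<longrightarrow> g u = (LINT x:{0<..<1}|lborel. mellin_term (\<lambda>u x. \<Phi> u x + \<Psi> u x) j u x))"
    using g(1) h(1) by (intro exI[of _ "\<lambda>u. g u + h u"]) (auto intro!: meromorphic_intros)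
qed

text \<open>The factor \<open>x ^ k\<close> turns the shift \<open>j\<close> into
  \<open>j + k\<close>, and the coefficient \<open>c u\<close> leaves the integral.\<close>

lemma continuable_cmult:
  assumes "continuable M \<Phi>" "c holomorphic_on half_plane M"
  shows "continuable M (\<lambda>u x. c u * of_real x ^ k * \<Phi> u x)"
  unfolding continuable_def
proof
  fix j
  obtain g where g: "g meromorphic_on half_plane M" "\<And>u. Re u > 1 \<Longrightarrow> g u = (LINT x:{0<..<1}|lborel. mellin_term \<Phi> (j + k) u x)"
    using assms(1) unfolding continuable_def by blast
  have c: "c meromorphic_on half_plane M"
    using assms(2) by (simp add: analytic_on_imp_meromorphic_on analytic_on_open)
  have "(LINT x:{0<..<1}|lborel. mellin_term (\<lambda>u x. c u * of_real x ^ k * \<Phi> u x) j u x) = c u * g u" if "Re u > 1" for u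
  proof -
    have "(LINT x:{0<..<1}|lborel. mellin_term (\<lambda>u x. c u * of_real x ^ k * \<Phi> u x) j u x) =
          (LINT x:{0<..<1}|lborel. c u * mellin_term \<Phi> (j + k) u x)"
    proof (rule set_lebesgue_integral_cong)
      show "\<forall>x. x \<in> {0<..<1} \<longrightarrow> mellin_term (\<lambda>u x. c u * of_real x ^ k * \<Phi> u x) j u x = c u * mellin_term \<Phi> (j + k) u x"
        by (auto simp: mellin_term_def powr_add powr_nat' add.assoc[symmetric])
    qed auto
    then show ?thesis using that by (simp add: g(2))
  qed
  then show "\<exists>g. g meromorphic_on half_plane M \<and>
     (\<forall>u. Re u > 1 \<longrightarrow> g u = (LINT x:{0<..<1}|lborel. mellin_term (\<lambda>u x. c u * of_real x ^ k * \<Phi> u x) j u x))"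
    using g(1) c by (intro exI[of _ "\<lambda>u. c u * g u"]) (auto intro!: meromorphic_intros)
qed

text \<open>For \<open>Re u > - M\<close> and \<open>j \<ge> N + M + 2\<close> the exponent
  \<open>Re u - 2 + j\<close> exceeds \<open>N\<close> and thus compensates the blow-up of
  \<open>\<Phi>\<close>: the integrand is bounded, locally uniformly in \<open>u\<close>, and the
  integral itself is the continuation.\<close>

lemma mellin_holomorphic:
  assumes "growth M N \<Phi>" "j \<ge> N + M + 2"
  shows "(\<lambda>u. LINT x:{0<..<1}|lborel. mellin_term \<Phi> j u x) holomorphic_on half_plane M"
proof -
  have "(\<lambda>u. \<integral>x. mellin_term \<Phi> j u x \<partial>restrict_space lborel {0<..<1}) holomorphic_on half_plane M"
  proof (rule holomorphic_on_lebesgue_integral)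
    fix u assume u: "u \<in> half_plane M"
    have "continuous_on {0<..2} (mellin_term \<Phi> j u)"
      using assms(1) u unfolding mellin_term_def growth_def by (auto intro!: continuous_intros)
    then have "continuous_on {0<..<1} (mellin_term \<Phi> j u)"
      by (rule continuous_on_subset) auto
    from borel_measurable_continuous_on_restrict[OF this]
    show "mellin_term \<Phi> j u \<in> borel_measurable (restrict_space lborel {0<..<1})"
      by (simp cong: measurable_cong_sets add: sets_restrict_space_cong[OF sets_lborel])
  next
    fix x assume "x \<in> space (restrict_space lborel {0<..<1::real})"
    then have "x \<in> {0<..2}" by (simp add: space_restrict_space)
    then have "(\<lambda>u. \<Phi> u x) holomorphic_on half_plane M" using assms(1) unfolding growth_def by blast
    then show "(\<lambda>u. mellin_term \<Phi> j u x) holomorphic_on half_plane M"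
      unfolding mellin_term_def by (intro holomorphic_intros)
  next
    fix u assume u: "u \<in> half_plane M"
    then obtain r C where r: "r > 0" "\<And>w x. w \<in> ball u r \<inter> half_plane M \<Longrightarrow> x \<in> {0<..2} \<Longrightarrow> norm (\<Phi> w x) * x ^ N \<le> C"
      using assms(1) unfolding growth_def by blast
    have "norm (mellin_term \<Phi> j w x) \<le> C" if w: "w \<in> ball u r \<inter> half_plane M" and x: "x \<in> {0<..<1}" for w x
    proof -
      have "norm (mellin_term \<Phi> j w x) = x powr (Re w - 2 + j) * norm (\<Phi> w x)"
        using x by (simp add: mellin_term_def norm_mult norm_of_real_powr)
      also have "\<dots> \<le> x powr (real N) * norm (\<Phi> w x)"
        using x w assms(2) by (intro mult_right_mono powr_mono') (auto simp: half_plane_def)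
      also have "\<dots> = norm (\<Phi> w x) * x ^ N" using x by (simp add: powr_realpow)
      also have "\<dots> \<le> C" using r(2)[of w x] w x by auto
      finally show ?thesis .
    qed
    moreover have "integrable (restrict_space lborel {0<..<1::real}) (\<lambda>x. C)"
      by (subst integrable_restrict_space) (auto intro!: integrable_real_indicator integrable_mult_left)
    ultimately show "\<exists>r g. 0 < r \<and> integrable (restrict_space lborel {0<..<1}) g \<and>
       (\<forall>w\<in>ball u r \<inter> half_plane M. \<forall>x\<in>space (restrict_space lborel {0<..<1}). norm (mellin_term \<Phi> j w x) \<le> g x)"
      using r(1) by (intro exI[of _ r] exI[of _ "\<lambda>x. C"]) (auto simp: space_restrict_space)
  qed simp
  then show ?thesis
    by (simp add: integral_restrict_space set_lebesgue_integral_def)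
qed

lemma mellin_holomorphic_12:
  assumes "growth M N \<Phi>"
  shows "(\<lambda>u. LINT x:{1..<2}|lborel. mellin_term \<Phi> j u x) holomorphic_on half_plane M"
proof -
  have "(\<lambda>u. \<integral>x. mellin_term \<Phi> j u x \<partial>restrict_space lborel {1..<2}) holomorphic_on half_plane M"
  proof (rule holomorphic_on_lebesgue_integral)
    fix u assume u: "u \<in> half_plane M"
    have "continuous_on {0<..2} (mellin_term \<Phi> j u)"
      using assms(1) u unfolding mellin_term_def growth_def by (auto intro!: continuous_intros)
    then have "continuous_on {1..<2} (mellin_term \<Phi> j u)"
      by (rule continuous_on_subset) auto
    from borel_measurable_continuous_on_restrict[OF this]
    show "mellin_term \<Phi> j u \<in> borel_measurable (restrict_space lborel {1..<2})"
      by (simp cong: measurable_cong_sets add: sets_restrict_space_cong[OF sets_lborel])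
  next
    fix x assume "x \<in> space (restrict_space lborel {1..<2::real})"
    then have "x \<in> {0<..2}" by (simp add: space_restrict_space)
    then have "(\<lambda>u. \<Phi> u x) holomorphic_on half_plane M" using assms(1) unfolding growth_def by blast
    then show "(\<lambda>u. mellin_term \<Phi> j u x) holomorphic_on half_plane M"
      unfolding mellin_term_def by (intro holomorphic_intros)
  next
    fix u assume u: "u \<in> half_plane M"
    then obtain r C where r: "r > 0" "\<And>w x. w \<in> ball u r \<inter> half_plane M \<Longrightarrow> x \<in> {0<..2} \<Longrightarrow> norm (\<Phi> w x) * x ^ N \<le> C"
      using assms(1) unfolding growth_def by blast
    \<comment> \<open>For \<open>w\<close> in \<open>ball u r\<close> the exponent
      \<open>Re w - 2 + j\<close> is at most \<open>norm u + r + j\<close>, and \<open>x\<close>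
      stays between 1 and 2.\<close>
    define D where "D = 2 powr (norm u + r + j) * C"
    have "norm (mellin_term \<Phi> j w x) \<le> D" if w: "w \<in> ball u r \<inter> half_plane M" and x: "x \<in> {1..<2}" for w x
    proof -
      have n: "norm w \<le> norm u + r" using w norm_triangle_sub[of w u] by (auto simp: dist_norm norm_minus_commute)
      have "norm (mellin_term \<Phi> j w x) = x powr (Re w - 2 + j) * norm (\<Phi> w x)"
        using x by (simp add: mellin_term_def norm_mult norm_of_real_powr)
      also have "\<dots> \<le> 2 powr (norm u + r + j) * C"
      proof (rule mult_mono')
        have "x powr (Re w - 2 + j) \<le> x powr (norm u + r + j)"
          using x n complex_Re_le_cmod[of w] by (intro powr_mono) auto
        also have "\<dots> \<le> 2 powr (norm u + r + j)" using x r(1) by (intro powr_mono2) auto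
        finally show "x powr (Re w - 2 + j) \<le> 2 powr (norm u + r + j)" .
        have "norm (\<Phi> w x) * 1 \<le> norm (\<Phi> w x) * x ^ N" using x by (intro mult_left_mono) auto
        also have "\<dots> \<le> C" using r(2)[of w x] w x by auto
        finally show "norm (\<Phi> w x) \<le> C" by simp
      qed auto
      finally show ?thesis by (simp add: D_def)
    qed
    moreover have "integrable (restrict_space lborel {1..<2::real}) (\<lambda>x. D)"
      by (subst integrable_restrict_space) (auto intro!: integrable_real_indicator integrable_mult_left)
    ultimately show "\<exists>r g. 0 < r \<and> integrable (restrict_space lborel {1..<2}) g \<and>
       (\<forall>w\<in>ball u r \<inter> half_plane M. \<forall>x\<in>space (restrict_space lborel {1..<2}). norm (mellin_term \<Phi> j w x) \<le> g x)"
      using r(1) by (intro exI[of _ r] exI[of _ "\<lambda>x. D"]) (auto simp: space_restrict_space)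
  qed simp
  then show ?thesis
    by (simp add: integral_restrict_space set_lebesgue_integral_def)
qed

lemma continuable_growth_0:
  assumes "growth M N \<Phi>" "K \<ge> N + M + 2"
  shows "continuable M (\<lambda>u x. of_real x ^ K * \<Phi> u x)"
  unfolding continuable_def
proof
  fix j
  have eq: "(LINT x:{0<..<1}|lborel. mellin_term (\<lambda>u x. of_real x ^ K * \<Phi> u x) j u x) =
        (LINT x:{0<..<1}|lborel. mellin_term \<Phi> (j + K) u x)" for u
  proof (rule set_lebesgue_integral_cong)
    show "\<forall>x. x \<in> {0<..<1} \<longrightarrow> mellin_term (\<lambda>u x. of_real x ^ K * \<Phi> u x) j u x = mellin_term \<Phi> (j + K) u x"
      by (auto simp: mellin_term_def powr_add powr_nat' add.assoc[symmetric])
  qed auto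
  have "(\<lambda>u. LINT x:{0<..<1}|lborel. mellin_term \<Phi> (j + K) u x) meromorphic_on half_plane M"
    using mellin_holomorphic[OF assms(1), of "j + K"] assms(2)
    by (simp add: analytic_on_imp_meromorphic_on analytic_on_open)
  then show "\<exists>g. g meromorphic_on half_plane M \<and>
     (\<forall>u. Re u > 1 \<longrightarrow> g u = (LINT x:{0<..<1}|lborel. mellin_term (\<lambda>u x. of_real x ^ K * \<Phi> u x) j u x))"
    unfolding eq by blast
qed

lemma continuable_cong:
  assumes "\<And>u x. u \<in> half_plane M \<Longrightarrow> x \<in> {0<..2} \<Longrightarrow> \<Phi> u x = \<Psi> u x"
  shows "continuable M \<Phi> \<longleftrightarrow> continuable M \<Psi>"
proof -
  have "(LINT x:{0<..<1}|lborel. mellin_term \<Phi> j u x) = (LINT x:{0<..<1}|lborel. mellin_term \<Psi> j u x)"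
    if "Re u > 1" for j u
    by (rule set_lebesgue_integral_cong) (use assms[OF in_half_plane[OF that]] in \<open>auto simp: mellin_term_def\<close>)
  then show ?thesis unfolding continuable_def by auto
qed

lemma continuable_zero: "continuable M (\<lambda>u x. 0)"
  unfolding continuable_def mellin_term_def by (auto intro!: exI[of _ "\<lambda>_. 0"])

lemma tame_cmult_power:
  assumes "tame M \<Phi>" "c holomorphic_on half_plane M"
  shows "tame M (\<lambda>u x. c u * of_real x ^ k * \<Phi> u x)"
proof -
  have 1: "growth M 0 (\<lambda>u x. complex_of_real x ^ k)"
    unfolding growth_def
  proof (intro conjI ballI)
    fix u show "\<exists>r C. r > 0 \<and> (\<forall>w\<in>ball u r \<inter> half_plane M. \<forall>x\<in>{0<..2::real}. norm (complex_of_real x ^ k) * x ^ 0 \<le> C)"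
      by (rule exI[of _ 1], rule exI[of _ "2 ^ k"]) (auto simp: norm_power intro!: power_mono)
  qed (auto intro!: continuous_intros)
  show ?thesis
    by (rule tame_mult[OF tame_mult[OF tame_const[OF assms(2)] growth_0_imp_tame[OF 1]] assms(1)])
qed

text \<open>Truncate \<open>F\<close> at the order \<open>N + M + 2\<close>. The finitely many
  monomials only shift the exponent in the integrals of \<open>\<Phi>\<close>, and the remainder
  carries enough powers of \<open>x\<close> for \<open>mellin_holomorphic\<close>.\<close>

lemma continuable_expands_mult:
  assumes F: "expands M F" and \<Phi>: "tame M \<Phi>" "continuable M \<Phi>"
  shows "continuable M (\<lambda>u x. F u x * \<Phi> u x)"
proof -
  obtain N where N: "growth M N \<Phi>" using \<Phi>(1) unfolding tame_def by blast
  define K where "K = N + M + 2"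
  obtain e R where e: "\<And>k. k < K \<Longrightarrow> e k holomorphic_on half_plane M" and R: "growth M 0 R"
    and eq: "\<And>u x. u \<in> half_plane M \<Longrightarrow> x \<in> {0<..2} \<Longrightarrow>
        F u x = (\<Sum>k<K. e k u * of_real x ^ k) + of_real x ^ K * R u x"
    using F unfolding expands_def by (drule_tac spec[of _ K]) blast
  have "n \<le> K \<Longrightarrow> continuable M (\<lambda>u x. \<Sum>k<n. e k u * of_real x ^ k * \<Phi> u x) \<and>
      tame M (\<lambda>u x. \<Sum>k<n. e k u * of_real x ^ k * \<Phi> u x)" for n
  proof (induction n)
    case 0 then show ?case by (simp add: continuable_zero tame_const)
  next
    case (Suc n)
    then show ?case
      by (auto intro!: continuable_add tame_add continuable_cmult tame_cmult_power \<Phi> e)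
  qed
  then have s: "continuable M (\<lambda>u x. \<Sum>k<K. e k u * of_real x ^ k * \<Phi> u x)"
      "tame M (\<lambda>u x. \<Sum>k<K. e k u * of_real x ^ k * \<Phi> u x)" by auto
  have R\<Phi>: "growth M N (\<lambda>u x. R u x * \<Phi> u x)" using growth_mult[OF R N] by simp
  have r: "continuable M (\<lambda>u x. of_real x ^ K * (R u x * \<Phi> u x))"
    by (rule continuable_growth_0[OF R\<Phi>]) (simp add: K_def)
  have rt: "tame M (\<lambda>u x. of_real x ^ K * (R u x * \<Phi> u x))"
    using tame_cmult_power[OF tame_mult[OF growth_0_imp_tame[OF R] \<Phi>(1)], of "\<lambda>_. 1" K] by simp
  have "continuable M (\<lambda>u x. (\<Sum>k<K. e k u * of_real x ^ k * \<Phi> u x) + of_real x ^ K * (R u x * \<Phi> u x))"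
    by (rule continuable_add[OF s(2) rt s(1) r])
  also have "?this \<longleftrightarrow> ?thesis"
    by (rule continuable_cong) (simp add: eq algebra_simps sum_distrib_left)
  finally show ?thesis .
qed

lemma powr_of_real_double:
  "x > 0 \<Longrightarrow> complex_of_real (2 * x) powr z = 2 powr z * of_real x powr z"
  using powr_times_real[of 2 "complex_of_real x" z] by simp

lemma mellin_double:
  fixes f :: "real \<Rightarrow> complex"
  shows "(LINT x:{0<..<1}|lborel. f (2 * x)) = (1/2) * (LINT y:{0<..<2}|lborel. f y)"
proof -
  have "(LINT y:{0<..<2}|lborel. f y) = (\<integral>y. indicator {0<..<2} y *\<^sub>R f y \<partial>lborel)"
    by (simp add: set_lebesgue_integral_def)
  also have "\<dots> = 2 * (\<integral>x. indicator {0<..<2} (2 * x) *\<^sub>R f (2 * x) \<partial>lborel)"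
    by (subst lborel_integral_real_affine[of 2 _ 0]) (auto simp: scaleR_conv_of_real)
  also have "(\<lambda>x::real. indicator {0<..<2} (2 * x) *\<^sub>R f (2 * x)) = (\<lambda>x. indicator {0<..<1} x *\<^sub>R f (2 * x))"
    by (auto simp: indicator_def)
  finally show ?thesis by (simp add: set_lebesgue_integral_def)
qed

text \<open>
  The substitution \<open>x \<mapsto> 2x\<close> turns the scaling relation into a linear equation for the
  Mellin integral over the unit interval.
\<close>

lemma continuable_scaling:
  assumes tame: "tame M \<Phi>" and \<Psi>: "continuable M \<Psi>"
    and a: "a holomorphic_on half_plane M" "\<And>u. Re u > 1 \<Longrightarrow> norm (a u) \<le> 1"
    and eq: "\<And>u x. u \<in> half_plane M \<Longrightarrow> x \<in> {0<..<1} \<Longrightarrow> \<Phi> u x = a u * \<Phi> u (2 * x) + \<Psi> u x"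
  shows "continuable M \<Phi>"
  unfolding continuable_def
proof
  fix j
  obtain g where g: "g meromorphic_on half_plane M" "\<And>u. Re u > 1 \<Longrightarrow> g u = (LINT x:{0<..<1}|lborel. mellin_term \<Psi> j u x)"
    using \<Psi> unfolding continuable_def by blast
  \<comment> \<open>Writing the power of \<open>x\<close> as a power of \<open>2 * x\<close> yields
    \<open>2 powr (- (u - 2 + of_nat j))\<close>, and the Jacobian of the substitution contributes
    another \<open>1/2\<close>.\<close>
  define b where "b = (\<lambda>u. a u * 2 powr (1 - u - of_nat j))"
  define h where "h = (\<lambda>u. LINT x:{1..<2}|lborel. mellin_term \<Phi> j u x)"
  have bm: "b meromorphic_on half_plane M"
    unfolding b_def using a(1)
    by (intro analytic_on_imp_meromorphic_on) (auto simp: analytic_on_open intro!: holomorphic_intros)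
  obtain N where "growth M N \<Phi>" using tame unfolding tame_def by blast
  then have hm: "h meromorphic_on half_plane M"
    unfolding h_def using mellin_holomorphic_12
    by (intro analytic_on_imp_meromorphic_on) (auto simp: analytic_on_open)
  have "(g u + b u * h u) / (1 - b u) = (LINT x:{0<..<1}|lborel. mellin_term \<Phi> j u x)" if u: "Re u > 1" for u
  proof -
    let ?I = "LINT x:{0<..<1}|lborel. mellin_term \<Phi> j u x"
    let ?p = "u - 2 + of_nat j"
    note int = mellin_term_integrable[OF tame u, of j]
    have int2: "set_integrable lborel ({0<..<1} \<union> {1..<2}) (mellin_term \<Phi> j u)"
      by (rule set_integrable_Un[OF int]) auto
    have un: "{0<..<1} \<union> {1..<2} = {0<..<2::real}" by auto
    have I2: "(LINT y:{0<..<2}|lborel. mellin_term \<Phi> j u y) = ?I + h u"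
      unfolding h_def un[symmetric] by (rule set_integral_Un[OF _ int]) auto
    have int': "set_integrable lborel {0<..<1} (\<lambda>x. mellin_term \<Phi> j u (2 * x))"
    proof -
      have "integrable lborel (\<lambda>x. indicator {0<..<2} (0 + 2 * x) *\<^sub>R mellin_term \<Phi> j u (0 + 2 * x))"
        using int2 unfolding un set_integrable_def by (subst lborel_integrable_real_affine_iff) auto
      also have "(\<lambda>x. indicator {0<..<2} (0 + 2 * x) *\<^sub>R mellin_term \<Phi> j u (0 + 2 * x)) =
          (\<lambda>x. indicator {0<..<1} x *\<^sub>R mellin_term \<Phi> j u (2 * x))"
        by (auto simp: indicator_def)
      finally show ?thesis unfolding set_integrable_def .
    qed
    have tm: "mellin_term \<Psi> j u x = mellin_term \<Phi> j u x - a u * 2 powr (- ?p) * mellin_term \<Phi> j u (2 * x)"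
      if "x \<in> {0<..<1}" for x
    proof -
      have "mellin_term \<Phi> j u (2 * x) = 2 powr ?p * (of_real x powr ?p * \<Phi> u (2 * x))"
        using powr_of_real_double[of x ?p] that by (simp add: mellin_term_def)
      moreover have "2 powr (- ?p) * 2 powr ?p = (1::complex)" by (simp add: powr_add[symmetric])
      ultimately have "2 powr (- ?p) * mellin_term \<Phi> j u (2 * x) = of_real x powr ?p * \<Phi> u (2 * x)"
        by (metis mult.assoc mult_1)
      then show ?thesis
        using eq[OF in_half_plane[OF u] that] by (simp add: mellin_term_def algebra_simps)
    qed
    have "g u = (LINT x:{0<..<1}|lborel. mellin_term \<Phi> j u x - a u * 2 powr (- ?p) * mellin_term \<Phi> j u (2 * x))"
      unfolding g(2)[OF u] by (rule set_lebesgue_integral_cong) (use tm in auto)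
    also have "\<dots> = ?I - (LINT x:{0<..<1}|lborel. a u * 2 powr (- ?p) * mellin_term \<Phi> j u (2 * x))"
      using int(1) int' by (intro set_integral_diff(2) set_integrable_mult_right) auto
    also have "\<dots> = ?I - a u * 2 powr (- ?p) * (1/2) * (?I + h u)"
      by (simp add: mellin_double[of "mellin_term \<Phi> j u"] I2)
    also have "a u * 2 powr (- ?p) * (1/2) = b u"
    proof -
      have half: "(1/2::complex) = 2 powr (-1)"
        using powr_minus[of "2::complex" 1] by (simp only: powr_one numeral_One inverse_eq_divide) simp
      have "2 powr (- ?p) * (1/2) = (2 powr (- ?p + - 1) :: complex)"
        unfolding half by (rule powr_add[symmetric])
      also have "- ?p + - 1 = 1 - u - of_nat j" by simp
      finally show ?thesis unfolding b_def by (simp only: mult.assoc)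
    qed
    finally have 1: "g u + b u * h u = (1 - b u) * ?I" by (simp add: algebra_simps)
    \<comment> \<open>In the region of convergence \<open>b u\<close> lies inside the unit disc, so
      the linear equation may be divided by \<open>1 - b u\<close>; beyond that region, zeros of
      \<open>1 - b u\<close> can become poles.\<close>
    have "norm (b u) = norm (a u) * 2 powr (1 - Re u - real j)"
      unfolding b_def by (simp add: norm_mult norm_powr_real_powr)
    also have "\<dots> \<le> 1 * 2 powr (1 - Re u - real j)" by (intro mult_right_mono a(2) u) auto
    also have "\<dots> < 1" using powr_less_mono[of "1 - Re u - real j" 0 2] u by simp
    finally have "b u \<noteq> 1" by auto
    then show ?thesis using 1 by (simp add: field_simps)
  qed
  then show "\<exists>g. g meromorphic_on half_plane M \<and>
     (\<forall>u. Re u > 1 \<longrightarrow> g u = (LINT x:{0<..<1}|lborel. mellin_term \<Phi> j u x))"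
    using g(1) bm hm by (intro exI[of _ "\<lambda>u. (g u + b u * h u) / (1 - b u)"]) (auto intro!: meromorphic_intros)
qed

text \<open>The constant function is invariant under \<open>x \<mapsto> 2x\<close>, so the scaling
  lemma with \<open>a = 1\<close> and no inhomogeneous term continues the elementary integral, whose
  value is the reciprocal of \<open>u - 1 + j\<close>.\<close>

lemma continuable_one: "continuable M (\<lambda>u x. 1)"
  by (rule continuable_scaling[where a = "\<lambda>u. 1", OF tame_const continuable_zero]) auto

section \<open>Lerch series\<close>

lemma power_le_fact_exp:
  fixes y :: real
  assumes "y \<ge> 0"
  shows "y ^ R \<le> fact R * exp y"
proof -
  have "(\<Sum>n\<in>{R}. y ^ n /\<^sub>R fact n) \<le> exp y"
    unfolding exp_def by (rule sum_le_suminf[OF summable_exp_generic]) (use assms in auto)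
  then show ?thesis by (simp add: field_simps)
qed

text \<open>Half of the exponential decay pays for the power; the other half is kept for
  summation.\<close>

lemma power_exp_le:
  fixes y c :: real
  assumes "y \<ge> 0" "c > 0"
  shows "y ^ R * exp (- c * y) \<le> fact R * (2 / c) ^ R * exp (- (c / 2) * y)"
proof -
  have "((c / 2) * y) ^ R \<le> fact R * exp ((c / 2) * y)"
    by (rule power_le_fact_exp) (use assms in simp)
  then have "(2 / c) ^ R * ((c / 2) * y) ^ R * exp (- c * y) \<le> (2 / c) ^ R * (fact R * exp ((c / 2) * y)) * exp (- c * y)"
    using assms by (intro mult_right_mono mult_left_mono) auto
  also have "(2 / c) ^ R * ((c / 2) * y) ^ R = y ^ R"
    using assms by (simp add: power_mult_distrib[symmetric])
  also have "(2 / c) ^ R * (fact R * exp ((c / 2) * y)) * exp (- c * y) =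
      fact R * (2 / c) ^ R * (exp ((c / 2) * y) * exp (- c * y))" by (simp add: mult_ac)
  also have "exp ((c / 2) * y) * exp (- c * y) = exp (- (c / 2) * y)"
    by (simp add: exp_add[symmetric])
  finally show ?thesis .
qed

text \<open>The argument of a complex base contributes at most \<open>exp (pi * R)\<close>. As
  \<open>Re w\<close> may have either sign, the modulus is split into \<open>2 * norm z\<close> and
  \<open>1/2\<close>: the first is at least 1 and the second has inverse 2, so both are bounded by
  powers with exponent \<open>R\<close>. This gives the 4.\<close>

lemma norm_powr_le:
  fixes z w :: complex
  assumes "norm w \<le> real R" "norm z \<ge> 1/2"
  shows "norm (z powr w) \<le> (4 * norm z) ^ R * exp (pi * R)"
proof -
  have "norm (z powr w) = norm z powr Re w * exp (- Im w * Arg z)" by (rule norm_powr_complex)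
  also have "\<dots> \<le> (4 * norm z) ^ R * exp (pi * R)"
  proof (rule mult_mono')
    have rw: "\<bar>Re w\<bar> \<le> R" using abs_Re_le_cmod[of w] assms(1) by linarith
    have "norm z powr Re w = (2 * norm z) powr Re w * (1/2) powr Re w"
      by (simp add: powr_mult[symmetric])
    also have "\<dots> \<le> (2 * norm z) powr R * 2 powr R"
    proof (rule mult_mono)
      show "(2 * norm z) powr Re w \<le> (2 * norm z) powr R"
        using rw assms(2) by (intro powr_mono) auto
      have "(1/2) powr Re w = 2 powr (- Re w)" by (simp add: powr_minus powr_divide inverse_eq_divide)
      also have "\<dots> \<le> 2 powr R" using rw by (intro powr_mono) auto
      finally show "(1/2) powr Re w \<le> 2 powr (real R)" .
    qed auto
    also have "\<dots> = (4 * norm z) powr R" by (simp add: powr_mult[symmetric])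
    also have "\<dots> = (4 * norm z) ^ R" using assms(2) by (intro powr_realpow) linarith
    finally show "norm z powr Re w \<le> (4 * norm z) ^ R" .
    have "- Im w * Arg z \<le> \<bar>Im w\<bar> * \<bar>Arg z\<bar>" by (metis abs_ge_self abs_minus_cancel abs_mult)
    also have "\<dots> \<le> R * pi"
    proof (rule mult_mono)
      show "\<bar>Im w\<bar> \<le> R" using abs_Im_le_cmod[of w] assms(1) by linarith
      show "\<bar>Arg z\<bar> \<le> pi" using Arg_le_pi[of z] mpi_less_Arg[of z] by auto
    qed auto
    finally show "exp (- Im w * Arg z) \<le> exp (pi * R)" by (simp add: mult.commute)
  qed auto
  finally show ?thesis .
qed

text \<open>One family for all series in use: \<open>\<epsilon> = 1\<close> gives \<open>L\<close>,
  \<open>\<epsilon> = -1\<close> gives \<open>A\<close>, and \<open>x = 0\<close> gives the zeta and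
  eta series. The shift \<open>t\<close> is complex so that it can serve as a variable of
  differentiation. The index is zero-based, hence the leading term of the alternating series is
  positive.\<close>

definition lerch_term :: "complex \<Rightarrow> complex \<Rightarrow> complex \<Rightarrow> complex \<Rightarrow> nat \<Rightarrow> complex" where
  "lerch_term \<epsilon> u x t n = \<epsilon> ^ n * (of_nat (Suc n) + t) powr (- u) * exp (- (of_nat (Suc n) * x))"

definition lerch :: "complex \<Rightarrow> complex \<Rightarrow> complex \<Rightarrow> complex \<Rightarrow> complex" where
  "lerch \<epsilon> u x t = (\<Sum>n. lerch_term \<epsilon> u x t n)"

definition lerch_bound :: "nat \<Rightarrow> real \<Rightarrow> real \<Rightarrow> nat \<Rightarrow> real" where
  "lerch_bound R A \<delta> n = (4 * (real (Suc n) + A)) ^ R * exp (pi * R) * exp (- \<delta> * real (Suc n))"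

lemma summable_lerch_bound:
  assumes "A \<ge> 0" "\<delta> > 0"
  shows "summable (lerch_bound R A \<delta>)"
proof (rule summable_comparison_test')
  define C where "C = 4 ^ R * exp (pi * R) * exp (\<delta> * A) * (fact R * (2 / \<delta>) ^ R)"
  have "summable (\<lambda>n. exp (- (\<delta> / 2)) ^ n)" by (rule summable_geometric) (use assms in simp)
  then show "summable (\<lambda>n. C * exp (- (\<delta> / 2)) ^ n)" by (rule summable_mult)
  fix n
  let ?y = "real (Suc n) + A"
  have "exp (- \<delta> * real (Suc n)) = exp (\<delta> * A) * exp (- \<delta> * ?y)"
    by (simp add: exp_add[symmetric] algebra_simps)
  then have "lerch_bound R A \<delta> n = 4 ^ R * exp (pi * R) * exp (\<delta> * A) * (?y ^ R * exp (- \<delta> * ?y))"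
    by (simp only: lerch_bound_def power_mult_distrib mult_ac)
  moreover have "lerch_bound R A \<delta> n \<ge> 0" using assms by (simp add: lerch_bound_def)
  ultimately have "norm (lerch_bound R A \<delta> n) = 4 ^ R * exp (pi * R) * exp (\<delta> * A) * (?y ^ R * exp (- \<delta> * ?y))"
    by simp
  also have "\<dots> \<le> 4 ^ R * exp (pi * R) * exp (\<delta> * A) * (fact R * (2 / \<delta>) ^ R * exp (- (\<delta> / 2) * ?y))"
    using assms by (intro mult_left_mono power_exp_le) auto
  also have "\<dots> = C * exp (- (\<delta> / 2) * ?y)" by (simp add: C_def)
  also have "\<dots> \<le> C * exp (- (\<delta> / 2)) ^ n"
  proof (rule mult_left_mono)
    have "exp (- (\<delta> / 2) * ?y) \<le> exp (real n * (- (\<delta> / 2)))"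
      using assms by (simp add: algebra_simps)
    also have "\<dots> = exp (- (\<delta> / 2)) ^ n" by (rule exp_of_nat_mult)
    finally show "exp (- (\<delta> / 2) * ?y) \<le> exp (- (\<delta> / 2)) ^ n" .
  qed (use assms in \<open>simp add: C_def\<close>)
  finally show "norm (lerch_bound R A \<delta> n) \<le> C * exp (- (\<delta> / 2)) ^ n" .
qed

lemma lerch_term_le_bound:
  assumes "norm \<epsilon> \<le> 1" "norm u \<le> real R" "norm t \<le> A" "Re t \<ge> -1/2" "Re x \<ge> \<delta>"
  shows "norm (lerch_term \<epsilon> u x t n) \<le> lerch_bound R A \<delta> n"
proof -
  let ?z = "of_nat (Suc n) + t"
  have "Re ?z \<ge> 1/2" using assms(4) by simp
  then have z: "norm ?z \<ge> 1/2" using complex_Re_le_cmod[of ?z] by linarith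
  have z': "norm ?z \<le> real (Suc n) + A"
    using norm_triangle_ineq[of "of_nat (Suc n)" t] assms(3) by (simp del: of_nat_Suc)
  have "norm (lerch_term \<epsilon> u x t n) = norm \<epsilon> ^ n * norm (?z powr (- u)) * exp (- (real (Suc n) * Re x))"
    by (simp add: lerch_term_def norm_mult norm_power del: of_nat_Suc)
  also have "\<dots> \<le> 1 * ((4 * norm ?z) ^ R * exp (pi * R)) * exp (- \<delta> * real (Suc n))"
  proof (intro mult_mono)
    show "norm \<epsilon> ^ n \<le> 1" using assms(1) by (intro power_le_one) auto
    show "norm (?z powr (- u)) \<le> (4 * norm ?z) ^ R * exp (pi * R)"
      by (rule norm_powr_le) (use assms(2) z in auto)
    show "exp (- (real (Suc n) * Re x)) \<le> exp (- \<delta> * real (Suc n))"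
      using assms(5) by (simp add: mult.commute)
  qed auto
  also have "\<dots> \<le> lerch_bound R A \<delta> n"
    unfolding lerch_bound_def mult_1 using z' by (intro mult_right_mono power_mono) auto
  finally show ?thesis .
qed

lemma lerch_term_eventually_bounded:
  assumes "norm \<epsilon> \<le> 1" "Re x > 0" "Re t > -1/2"
  shows "summable (\<lambda>n. norm (lerch_term \<epsilon> u x t n))"
proof -
  obtain R :: nat where R: "norm u \<le> R" using real_arch_simple[of "norm u"] by auto
  show ?thesis
    by (rule summable_comparison_test'[OF summable_lerch_bound[of "norm t" "Re x" R]])
       (use assms R lerch_term_le_bound[OF assms(1) R, of t "norm t" "Re x" x] in auto)
qed

lemma lerch_sums:
  assumes "norm \<epsilon> \<le> 1" "Re x > 0" "Re t > -1/2"
  shows "lerch_term \<epsilon> u x t sums lerch \<epsilon> u x t"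
  unfolding lerch_def
  by (rule summable_sums[OF summable_norm_cancel[OF lerch_term_eventually_bounded[OF assms]]])

text \<open>Termwise differentiation under a local majorant of the shape \<open>lerch_bound\<close>;
  it is applied to each of the three variables \<open>u\<close>, \<open>x\<close> and
  \<open>t\<close>.\<close>

lemma lerch_has_derivative_aux:
  fixes f f' :: "nat \<Rightarrow> complex \<Rightarrow> complex"
  assumes "open S" "z \<in> S"
    and d: "\<And>n z. z \<in> S \<Longrightarrow> (f n has_field_derivative f' n z) (at z)"
    and b: "\<And>z. z \<in> S \<Longrightarrow> \<exists>d R A \<delta>. d > 0 \<and> A \<ge> 0 \<and> \<delta> > 0 \<and>
        (\<forall>n. \<forall>y\<in>ball z d \<inter> S. norm (f n y) \<le> lerch_bound R A \<delta> n)"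
  shows "((\<lambda>z. \<Sum>n. f n z) has_field_derivative (\<Sum>n. f' n z)) (at z)"
proof -
  have "\<exists>d h. 0 < d \<and> summable h \<and> (\<forall>\<^sub>F n in sequentially. \<forall>y\<in>ball z d \<inter> S. norm (f n y) \<le> h n)" if zS: "z \<in> S" for z
  proof -
    obtain d R A \<delta> where *: "d > 0" "A \<ge> 0" "\<delta> > 0"
        "\<forall>n. \<forall>y\<in>ball z d \<inter> S. norm (f n y) \<le> lerch_bound R A \<delta> n"
      using b[OF zS] by blast
    show ?thesis
      by (rule exI[of _ d], rule exI[of _ "lerch_bound R A \<delta>"])
         (use * in \<open>simp add: summable_lerch_bound\<close>)
  qed
  from series_and_derivative_comparison_local[OF \<open>open S\<close> d this]
  obtain g g' where g: "\<And>z. z \<in> S \<Longrightarrow> (\<lambda>n. f n z) sums g z" "\<And>z. z \<in> S \<Longrightarrow> (\<lambda>n. f' n z) sums g' z"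
    "\<And>z. z \<in> S \<Longrightarrow> (g has_field_derivative g' z) (at z)" by blast
  have "((\<lambda>z. \<Sum>n. f n z) has_field_derivative g' z) (at z)"
    by (rule has_field_derivative_transform_within_open[OF g(3)[OF assms(2)] assms(1,2)])
       (use g(1) in \<open>simp add: sums_iff\<close>)
  then show ?thesis using g(2)[OF assms(2)] by (simp add: sums_iff)
qed

lemma lerch_holomorphic:
  assumes "norm \<epsilon> \<le> 1" "Re x > 0" "Re t > -1/2"
  shows "(\<lambda>u. lerch \<epsilon> u x t) holomorphic_on A"
proof -
  have "((\<lambda>u. \<Sum>n. lerch_term \<epsilon> u x t n) has_field_derivative
      (\<Sum>n. - Ln (of_nat (Suc n) + t) * lerch_term \<epsilon> u x t n)) (at u)" for u
  proof (rule lerch_has_derivative_aux[where S = UNIV])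
    fix n z
    have "of_nat (Suc n) + t \<noteq> 0" using assms(3) by (auto simp: complex_eq_iff)
    then show "((\<lambda>u. lerch_term \<epsilon> u x t n) has_field_derivative - Ln (of_nat (Suc n) + t) * lerch_term \<epsilon> z x t n) (at z)"
      unfolding lerch_term_def powr_def by (auto intro!: derivative_eq_intros simp del: of_nat_Suc)
  next
    fix z :: complex
    obtain R :: nat where R: "norm z + 1 \<le> R" using real_arch_simple[of "norm z + 1"] by auto
    have "norm (lerch_term \<epsilon> y x t n) \<le> lerch_bound R (norm t) (Re x) n" if "y \<in> ball z 1" for y n
    proof (rule lerch_term_le_bound)
      show "norm y \<le> R" using that R norm_triangle_sub[of y z] by (auto simp: dist_norm norm_minus_commute)
    qed (use assms in auto)
    then show "\<exists>d R A \<delta>. d > 0 \<and> A \<ge> 0 \<and> \<delta> > 0 \<and>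
        (\<forall>n. \<forall>y\<in>ball z d \<inter> UNIV. norm (lerch_term \<epsilon> y x t n) \<le> lerch_bound R A \<delta> n)"
      using assms(2) by (intro exI[of _ 1] exI[of _ R] exI[of _ "norm t"] exI[of _ "Re x"]) auto
  qed auto
  then show ?thesis
    unfolding lerch_def holomorphic_on_def field_differentiable_def
    using has_field_derivative_at_within by blast
qed

lemma lerch_deriv_x:
  assumes "norm \<epsilon> \<le> 1" "Re x > 0"
  shows "((\<lambda>x. lerch \<epsilon> u x 0) has_field_derivative - lerch \<epsilon> (u - 1) x 0) (at x)"
proof -
  have "((\<lambda>x. \<Sum>n. lerch_term \<epsilon> u x 0 n) has_field_derivative
      (\<Sum>n. - lerch_term \<epsilon> (u - 1) x 0 n)) (at x)"
  proof (rule lerch_has_derivative_aux[where S = "{x. Re x > 0}"])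
    fix n z
    have "(of_nat (Suc n) :: complex) powr (- (u - 1)) = of_nat (Suc n) * of_nat (Suc n) powr (- u)"
      using powr_add[of "of_nat (Suc n) :: complex" 1 "- u"] by (simp del: of_nat_Suc)
    then show "((\<lambda>x. lerch_term \<epsilon> u x 0 n) has_field_derivative - lerch_term \<epsilon> (u - 1) z 0 n) (at z)"
      unfolding lerch_term_def by (auto intro!: derivative_eq_intros simp del: of_nat_Suc)
  next
    fix z :: complex assume z: "z \<in> {x. Re x > 0}"
    obtain R :: nat where R: "norm u \<le> R" using real_arch_simple[of "norm u"] by auto
    have "norm (lerch_term \<epsilon> u y 0 n) \<le> lerch_bound R 0 (Re z / 2) n" if "y \<in> ball z (Re z / 2)" for y n
    proof (rule lerch_term_le_bound)
      show "Re z / 2 \<le> Re y" using that abs_Re_le_cmod[of "z - y"] by (auto simp: dist_norm)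
    qed (use assms R in auto)
    then show "\<exists>d R A \<delta>. d > 0 \<and> A \<ge> 0 \<and> \<delta> > 0 \<and>
        (\<forall>n. \<forall>y\<in>ball z d \<inter> {x. Re x > 0}. norm (lerch_term \<epsilon> u y 0 n) \<le> lerch_bound R A \<delta> n)"
      using z by (intro exI[of _ "Re z / 2"] exI[of _ R] exI[of _ 0] exI[of _ "Re z / 2"]) auto
  qed (use assms in \<open>auto simp: open_halfspace_Re_gt\<close>)
  moreover have "summable (lerch_term \<epsilon> (u - 1) x 0)"
    using lerch_sums[of \<epsilon> x 0 "u - 1"] assms by (auto simp: sums_iff)
  ultimately show ?thesis
    unfolding lerch_def by (simp add: suminf_minus)
qed

text \<open>Differentiation in the shift raises \<open>u\<close> by one, while differentiation in
  \<open>x\<close> lowers it. The former gains convergence and drives the bound for the alternating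
  series; the latter produces its Taylor expansion at 0.\<close>

lemma lerch_deriv_t:
  assumes "norm \<epsilon> \<le> 1" "Re x > 0" "Re t > -1/2"
  shows "((\<lambda>t. lerch \<epsilon> u x t) has_field_derivative - u * lerch \<epsilon> (u + 1) x t) (at t)"
proof -
  have "((\<lambda>t. \<Sum>n. lerch_term \<epsilon> u x t n) has_field_derivative
      (\<Sum>n. - u * lerch_term \<epsilon> (u + 1) x t n)) (at t)"
  proof (rule lerch_has_derivative_aux[where S = "{t. Re t > -1/2}"])
    fix n and z :: complex assume z: "z \<in> {t. Re t > -1/2}"
    then have "of_nat (Suc n) + z \<notin> \<real>\<^sub>\<le>\<^sub>0" by (auto simp: complex_nonpos_Reals_iff)
    moreover have e: "- (u + 1) = - u - 1" by simp
    ultimately show "((\<lambda>t. lerch_term \<epsilon> u x t n) has_field_derivative - u * lerch_term \<epsilon> (u + 1) x z n) (at z)"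
      unfolding lerch_term_def e
      by (auto intro!: derivative_eq_intros simp del: of_nat_Suc minus_add_distrib simp: mult_ac)
  next
    fix z :: complex assume z: "z \<in> {t. Re t > -1/2}"
    obtain R :: nat where R: "norm u \<le> R" using real_arch_simple[of "norm u"] by auto
    have "norm (lerch_term \<epsilon> u x y n) \<le> lerch_bound R (norm z + 1) (Re x) n" if "y \<in> ball z 1 \<inter> {t. Re t > -1/2}" for y n
    proof (rule lerch_term_le_bound)
      show "norm y \<le> norm z + 1" using that norm_triangle_sub[of y z] by (auto simp: dist_norm norm_minus_commute)
    qed (use assms R that in auto)
    then show "\<exists>d R A \<delta>. d > 0 \<and> A \<ge> 0 \<and> \<delta> > 0 \<and>
        (\<forall>n. \<forall>y\<in>ball z d \<inter> {t. Re t > -1/2}. norm (lerch_term \<epsilon> u x y n) \<le> lerch_bound R A \<delta> n)"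
      using assms(2) by (intro exI[of _ 1] exI[of _ R] exI[of _ "norm z + 1"] exI[of _ "Re x"]) auto
  qed (use assms in \<open>auto simp: open_halfspace_Re_gt\<close>)
  moreover have "(\<Sum>n. - u * lerch_term \<epsilon> (u + 1) x t n) = - u * lerch \<epsilon> (u + 1) x t"
    using sums_mult[OF lerch_sums[OF assms], of "- u" "u + 1"] by (simp only: sums_iff)
  ultimately show ?thesis
    unfolding lerch_def by (simp only:)
qed

abbreviation alt :: "complex \<Rightarrow> real \<Rightarrow> real \<Rightarrow> complex" where
  "alt u x t \<equiv> lerch (-1) u (of_real x) (of_real t)"

lemma lerch_shift:
  assumes "norm \<epsilon> \<le> 1" "Re x > 0" "Re t > -1/2"
  shows "lerch \<epsilon> u x t = (1 + t) powr (- u) * exp (- x) + \<epsilon> * exp (- x) * lerch \<epsilon> u x (t + 1)"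
proof -
  have s: "lerch_term \<epsilon> u x t sums lerch \<epsilon> u x t" by (rule lerch_sums[OF assms])
  have "lerch_term \<epsilon> u x (t + 1) sums lerch \<epsilon> u x (t + 1)"
    by (rule lerch_sums) (use assms in auto)
  then have "(\<lambda>n. \<epsilon> * exp (- x) * lerch_term \<epsilon> u x (t + 1) n) sums (\<epsilon> * exp (- x) * lerch \<epsilon> u x (t + 1))"
    by (rule sums_mult)
  also have "(\<lambda>n. \<epsilon> * exp (- x) * lerch_term \<epsilon> u x (t + 1) n) = (\<lambda>n. lerch_term \<epsilon> u x t (Suc n))"
  proof
    fix n
    have "- x + - (of_nat (Suc n) * x) = - (of_nat (Suc (Suc n)) * x)"
      by (simp add: algebra_simps)
    then have "exp (- x) * exp (- (of_nat (Suc n) * x)) = exp (- (of_nat (Suc (Suc n)) * x))"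
      by (simp only: exp_add[symmetric])
    moreover have "of_nat (Suc n) + (t + 1) = of_nat (Suc (Suc n)) + t" by simp
    moreover have "\<epsilon> * exp (- x) * lerch_term \<epsilon> u x (t + 1) n =
        \<epsilon> ^ Suc n * (of_nat (Suc n) + (t + 1)) powr (- u) * (exp (- x) * exp (- (of_nat (Suc n) * x)))"
      by (simp add: lerch_term_def mult_ac del: of_nat_Suc)
    ultimately show "\<epsilon> * exp (- x) * lerch_term \<epsilon> u x (t + 1) n = lerch_term \<epsilon> u x t (Suc n)"
      by (simp only: lerch_term_def)
  qed
  finally have "lerch_term \<epsilon> u x t sums (\<epsilon> * exp (- x) * lerch \<epsilon> u x (t + 1) + lerch_term \<epsilon> u x t 0)"
    by (simp add: sums_Suc_iff)
  from sums_unique2[OF s this] show ?thesis by (simp add: lerch_term_def)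
qed

lemma norm_lerch_le_suminf:
  assumes "norm \<epsilon> \<le> 1" "x > 0" "t \<ge> 0" "Re u \<ge> c" "c \<ge> 0" "summable (\<lambda>n. real (Suc n) powr (- c))"
  shows "norm (lerch \<epsilon> u (of_real x) (of_real t)) \<le> (\<Sum>n. real (Suc n) powr (- c))"
proof -
  have "norm (lerch_term \<epsilon> u (of_real x) (of_real t) n) \<le> real (Suc n) powr (- c)" for n
  proof -
    have "norm (lerch_term \<epsilon> u (of_real x) (of_real t) n) =
        norm \<epsilon> ^ n * norm (complex_of_real (real (Suc n) + t) powr (- u)) * norm (exp (complex_of_real (- (real (Suc n) * x))))"
      by (simp add: lerch_term_def norm_mult norm_power)
    also have "\<dots> = norm \<epsilon> ^ n * (real (Suc n) + t) powr (- Re u) * exp (- (real (Suc n) * x))"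
      using norm_of_real_powr[of "real (Suc n) + t" "- u"] assms(3)
      by (simp only: norm_exp_eq_Re Re_complex_of_real uminus_complex.sel)
    also have "\<dots> \<le> 1 * real (Suc n) powr (- c) * 1"
    proof (intro mult_mono)
      show "norm \<epsilon> ^ n \<le> 1" using assms(1) by (intro power_le_one) auto
      have "(real (Suc n) + t) powr (- Re u) \<le> real (Suc n) powr (- Re u)"
        using assms by (intro powr_mono2') auto
      also have "\<dots> \<le> real (Suc n) powr (- c)" using assms by (intro powr_mono) auto
      finally show "(real (Suc n) + t) powr (- Re u) \<le> real (Suc n) powr (- c)" .
      show "exp (- (real (Suc n) * x)) \<le> 1" using assms(2) by simp
    qed auto
    finally show ?thesis by simp
  qed
  then show ?thesis
    unfolding lerch_def using assms(6)
    by (intro order.trans[OF summable_norm suminf_le] summable_comparison_test'[OF assms(6)]) auto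
qed

section \<open>The alternating series near the origin\<close>

lemma summable_Suc_powr: "c > 1 \<Longrightarrow> summable (\<lambda>n. real (Suc n) powr (- c))"
  using summable_Suc_iff[of "\<lambda>n. real n powr (- c)"] summable_real_powr_iff[of "- c"] by simp

text \<open>
  Downward induction on \<open>Re u\<close>: \<open>(1 + exp (-x)) * alt u x t\<close> differs from an explicit term by
  \<open>exp (-x) * (alt u x t - alt u x (t + 1))\<close>, which the mean value theorem bounds through \<open>alt (u + 1)\<close>.
\<close>

lemma alt_bounded:
  "\<exists>C. \<forall>u t x. norm u \<le> real R \<longrightarrow> Re u \<ge> 2 - real m \<longrightarrow> 0 \<le> t \<longrightarrow> t \<le> A \<longrightarrow> x > 0 \<longrightarrow> norm (alt u x t) \<le> C"
proof (induction m arbitrary: R A)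
  case 0
  have "norm (alt u x t) \<le> (\<Sum>n. real (Suc n) powr (- 2))" if "Re u \<ge> 2" "t \<ge> 0" "x > 0" for u t x
    by (rule norm_lerch_le_suminf) (use that summable_Suc_powr[of 2] in auto)
  then show ?case by auto
next
  case (Suc m)
  \<comment> \<open>The induction hypothesis is used at \<open>u + 1\<close>, which enlarges the
    bound on the norm by one, and for shifts between \<open>t\<close> and \<open>t + 1\<close>,
    which enlarges \<open>A\<close> by one.\<close>
  obtain C where C: "\<And>u t x. norm u \<le> real (R + 1) \<Longrightarrow> Re u \<ge> 2 - real m \<Longrightarrow> 0 \<le> t \<Longrightarrow> t \<le> A + 1 \<Longrightarrow> x > 0 \<Longrightarrow> norm (alt u x t) \<le> C"
    using Suc.IH[of "R + 1" "A + 1"] by blast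
  have "norm (alt u x t) \<le> (1 + A) powr real R + real R * C"
    if u: "norm u \<le> real R" "Re u \<ge> 2 - real (Suc m)" and t: "0 \<le> t" "t \<le> A" and x: "x > 0" for u t x
  proof -
    have "norm (alt u x (t + 1) - alt u x t) \<le> real R * C * norm (complex_of_real (t + 1) - of_real t)"
    proof (rule field_differentiable_bound[where S = "closed_segment (of_real t) (of_real (t + 1))"
          and f' = "\<lambda>s. - u * lerch (-1) (u + 1) (of_real x) s"])
      fix z assume "z \<in> closed_segment (complex_of_real t) (of_real (t + 1))"
      then obtain s where s: "z = of_real s" "t \<le> s" "s \<le> t + 1"
        unfolding closed_segment_of_real by (auto simp: closed_segment_eq_real_ivl)
      show "(lerch (-1) u (of_real x) has_field_derivative - u * lerch (-1) (u + 1) (of_real x) z)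
          (at z within closed_segment (of_real t) (of_real (t + 1)))"
        by (rule has_field_derivative_at_within, rule lerch_deriv_t) (use s t x in auto)
      have "norm (u + 1) \<le> real (R + 1)" using norm_triangle_ineq[of u 1] u(1) by simp
      then have "norm (alt (u + 1) x s) \<le> C" using s t x u by (intro C) auto
      then show "norm (- u * lerch (-1) (u + 1) (of_real x) z) \<le> real R * C"
        using u(1) s by (auto simp: norm_mult intro!: mult_mono)
    qed auto
    then have d: "norm (alt u x (t + 1) - alt u x t) \<le> real R * C" by simp
    have "alt u x t = (1 + of_real t) powr (- u) * exp (- of_real x) - exp (- of_real x) * alt u x (t + 1)"
      using lerch_shift[of "-1" "of_real x" "of_real t" u] t x by simp
    then have "alt u x t * (1 + exp (- of_real x)) = exp (- of_real x) * ((1 + of_real t) powr (- u) - (alt u x (t + 1) - alt u x t))"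
      by (simp add: algebra_simps)
    then have "norm (alt u x t * of_real (1 + exp (- x))) =
        norm (of_real (exp (- x)) * ((1 + of_real t) powr (- u) - (alt u x (t + 1) - alt u x t)))"
      by (simp flip: exp_of_real)
    then have "norm (alt u x t) * (1 + exp (- x)) = exp (- x) * norm ((1 + of_real t) powr (- u) - (alt u x (t + 1) - alt u x t))"
      unfolding norm_mult norm_of_real by (simp add: add_nonneg_nonneg)
    moreover have "norm (alt u x t) * 1 \<le> norm (alt u x t) * (1 + exp (- x))"
      by (intro mult_left_mono) auto
    moreover have "exp (- x) * norm ((1 + of_real t) powr (- u) - (alt u x (t + 1) - alt u x t)) \<le>
        1 * norm ((1 + of_real t) powr (- u) - (alt u x (t + 1) - alt u x t))"
      using x by (intro mult_right_mono) auto
    ultimately have "norm (alt u x t) \<le> norm ((1 + of_real t) powr (- u) - (alt u x (t + 1) - alt u x t))" by linarith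
    also have "\<dots> \<le> norm ((1 + complex_of_real t) powr (- u)) + norm (alt u x (t + 1) - alt u x t)"
      by (rule norm_triangle_ineq4)
    also have "norm ((1 + complex_of_real t) powr (- u)) = (1 + t) powr (- Re u)"
      using norm_of_real_powr[of "1 + t" "- u"] t by simp
    also have "(1 + t) powr (- Re u) \<le> (1 + A) powr real R"
    proof -
      have "(1 + t) powr (- Re u) \<le> (1 + t) powr real R"
        using t u(1) abs_Re_le_cmod[of u] by (intro powr_mono) auto
      also have "\<dots> \<le> (1 + A) powr real R" using t by (intro powr_mono2) auto
      finally show ?thesis .
    qed
    finally show ?thesis using d by simp
  qed
  then show ?case by blast
qed

lemma alt_bounded_0:
  "\<exists>C. \<forall>u x. norm u \<le> real R \<longrightarrow> x > 0 \<longrightarrow> norm (alt u x 0) \<le> C"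
proof -
  \<comment> \<open>With \<open>m = R + 2\<close> the lower bound on the real part is
    \<open>- R\<close>, which follows from the bound on the norm.\<close>
  obtain C where C: "\<And>u x. norm u \<le> real R \<Longrightarrow> Re u \<ge> 2 - real (R + 2) \<Longrightarrow> x > 0 \<Longrightarrow> norm (alt u x 0) \<le> C"
    using alt_bounded[of R "R + 2" 0] by force
  have "Re u \<ge> 2 - real (R + 2)" if "norm u \<le> real R" for u
    using that abs_Re_le_cmod[of u] by auto
  then show ?thesis using C by blast
qed

lemma alt_diff_le:
  assumes "\<And>y. y \<in> {a..b} \<Longrightarrow> norm (f' y) \<le> B" "a \<le> b"
    and "\<And>y. y \<in> {a..b} \<Longrightarrow> (f has_field_derivative f' y) (at (of_real y))"
  shows "norm (f (of_real b) - f (complex_of_real a)) \<le> B * (b - a)"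
proof -
  have "norm (f (of_real b) - f (complex_of_real a)) \<le> B * norm (complex_of_real b - of_real a)"
  proof (rule field_differentiable_bound[where S = "closed_segment (of_real a) (of_real b)" and f' = "f' \<circ> Re"])
    fix z assume "z \<in> closed_segment (complex_of_real a) (of_real b)"
    then obtain s where s: "z = of_real s" "a \<le> s" "s \<le> b"
      unfolding closed_segment_of_real using assms(2) by (auto simp: closed_segment_eq_real_ivl)
    show "(f has_field_derivative (f' \<circ> Re) z) (at z within closed_segment (of_real a) (of_real b))"
      by (rule has_field_derivative_at_within) (use s assms(3)[of s] in auto)
    show "norm ((f' \<circ> Re) z) \<le> B" using assms(1)[of s] s by simp
  qed auto
  also have "norm (complex_of_real b - of_real a) = b - a"
    using assms(2) by (simp flip: of_real_diff)
  finally show ?thesis .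
qed

text \<open>The derivative in \<open>x\<close> is minus the alternating series at
  \<open>u - 1\<close>, which is bounded for all \<open>x > 0\<close>, locally uniformly in
  \<open>u\<close>. So the series is Lipschitz in \<open>x\<close>, the limit at 0 exists uniformly
  on compact sets of \<open>u\<close>, and this limit, the eta function, is entire.\<close>

lemma alt_limit:
  "\<exists>\<eta>. \<eta> holomorphic_on UNIV \<and>
    (\<forall>R. \<exists>C. \<forall>u x. norm u \<le> real R \<longrightarrow> x > 0 \<longrightarrow> norm (alt u x 0 - \<eta> u) \<le> C * x)"
proof -
  have lip: "\<exists>C. \<forall>u x y. norm u \<le> real R \<longrightarrow> 0 < y \<longrightarrow> y \<le> x \<longrightarrow> norm (alt u x 0 - alt u y 0) \<le> C * (x - y)" for R
  proof -
    obtain C where C: "\<And>u x. norm u \<le> real (R + 1) \<Longrightarrow> x > 0 \<Longrightarrow> norm (alt u x 0) \<le> C"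
      using alt_bounded_0[of "R + 1"] by blast
    have "norm (alt u x 0 - alt u y 0) \<le> C * (x - y)" if "norm u \<le> real R" "0 < y" "y \<le> x" for u x y
    proof (rule alt_diff_le[where f = "\<lambda>x. lerch (-1) u x (of_real 0)" and f' = "\<lambda>x. - alt (u - 1) x 0"])
      fix z assume "z \<in> {y..x}"
      then have z: "z > 0" using that by auto
      have "norm (u - 1) \<le> real (R + 1)" using norm_triangle_ineq4[of u 1] that(1) by simp
      then show "norm (- alt (u - 1) z 0) \<le> C" using C[of "u - 1" z] z by simp
      show "((\<lambda>x. lerch (-1) u x (of_real 0)) has_field_derivative - alt (u - 1) z 0) (at (of_real z))"
        using lerch_deriv_x[of "-1" "of_real z" u] z by simp
    qed (use that in auto)
    then show ?thesis by blast
  qed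
  define \<eta> where "\<eta> = (\<lambda>u. lim (\<lambda>n. alt u (1 / real (Suc n)) 0))"
  have lim: "(\<lambda>n. alt u (1 / real (Suc n)) 0) \<longlonglongrightarrow> \<eta> u" for u
  proof -
    obtain R :: nat where R: "norm u \<le> R" using real_arch_simple[of "norm u"] by auto
    obtain C where "\<forall>u x y. norm u \<le> real R \<longrightarrow> 0 < y \<longrightarrow> y \<le> x \<longrightarrow> norm (alt u x 0 - alt u y 0) \<le> C * (x - y)"
      using lip[of R] by blast
    then have C: "norm (alt u x 0 - alt u y 0) \<le> C * (x - y)" if "0 < y" "y \<le> x" for x y
      using R that by simp
    have C0: "C \<ge> 0" using order.trans[OF norm_ge_zero C[of 1 2]] by simp
    have "Cauchy (\<lambda>n. alt u (1 / real (Suc n)) 0)"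
    proof (rule CauchyI', unfold dist_norm)
      fix e :: real assume e: "e > 0"
      obtain N :: nat where N: "C / e < N" using reals_Archimedean2 by blast
      show "\<exists>M. \<forall>m\<ge>M. \<forall>n>m. norm (alt u (1 / real (Suc m)) 0 - alt u (1 / real (Suc n)) 0) < e"
      proof (intro exI[of _ N] allI impI)
        fix m n assume mn: "m \<ge> N" "n > m"
        have "norm (alt u (1 / real (Suc m)) 0 - alt u (1 / real (Suc n)) 0) \<le> C * (1 / real (Suc m) - 1 / real (Suc n))"
          by (rule C) (use mn in \<open>auto intro!: divide_left_mono\<close>)
        also have "\<dots> \<le> C * (1 / real (Suc m))" using C0 by (intro mult_left_mono) auto
        also have "\<dots> < e"
        proof -
          have "C < N * e" using N e by (simp add: field_simps)
          also have "\<dots> \<le> real (Suc m) * e" using mn e by (intro mult_right_mono) auto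
          finally show ?thesis by (simp add: field_simps)
        qed
        finally show "norm (alt u (1 / real (Suc m)) 0 - alt u (1 / real (Suc n)) 0) < e" .
      qed
    qed
    then show ?thesis unfolding \<eta>_def by (simp add: Cauchy_convergent convergent_LIMSEQ_iff[symmetric])
  qed
  have bd: "\<exists>C. \<forall>u x. norm u \<le> real R \<longrightarrow> x > 0 \<longrightarrow> norm (alt u x 0 - \<eta> u) \<le> C * x" for R
  proof -
    obtain C where C: "\<And>u x y. norm u \<le> real R \<Longrightarrow> 0 < y \<Longrightarrow> y \<le> x \<Longrightarrow> norm (alt u x 0 - alt u y 0) \<le> C * (x - y)"
      using lip[of R] by blast
    have C0: "C \<ge> 0" using order.trans[OF norm_ge_zero C[of 0 1 2]] by simp
    have "norm (alt u x 0 - \<eta> u) \<le> C * x" if u: "norm u \<le> real R" and x: "x > 0" for u x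
    proof (rule LIMSEQ_le_const2)
      show "(\<lambda>n. norm (alt u x 0 - alt u (1 / real (Suc n)) 0)) \<longlonglongrightarrow> norm (alt u x 0 - \<eta> u)"
        by (intro tendsto_intros lim)
      obtain N :: nat where N: "1 / x < N" using reals_Archimedean2 by blast
      show "\<exists>N. \<forall>n\<ge>N. norm (alt u x 0 - alt u (1 / real (Suc n)) 0) \<le> C * x"
      proof (intro exI[of _ N] allI impI)
        fix n assume "n \<ge> N"
        then have "1 / x < real (Suc n)" using N by linarith
        then have "1 / real (Suc n) \<le> x" using x by (simp add: field_simps)
        then have "norm (alt u x 0 - alt u (1 / real (Suc n)) 0) \<le> C * (x - 1 / real (Suc n))"
          by (intro C u) auto
        also have "\<dots> \<le> C * x" using C0 by (intro mult_left_mono) auto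
        finally show "norm (alt u x 0 - alt u (1 / real (Suc n)) 0) \<le> C * x" .
      qed
    qed
    then show ?thesis by blast
  qed
  have "\<eta> holomorphic_on UNIV"
  proof (rule holomorphic_uniform_sequence[where f = "\<lambda>n u. alt u (1 / real (Suc n)) 0"])
    show "(\<lambda>u. alt u (1 / real (Suc n)) 0) holomorphic_on UNIV" for n
      by (rule lerch_holomorphic) auto
    fix u :: complex
    obtain R :: nat where R: "norm u + 1 \<le> R" using real_arch_simple[of "norm u + 1"] by auto
    obtain C where C: "\<And>u x. norm u \<le> real R \<Longrightarrow> x > 0 \<Longrightarrow> norm (alt u x 0 - \<eta> u) \<le> C * x"
      using bd[of R] by blast
    have "uniform_limit (cball u 1) (\<lambda>n u. alt u (1 / real (Suc n)) 0) \<eta> sequentially"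
      unfolding uniform_limit_iff
    proof (intro allI impI)
      fix e :: real assume e: "e > 0"
      have "(\<lambda>n. C * (1 / real (Suc n))) \<longlonglongrightarrow> C * 0"
        by (intro tendsto_intros LIMSEQ_Suc lim_1_over_n)
      then have "\<forall>\<^sub>F n in sequentially. C * (1 / real (Suc n)) < e"
        using e by (intro order_tendstoD) auto
      then show "\<forall>\<^sub>F n in sequentially. \<forall>w\<in>cball u 1. dist (alt w (1 / real (Suc n)) 0) (\<eta> w) < e"
      proof eventually_elim
        case (elim n)
        show ?case
        proof
          fix w assume "w \<in> cball u 1"
          then have "norm w \<le> R" using norm_triangle_sub[of w u] R by (auto simp: dist_norm norm_minus_commute)
          then have "norm (alt w (1 / real (Suc n)) 0 - \<eta> w) \<le> C * (1 / real (Suc n))" by (intro C) auto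
          then show "dist (alt w (1 / real (Suc n)) 0) (\<eta> w) < e" using elim by (simp add: dist_norm)
        qed
      qed
    qed
    then show "\<exists>d>0. cball u d \<subseteq> UNIV \<and> uniform_limit (cball u d) (\<lambda>n u. alt u (1 / real (Suc n)) 0) \<eta> sequentially"
      by (intro exI[of _ 1]) auto
  qed auto
  then show ?thesis using bd by blast
qed

text \<open>Each differentiation in \<open>x\<close> replaces \<open>u\<close> by
  \<open>u - 1\<close> and changes the sign, so these are the Taylor coefficients at 0 as long as
  the derivatives extend continuously.\<close>

definition alt_taylor :: "(complex \<Rightarrow> complex) \<Rightarrow> nat \<Rightarrow> complex \<Rightarrow> complex" where
  "alt_taylor \<eta> k u = (-1) ^ k / fact k * \<eta> (u - of_nat k)"

text \<open>The derivative of the remainder of order \<open>K + 1\<close> at \<open>u\<close> is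
  minus the remainder of order \<open>K\<close> at \<open>u - 1\<close>. Since the remainder tends
  to 0 at the origin, the mean value theorem turns the bound \<open>C * x ^ K\<close> into one with
  an additional factor \<open>x\<close>.\<close>

lemma alt_taylor_remainder:
  assumes \<eta>: "\<And>R. \<exists>C. \<forall>u x. norm u \<le> real R \<longrightarrow> x > 0 \<longrightarrow> norm (alt u x 0 - \<eta> u) \<le> C * x"
  shows "\<exists>C. \<forall>u x. norm u \<le> real R \<longrightarrow> x > 0 \<longrightarrow>
    norm (alt u x 0 - (\<Sum>k<K. alt_taylor \<eta> k u * of_real x ^ k)) \<le> C * x ^ K"
proof (induction K arbitrary: R)
  case 0
  then show ?case using alt_bounded_0[of R] by simp
next
  case (Suc K)
  obtain C where C: "\<And>u x. norm u \<le> real (R + 1) \<Longrightarrow> x > 0 \<Longrightarrow>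
      norm (alt u x 0 - (\<Sum>k<K. alt_taylor \<eta> k u * of_real x ^ k)) \<le> C * x ^ K"
    using Suc.IH[of "R + 1"] by blast
  obtain D where D: "\<And>u x. norm u \<le> real R \<Longrightarrow> x > 0 \<Longrightarrow> norm (alt u x 0 - \<eta> u) \<le> D * x"
    using \<eta>[of R] by blast
  have C0: "C \<ge> 0" using order.trans[OF norm_ge_zero C[of 0 1]] by simp
  have "norm (alt u x 0 - (\<Sum>k<Suc K. alt_taylor \<eta> k u * of_real x ^ k)) \<le> C * x ^ Suc K"
    if u: "norm u \<le> real R" and x: "x > 0" for u x
  proof -
    define g where "g = (\<lambda>z. lerch (-1) u z 0 - (\<Sum>k<Suc K. alt_taylor \<eta> k u * z ^ k))"
    define g' where "g' = (\<lambda>y::real. - (alt (u - 1) y 0 - (\<Sum>k<K. alt_taylor \<eta> k (u - 1) * of_real y ^ k)))"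
    have der: "(g has_field_derivative g' y) (at (of_real y))" if "y > 0" for y :: real
    proof -
      \<comment> \<open>The Taylor polynomials obey the same rule under differentiation as the
        series in \<open>lerch_deriv_x\<close>.\<close>
      have *: "alt_taylor \<eta> (Suc k) u * of_nat (Suc k) = - alt_taylor \<eta> k (u - 1)" for k
        by (simp add: alt_taylor_def divide_simps algebra_simps del: of_nat_Suc) (simp add: algebra_simps)
      have "((\<lambda>z. \<Sum>k<Suc K. alt_taylor \<eta> k u * z ^ k) has_field_derivative
          (\<Sum>k<Suc K. alt_taylor \<eta> k u * (of_nat k * of_real y ^ (k - 1)))) (at (of_real y))"
        by (auto intro!: derivative_eq_intros simp: mult_ac)
      also have "(\<Sum>k<Suc K. alt_taylor \<eta> k u * (of_nat k * of_real y ^ (k - 1))) =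
          (\<Sum>k<K. (alt_taylor \<eta> (Suc k) u * of_nat (Suc k)) * of_real y ^ k)"
        by (subst sum.lessThan_Suc_shift) (simp add: mult_ac del: of_nat_Suc)
      also have "\<dots> = - (\<Sum>k<K. alt_taylor \<eta> k (u - 1) * of_real y ^ k)"
        unfolding * by (simp add: sum_negf)
      finally have 1: "((\<lambda>z. \<Sum>k<Suc K. alt_taylor \<eta> k u * z ^ k) has_field_derivative
          - (\<Sum>k<K. alt_taylor \<eta> k (u - 1) * of_real y ^ k)) (at (of_real y))" .
      have 2: "((\<lambda>z. lerch (-1) u z 0) has_field_derivative - lerch (-1) (u - 1) (of_real y) 0) (at (of_real y))"
        by (rule lerch_deriv_x) (use that in auto)
      show ?thesis unfolding g_def g'_def using DERIV_diff[OF 2 1] by (simp add: algebra_simps)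
    qed
    have bd: "norm (g' y) \<le> C * x ^ K" if "0 < y" "y \<le> x" for y
    proof -
      have "norm (u - 1) \<le> real (R + 1)" using norm_triangle_ineq4[of u 1] u by simp
      from C[OF this that(1)] have "norm (g' y) \<le> C * y ^ K"
        unfolding g'_def norm_minus_cancel .
      also have "\<dots> \<le> C * x ^ K" using that C0 by (intro mult_left_mono power_mono) auto
      finally show ?thesis .
    qed
    have step: "norm (g (of_real x) - g (of_real y)) \<le> C * x ^ K * (x - y)" if "0 < y" "y \<le> x" for y
      by (rule alt_diff_le[where f' = g']) (use that bd der in auto)
    \<comment> \<open>The derivative is available for positive arguments only, so the mean value
      estimate is taken from \<open>y n\<close> to \<open>x\<close> and then \<open>y n\<close>
      tends to 0.\<close>
    define y where "y = (\<lambda>n. x / real (Suc n))"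
    have y0: "y \<longlonglongrightarrow> 0"
      unfolding y_def using LIMSEQ_Suc[OF lim_const_over_n[of x]] by simp
    have y: "0 < y n" "y n \<le> x" for n using x by (auto simp: y_def divide_le_eq mult_le_cancel_left1)
    have a0: "(\<lambda>n. alt u (y n) 0 - \<eta> u) \<longlonglongrightarrow> 0"
    proof (rule Lim_null_comparison)
      show "\<forall>\<^sub>F n in sequentially. norm (alt u (y n) 0 - \<eta> u) \<le> D * y n"
        using D[OF u y(1)] by auto
      show "(\<lambda>n. D * y n) \<longlonglongrightarrow> 0" using tendsto_mult_left[OF y0, of D] by simp
    qed
    have "(\<lambda>n. \<Sum>k<Suc K. alt_taylor \<eta> k u * of_real (y n) ^ k) \<longlonglongrightarrow> (\<Sum>k<Suc K. alt_taylor \<eta> k u * of_real 0 ^ k)"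
      by (intro tendsto_intros y0)
    also have "(\<Sum>k<Suc K. alt_taylor \<eta> k u * of_real 0 ^ k) = \<eta> u"
      by (subst sum.lessThan_Suc_shift) (simp add: alt_taylor_def)
    finally have "(\<lambda>n. (alt u (y n) 0 - \<eta> u) - ((\<Sum>k<Suc K. alt_taylor \<eta> k u * of_real (y n) ^ k) - \<eta> u)) \<longlonglongrightarrow> 0 - (\<eta> u - \<eta> u)"
      by (intro tendsto_diff a0 tendsto_const)
    then have gy: "(\<lambda>n. g (of_real (y n))) \<longlonglongrightarrow> 0"
      by (simp add: g_def del: sum.lessThan_Suc)
    have "norm (g (of_real x) - 0) \<le> C * x ^ K * (x - 0)"
      by (rule LIMSEQ_le[OF tendsto_norm[OF tendsto_diff[OF tendsto_const gy]]
            tendsto_mult[OF tendsto_const tendsto_diff[OF tendsto_const y0]]])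
         (use step y in auto)
    then show ?thesis by (simp add: g_def mult_ac)
  qed
  then show ?case by blast
qed

lemma continuous_on_lerch_x: "continuous_on {0<..} (\<lambda>x. lerch \<epsilon> u (of_real x) 0)" if "norm \<epsilon> \<le> 1"
proof -
  have "(\<lambda>x. lerch \<epsilon> u x 0) holomorphic_on {x. Re x > 0}"
    unfolding holomorphic_on_def field_differentiable_def
    using lerch_deriv_x[OF that] has_field_derivative_at_within by blast
  then have "continuous_on {x. Re x > 0} (\<lambda>x. lerch \<epsilon> u x 0)"
    by (rule holomorphic_on_imp_continuous_on)
  then show ?thesis
    by (rule continuous_on_compose2) (auto intro!: continuous_intros)
qed

lemma greaterThanAtMost_subseteq_greaterThan: "{a<..b} \<subseteq> {a<..}" for a b :: real
  by auto

lemma expands_alt: "expands M (\<lambda>u x. alt u x 0)"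
  unfolding expands_def
proof
  fix K
  obtain \<eta> where \<eta>: "\<eta> holomorphic_on UNIV"
    "\<And>R. \<exists>C. \<forall>u x. norm u \<le> real R \<longrightarrow> x > 0 \<longrightarrow> norm (alt u x 0 - \<eta> u) \<le> C * x"
    using alt_limit by auto
  define R where "R = (\<lambda>u x. (alt u x 0 - (\<Sum>k<K. alt_taylor \<eta> k u * of_real x ^ k)) / of_real x ^ K)"
  have hol: "alt_taylor \<eta> k holomorphic_on A" for k A
  proof -
    have "(\<eta> \<circ> (\<lambda>u. u - of_nat k)) holomorphic_on A"
      by (rule holomorphic_on_compose) (auto intro!: holomorphic_intros holomorphic_on_subset[OF \<eta>(1)])
    then show ?thesis unfolding alt_taylor_def comp_def by (intro holomorphic_intros)
  qed
  have "growth M 0 R"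
    unfolding growth_def
  proof (intro conjI ballI)
    fix u :: complex
    show "continuous_on {0<..2} (R u)"
      using continuous_on_subset[OF continuous_on_lerch_x[of "-1" u], of "{0<..2}"] greaterThanAtMost_subseteq_greaterThan
      unfolding R_def by (auto intro!: continuous_intros)
    obtain N :: nat where N: "norm u + 1 \<le> N" using real_arch_simple[of "norm u + 1"] by auto
    obtain C where C: "\<And>u x. norm u \<le> real N \<Longrightarrow> x > 0 \<Longrightarrow>
      norm (alt u x 0 - (\<Sum>k<K. alt_taylor \<eta> k u * of_real x ^ k)) \<le> C * x ^ K"
      using alt_taylor_remainder[OF \<eta>(2), of N K] by blast
    have "norm (R w x) * x ^ 0 \<le> C" if "w \<in> ball u 1" "x \<in> {0<..2}" for w x
    proof -
      have "norm w \<le> N" using that norm_triangle_sub[of w u] N by (auto simp: dist_norm norm_minus_commute)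
      then show ?thesis using C[of w x] that
        by (simp add: R_def norm_divide norm_power divide_le_eq)
    qed
    then show "\<exists>r C. r > 0 \<and> (\<forall>w\<in>ball u r \<inter> half_plane M. \<forall>x\<in>{0<..2}. norm (R w x) * x ^ 0 \<le> C)"
      by (intro exI[of _ 1] exI[of _ C]) auto
  next
    fix x :: real assume "x \<in> {0<..2}"
    then show "(\<lambda>u. R u x) holomorphic_on half_plane M"
      unfolding R_def by (auto intro!: holomorphic_intros hol lerch_holomorphic)
  qed
  moreover have "alt u x 0 = (\<Sum>k<K. alt_taylor \<eta> k u * of_real x ^ k) + of_real x ^ K * R u x" if "x \<in> {0<..2}" for u x
    using that by (simp add: R_def)
  ultimately show "\<exists>e R. (\<forall>k<K. e k holomorphic_on half_plane M) \<and> growth M 0 R \<and>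
     (\<forall>u\<in>half_plane M. \<forall>x\<in>{0<..2}.
        alt u x 0 = (\<Sum>k<K. e k u * of_real x ^ k) + of_real x ^ K * R u x)"
    using hol by (intro exI[of _ "alt_taylor \<eta>"] exI[of _ R]) auto
qed

text \<open>Each step splits off the value at 0 and divides the rest by \<open>z\<close>;
  \<open>pole_lemma\<close> keeps the quotient holomorphic at 0.\<close>

lemma holomorphic_taylor_remainder:
  assumes "f holomorphic_on ball 0 r" "r > 0"
  shows "\<exists>a R. R holomorphic_on ball 0 r \<and> (\<forall>z\<in>ball 0 r. f z = (\<Sum>k<K::nat. a k * z ^ k) + z ^ K * R z)"
proof (induction K)
  case 0
  then show ?case using assms by auto
next
  case (Suc K)
  then obtain a R where R: "R holomorphic_on ball 0 r"
    and f: "\<And>z. z \<in> ball 0 r \<Longrightarrow> f z = (\<Sum>k<K. a k * z ^ k) + z ^ K * R z" by blast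
  define R' where "R' = (\<lambda>z. if z = 0 then deriv R 0 else (R z - R 0) / (z - 0))"
  define a' where "a' = a(K := R 0)"
  have "R' holomorphic_on ball 0 r"
    unfolding R'_def by (rule pole_lemma[OF R]) (use assms(2) in auto)
  moreover have "f z = (\<Sum>k<Suc K. a' k * z ^ k) + z ^ Suc K * R' z" if "z \<in> ball 0 r" for z
  proof -
    have "R z = R 0 + z * R' z" by (simp add: R'_def)
    then show ?thesis using f[OF that] by (simp add: a'_def algebra_simps)
  qed
  ultimately show ?case by blast
qed

text \<open>A disc of radius 3 contains the compact interval from 0 to 2, on which the remainder is
  therefore bounded.\<close>

lemma expands_holomorphic:
  assumes "f holomorphic_on ball 0 3"
  shows "expands M (\<lambda>u x. f (of_real x))"
  unfolding expands_def
proof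
  fix K
  obtain a R where R: "R holomorphic_on ball 0 3"
    and f: "\<And>z. z \<in> ball 0 3 \<Longrightarrow> f z = (\<Sum>k<K. a k * z ^ k) + z ^ K * R z"
    using holomorphic_taylor_remainder[OF assms, of K] by auto
  have cont: "continuous_on {0..2} (\<lambda>x. R (of_real x))"
    by (rule continuous_on_compose2[OF holomorphic_on_imp_continuous_on[OF R]]) (auto intro!: continuous_intros)
  then have "compact ((\<lambda>x. R (of_real x)) ` {0..2})" by (rule compact_continuous_image) simp
  then obtain C where C: "\<And>x. x \<in> {0..2} \<Longrightarrow> norm (R (of_real x)) \<le> C"
    by (meson bounded_iff compact_imp_bounded image_eqI)
  have "growth M 0 (\<lambda>u x. R (of_real x))"
    unfolding growth_def
  proof (intro conjI ballI)
    fix u show "continuous_on {0<..2} (\<lambda>x. R (of_real x))" by (rule continuous_on_subset[OF cont]) auto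
    show "\<exists>r C. r > 0 \<and> (\<forall>w\<in>ball u r \<inter> half_plane M. \<forall>x\<in>{0<..2}. norm (R (of_real x)) * x ^ 0 \<le> C)"
      using C by (intro exI[of _ 1] exI[of _ C]) auto
  qed auto
  then show "\<exists>e R. (\<forall>k<K. e k holomorphic_on half_plane M) \<and> growth M 0 R \<and>
     (\<forall>u\<in>half_plane M. \<forall>x\<in>{0<..2}. f (of_real x) = (\<Sum>k<K. e k u * of_real x ^ k) + of_real x ^ K * R u x)"
    using f by (intro exI[of _ "\<lambda>k u. a k"] exI[of _ "\<lambda>u x. R (of_real x)"]) auto
qed

text \<open>The zero of \<open>sinh\<close> at 0 cancels against \<open>x\<close>, and its other
  zeros are nonzero multiples of \<pi> on the imaginary axis, outside the disc of radius 3.\<close>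

lemma expands_div_sinh: "expands M (\<lambda>u x. of_real (x / (2 * sinh x)))"
proof -
  define g :: "complex \<Rightarrow> complex" where "g = (\<lambda>z. if z = 0 then deriv sinh 0 else (sinh z - sinh 0) / (z - 0))"
  have g: "g holomorphic_on ball 0 3"
    unfolding g_def by (rule pole_lemma) (auto simp: sinh_field_def[abs_def] intro!: holomorphic_intros)
  have d: "deriv sinh 0 = (1::complex)"
    by (rule DERIV_imp_deriv) (auto intro!: derivative_eq_intros)
  have "g z \<noteq> 0" if z: "z \<in> ball 0 3" for z
  proof (cases "z = 0")
    case False
    have "sinh z \<noteq> 0"
    proof
      assume "sinh z = 0"
      then have "sin (\<i> * z) = 0" by (simp add: sinh_conv_sin)
      then obtain n :: int where n: "\<i> * z = of_real (n * pi)" by (auto simp: sin_eq_0)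
      then have "norm z = norm (complex_of_real (n * pi))" by (metis norm_ii norm_mult mult_1)
      also have "\<dots> = \<bar>real_of_int n\<bar> * pi" by (simp only: norm_of_real abs_mult) simp
      finally have nz: "norm z = \<bar>real_of_int n\<bar> * pi" .
      have "n \<noteq> 0" using n False by auto
      then have "1 * 3 \<le> \<bar>real_of_int n\<bar> * pi" using pi_gt3 by (intro mult_mono) auto
      then show False using nz z by simp
    qed
    then show ?thesis using False by (simp add: g_def)
  qed (simp add: g_def d)
  then have "(\<lambda>z. 1 / (2 * g z)) holomorphic_on ball 0 3"
    using g by (intro holomorphic_intros) auto
  then have "expands M (\<lambda>u x. 1 / (2 * g (of_real x)))" by (rule expands_holomorphic)
  moreover have "1 / (2 * g (of_real x)) = of_real (x / (2 * sinh x))" if "x > 0" for x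
    using that by (simp add: g_def sinh_field_def flip: exp_of_real)
  ultimately show ?thesis unfolding expands_def by simp
qed

section \<open>Continuation of the Mellin transform\<close>

abbreviation polylog :: "complex \<Rightarrow> real \<Rightarrow> complex" where
  "polylog u x \<equiv> lerch 1 u (of_real x) 0"

text \<open>In the difference of the two series the terms with odd number cancel and those with even
  number double; extracting the factor 2 from the even numbers gives \<open>2 powr (1 - u)\<close>
  times the series at \<open>2 * x\<close>.\<close>

lemma polylog_scaling:
  assumes "x > 0"
  shows "polylog u x = 2 powr (1 - u) * polylog u (2 * x) + alt u x 0"
proof -
  have 1: "lerch_term 1 u (of_real x) 0 sums polylog u x" by (rule lerch_sums) (use assms in auto)
  have 2: "lerch_term (-1) u (of_real x) 0 sums lerch (-1) u (of_real x) 0" by (rule lerch_sums) (use assms in auto)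
  have 3: "lerch_term 1 u (of_real (2 * x)) 0 sums polylog u (2 * x)" by (rule lerch_sums) (use assms in auto)
  define f where "f = (\<lambda>n. lerch_term 1 u (of_real x) 0 n - lerch_term (-1) u (of_real x) 0 n)"
  have f: "f sums (polylog u x - alt u x 0)"
    unfolding f_def using sums_diff[OF 1 2] by simp
  \<comment> \<open>Indices are zero-based: the even numbers sit at the odd indices.\<close>
  have "(\<lambda>n. f (2 * n + 1)) sums (polylog u x - alt u x 0)"
  proof (subst sums_mono_reindex)
    show "strict_mono (\<lambda>n::nat. 2 * n + 1)" by (auto simp: strict_mono_def)
    show "f n = 0" if "n \<notin> range (\<lambda>n. 2 * n + 1)" for n
    proof -
      have "even n" using that by (metis oddE rangeI)
      then show ?thesis by (simp add: f_def lerch_term_def)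
    qed
  qed (rule f)
  moreover have "f (2 * n + 1) = 2 powr (1 - u) * lerch_term 1 u (of_real (2 * x)) 0 n" for n
  proof -
    have "(2::complex) powr (1 - u) = 2 * 2 powr (- u)"
      using powr_add[of "2::complex" 1 "- u"] by simp
    moreover have "(2 * complex_of_real (real (Suc n))) powr (- u) = 2 powr (- u) * of_nat (Suc n) powr (- u)"
      using powr_of_real_double[of "real (Suc n)" "- u"] by (simp del: of_nat_Suc)
    moreover have "complex_of_nat (Suc (2 * n + 1)) = 2 * complex_of_real (real (Suc n))" by simp
    ultimately show ?thesis
      by (simp add: f_def lerch_term_def del: of_nat_Suc) (simp add: mult_ac)
  qed
  ultimately have "(\<lambda>n. 2 powr (1 - u) * lerch_term 1 u (of_real (2 * x)) 0 n) sums (polylog u x - alt u x 0)"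
    by simp
  from sums_unique2[OF this sums_mult[OF 3]] show ?thesis by (simp add: algebra_simps)
qed

text \<open>For \<open>Re u \<ge> - M\<close> the series is dominated by
  \<open>\<Sum>n. n^M * exp (- n x)\<close>. Half of the decay absorbs \<open>n^M\<close> at the
  price of \<open>(2 / x) ^ M\<close>; the remaining geometric series costs another
  \<open>2 / x\<close>.\<close>

lemma norm_lerch_le_power:
  assumes "norm \<epsilon> \<le> 1" "x > 0" "Re u \<ge> - real M"
  shows "norm (lerch \<epsilon> u (of_real x) 0) * x ^ (M + 1) \<le> fact M * 2 ^ (M + 1)"
proof -
  have b: "norm (lerch_term \<epsilon> u (of_real x) 0 n) \<le> fact M * (2 / x) ^ M * exp (- (x / 2)) ^ Suc n" for n
  proof -
    have "norm (lerch_term \<epsilon> u (of_real x) 0 n) =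
        norm \<epsilon> ^ n * norm (complex_of_real (real (Suc n)) powr (- u)) * norm (exp (complex_of_real (- (real (Suc n) * x))))"
      by (simp add: lerch_term_def norm_mult norm_power)
    also have "\<dots> = norm \<epsilon> ^ n * real (Suc n) powr (- Re u) * exp (- x * real (Suc n))"
      using norm_of_real_powr[of "real (Suc n)" "- u"]
      by (simp only: norm_exp_eq_Re Re_complex_of_real uminus_complex.sel) simp
    also have "\<dots> \<le> 1 * real (Suc n) powr real M * exp (- x * real (Suc n))"
      using assms by (intro mult_mono power_le_one powr_mono) auto
    also have "\<dots> = real (Suc n) ^ M * exp (- x * real (Suc n))"
      by (simp add: powr_realpow del: of_nat_Suc)
    also have "\<dots> \<le> fact M * (2 / x) ^ M * exp (- (x / 2) * real (Suc n))"
      by (rule power_exp_le) (use assms in auto)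
    also have "exp (- (x / 2) * real (Suc n)) = exp (- (x / 2)) ^ Suc n"
      by (subst exp_of_nat_mult[symmetric]) (simp add: mult_ac)
    finally show ?thesis .
  qed
  define q where "q = exp (- (x / 2))"
  have q: "0 < q" "q < 1" using assms by (auto simp: q_def)
  have "(\<lambda>n. q * q ^ n) sums (q / (1 - q))"
    using sums_mult[OF geometric_sums[of q], of q] q by simp
  then have gs: "(\<lambda>n. fact M * (2 / x) ^ M * q ^ Suc n) sums (fact M * (2 / x) ^ M * (q / (1 - q)))"
    unfolding power_Suc by (rule sums_mult)
  have "norm (lerch \<epsilon> u (of_real x) 0) \<le> fact M * (2 / x) ^ M * (q / (1 - q))"
    unfolding lerch_def
  proof (rule norm_suminf_le[of _ "\<lambda>n. fact M * (2 / x) ^ M * q ^ Suc n", THEN order.trans])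
    show "norm (lerch_term \<epsilon> u (of_real x) 0 n) \<le> fact M * (2 / x) ^ M * q ^ Suc n" for n
      using b[of n] by (simp add: q_def)
    show "summable (\<lambda>n. fact M * (2 / x) ^ M * q ^ Suc n)"
      using gs by (simp only: sums_iff)
    show "(\<Sum>n. fact M * (2 / x) ^ M * q ^ Suc n) \<le> fact M * (2 / x) ^ M * (q / (1 - q))"
      using gs by (simp only: sums_iff)
  qed
  also have "q / (1 - q) \<le> 2 / x"
  proof -
    have "q * (1 + x / 2) \<le> q * exp (x / 2)"
      using q exp_ge_add_one_self[of "x / 2"] by (intro mult_left_mono) auto
    also have "\<dots> = 1" by (simp add: q_def flip: exp_add)
    finally have "q + q * (x / 2) \<le> 1" by (simp add: distrib_left)
    then show ?thesis using q assms by (simp add: field_simps)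
  qed
  then have "fact M * (2 / x) ^ M * (q / (1 - q)) \<le> fact M * (2 / x) ^ M * (2 / x)"
    using assms by (intro mult_left_mono) auto
  finally have "norm (lerch \<epsilon> u (of_real x) 0) \<le> fact M * (2 / x) ^ (M + 1)" by (simp add: mult_ac)
  then have "norm (lerch \<epsilon> u (of_real x) 0) * x ^ (M + 1) \<le> fact M * (2 / x) ^ (M + 1) * x ^ (M + 1)"
    using assms by (intro mult_right_mono) auto
  also have "\<dots> = fact M * 2 ^ (M + 1)"
    using assms by (simp add: power_mult_distrib[symmetric] mult.assoc del: power_Suc)
  finally show ?thesis .
qed

lemma tame_polylog: "tame M polylog"
  unfolding tame_def
proof (intro conjI allI impI)
  have "growth M (M + 1) polylog"
    unfolding growth_def
  proof (intro conjI ballI)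
    fix u show "continuous_on {0<..2} (polylog u)" by (rule continuous_on_subset[OF continuous_on_lerch_x]) auto
    show "\<exists>r C. r > 0 \<and> (\<forall>w\<in>ball u r \<inter> half_plane M. \<forall>x\<in>{0<..2}. norm (polylog w x) * x ^ (M + 1) \<le> C)"
    proof (intro exI conjI ballI)
      fix w x assume "w \<in> ball u 1 \<inter> half_plane M" "x \<in> {0<..2::real}"
      then show "norm (polylog w x) * x ^ (M + 1) \<le> fact M * 2 ^ (M + 1)"
        by (intro norm_lerch_le_power) (auto simp: half_plane_def)
    qed simp
  next
    fix x :: real assume "x \<in> {0<..2}"
    then show "(\<lambda>u. polylog u x) holomorphic_on half_plane M" by (intro lerch_holomorphic) auto
  qed
  then show "\<exists>N. growth M N polylog" ..
  fix u :: complex assume u: "Re u > 1"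
  have "norm (polylog u x) \<le> (\<Sum>n. real (Suc n) powr (- Re u))" if "x > 0" for x
    using norm_lerch_le_suminf[of 1 x 0 "Re u" u] that u summable_Suc_powr[OF u] by simp
  then have "\<forall>x\<in>{0<..2}. norm (polylog u x) \<le> (\<Sum>n. real (Suc n) powr (- Re u))" by simp
  then show "\<exists>C. \<forall>x\<in>{0<..2}. norm (polylog u x) \<le> C" by (rule exI)
qed

lemma continuable_polylog: "continuable M polylog"
proof (rule continuable_scaling[where a = "\<lambda>u. 2 powr (1 - u)", OF tame_polylog])
  have "continuable M (\<lambda>u x. alt u x 0 * 1)"
    by (rule continuable_expands_mult[OF expands_alt tame_const continuable_one]) auto
  then show "continuable M (\<lambda>u x. alt u x 0)" by simp
  show "norm (2 powr (1 - u) :: complex) \<le> 1" if "Re u > 1" for u :: complex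
    using that powr_mono[of "1 - Re u" 0 2] by (simp add: norm_powr_real_powr)
  show "polylog u x = 2 powr (1 - u) * polylog u (2 * x) + alt u x 0" if "x \<in> {0<..<1}" for u x
    by (rule polylog_scaling) (use that in auto)
qed (auto intro!: holomorphic_intros)

text \<open>Squaring \<open>L(x) - A(x) = 2 powr (1 - u) * L(2x)\<close> gives a scaling relation
  for the square with inhomogeneous part \<open>2 A L - A^2\<close>, which is continuable by the
  linear case. The factors \<open>of_real x ^ 0\<close> give this part the shape of
  \<open>continuable_cmult\<close>.\<close>

lemma continuable_polylog_square: "continuable M (\<lambda>u x. polylog u x ^ 2)"
proof (rule continuable_scaling[where a = "\<lambda>u. 2 powr (2 - 2 * u)" and
      \<Psi> = "\<lambda>u x. 2 * of_real x ^ 0 * (alt u x 0 * polylog u x) + (-1) * of_real x ^ 0 * (alt u x 0 * alt u x 0)"])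
  note alt_tame = expands_imp_tame[OF expands_alt]
  show "tame M (\<lambda>u x. polylog u x ^ 2)"
    using tame_mult[OF tame_polylog tame_polylog] by (simp add: power2_eq_square)
  have "continuable M (\<lambda>u x. alt u x 0 * 1)"
    by (rule continuable_expands_mult[OF expands_alt tame_const continuable_one]) auto
  then have a: "continuable M (\<lambda>u x. alt u x 0)" by simp
  show "continuable M (\<lambda>u x. 2 * of_real x ^ 0 * (alt u x 0 * polylog u x) + (-1) * of_real x ^ 0 * (alt u x 0 * alt u x 0))"
    by (intro continuable_add tame_cmult_power continuable_cmult continuable_expands_mult
        expands_alt tame_mult tame_polylog continuable_polylog alt_tame a holomorphic_on_const)
  show "norm (2 powr (2 - 2 * u) :: complex) \<le> 1" if "Re u > 1" for u :: complex
    using that powr_mono[of "2 - 2 * Re u" 0 2] by (simp add: norm_powr_real_powr)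
  show "polylog u x ^ 2 = 2 powr (2 - 2 * u) * polylog u (2 * x) ^ 2 +
      (2 * of_real x ^ 0 * (alt u x 0 * polylog u x) + (-1) * of_real x ^ 0 * (alt u x 0 * alt u x 0))"
    if "x \<in> {0<..<1}" for u x
  proof -
    have "(2::complex) powr (2 - 2 * u) = (2 powr (1 - u)) ^ 2"
      by (simp add: power2_eq_square powr_add[symmetric])
    moreover have "2 powr (1 - u) * polylog u (2 * x) = polylog u x - alt u x 0"
      using polylog_scaling[of x u] that by simp
    ultimately have "2 powr (2 - 2 * u) * polylog u (2 * x) ^ 2 = (polylog u x - alt u x 0) ^ 2"
      by (simp flip: power_mult_distrib)
    then show ?thesis by (simp add: power2_eq_square algebra_simps)
  qed
qed (auto intro!: holomorphic_intros)

lemma continuable_triple: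
  "continuable M (\<lambda>u x. of_real (x / (2 * sinh x)) * polylog u x ^ 2)"
proof (rule continuable_expands_mult[OF expands_div_sinh _ continuable_polylog_square])
  show "tame M (\<lambda>u x. polylog u x ^ 2)"
    using tame_mult[OF tame_polylog tame_polylog] by (simp add: power2_eq_square)
qed

section \<open>The kernel on the whole positive half-line\<close>

definition mellin_kernel :: "complex \<Rightarrow> real \<Rightarrow> complex" where
  "mellin_kernel u x = of_real x powr (u - 1) * polylog u x ^ 2 / of_real (2 * sinh x)"

lemma kernel_eq_mellin_term:
  "x > 0 \<Longrightarrow> mellin_kernel u x = mellin_term (\<lambda>u x. of_real (x / (2 * sinh x)) * polylog u x ^ 2) 0 u x"
proof -
  assume x: "x > 0"
  have "complex_of_real x powr (u - 1) = of_real x powr (u - 2) * of_real x"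
    using powr_add[of "complex_of_real x" "u - 2" 1] x by simp
  then show ?thesis by (simp add: mellin_kernel_def mellin_term_def)
qed

lemma continuous_on_kernel: "continuous_on {0<..} (mellin_kernel u)"
  unfolding mellin_kernel_def using continuous_on_lerch_x[of 1 u] by (auto intro!: continuous_intros)

lemma kernel_measurable: "A \<in> sets borel \<Longrightarrow> A \<subseteq> {0<..} \<Longrightarrow> mellin_kernel u \<in> borel_measurable (restrict_space lborel A)"
  using borel_measurable_continuous_on_restrict[OF continuous_on_subset[OF continuous_on_kernel, of A u]]
  by (simp cong: measurable_cong_sets add: sets_restrict_space_cong[OF sets_lborel])

text \<open>For \<open>x \<ge> 1\<close> the bound on \<open>polylog\<close> needs no negative
  powers of \<open>x\<close>, and \<open>2 sinh x \<ge> exp x / 4\<close> because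
  \<open>exp x \<ge> 2\<close>. This majorant makes the integral over the tail holomorphic in
  \<open>u\<close> without any continuation.\<close>

lemma norm_kernel_le:
  assumes "x \<ge> 1" "Re u \<ge> - real M" "Re u - 1 \<le> real R"
  shows "norm (mellin_kernel u x) \<le> 4 * (fact M * 2 ^ (M + 1)) ^ 2 * (x ^ R / exp x)"
proof -
  let ?B = "fact M * 2 ^ (M + 1) :: real"
  have "norm (polylog u x) * 1 \<le> norm (polylog u x) * x ^ (M + 1)"
    using assms(1) by (intro mult_left_mono one_le_power) auto
  also have "\<dots> \<le> ?B" by (rule norm_lerch_le_power) (use assms in auto)
  finally have p: "norm (polylog u x) \<le> ?B" by simp
  have e2: "exp x \<ge> 2" using exp_ge_add_one_self[of x] assms(1) by linarith
  then have "exp (- x) \<le> 1 / 2" using le_imp_inverse_le[OF e2] by (simp add: exp_minus)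
  with e2 have sh: "2 * sinh x \<ge> exp x / 4" "sinh x > 0"
    using assms(1) by (auto simp: sinh_field_def)
  have "norm (mellin_kernel u x) = x powr (Re u - 1) * norm (polylog u x) ^ 2 * (1 / (2 * sinh x))"
    using assms(1) sh(2) by (simp add: mellin_kernel_def norm_mult norm_divide norm_power norm_of_real_powr)
  also have "\<dots> \<le> x ^ R * ?B ^ 2 * (4 / exp x)"
  proof (intro mult_mono)
    have "x powr (Re u - 1) \<le> x powr real R" using assms by (intro powr_mono) auto
    then show "x powr (Re u - 1) \<le> x ^ R" using assms by (simp add: powr_realpow)
    show "norm (polylog u x) ^ 2 \<le> ?B ^ 2" by (rule power_mono[OF p]) simp
    show "1 / (2 * sinh x) \<le> 4 / exp x" using sh by (simp add: field_simps)
  qed (use assms sh in auto)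
  finally show ?thesis by (simp add: mult_ac)
qed

lemma integrable_power_exp:
  "set_integrable lborel {0<..} (\<lambda>x::real. x ^ R / exp x)"
proof -
  have "(\<lambda>t. complex_of_real t powr (of_nat (R + 1) - 1) / of_real (exp t)) absolutely_integrable_on {0<..}"
    by (intro absolutely_integrable_Gamma_integral') simp
  then have "set_integrable lborel {0<..} (\<lambda>t. complex_of_real t powr (of_nat (R + 1) - 1) / of_real (exp t))"
    unfolding set_integrable_def by (subst (asm) integrable_completion) auto
  then have "set_integrable lborel {0<..} (\<lambda>t. norm (complex_of_real t powr (of_nat (R + 1) - 1) / of_real (exp t)))"
    by (rule set_integrable_norm)
  moreover have "(\<lambda>t. indicator {0<..} t *\<^sub>R norm (complex_of_real t powr (of_nat (R + 1) - 1) / of_real (exp t))) =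
      (\<lambda>x. indicator {0<..} x *\<^sub>R (x ^ R / exp x))"
    by (auto simp: fun_eq_iff indicator_def norm_divide norm_power)
  ultimately show ?thesis unfolding set_integrable_def by (simp only:)
qed

lemma kernel_tail_holomorphic:
  "(\<lambda>u. LINT x:{1..}|lborel. mellin_kernel u x) holomorphic_on half_plane M"
proof -
  have "(\<lambda>u. \<integral>x. mellin_kernel u x \<partial>restrict_space lborel {1..}) holomorphic_on half_plane M"
  proof (rule holomorphic_on_lebesgue_integral)
    show "mellin_kernel u \<in> borel_measurable (restrict_space lborel {1..})" for u
      by (rule kernel_measurable) auto
    show "(\<lambda>u. mellin_kernel u x) holomorphic_on half_plane M" if "x \<in> space (restrict_space lborel {1..})" for x
      using that unfolding mellin_kernel_def
      by (intro holomorphic_intros lerch_holomorphic) (auto simp: space_restrict_space)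
    fix u :: complex assume u: "u \<in> half_plane M"
    obtain R :: nat where R: "norm u \<le> R" using real_arch_simple[of "norm u"] by auto
    let ?g = "\<lambda>x::real. 4 * (fact M * 2 ^ (M + 1)) ^ 2 * (x ^ R / exp x)"
    have "set_integrable lborel {1..} ?g"
      by (intro set_integrable_mult_right set_integrable_subset[OF integrable_power_exp]) auto
    then have "integrable (restrict_space lborel {1..}) ?g"
      unfolding set_integrable_def by (subst integrable_restrict_space) auto
    moreover have "norm (mellin_kernel w x) \<le> ?g x" if "w \<in> ball u 1 \<inter> half_plane M" "x \<ge> 1" for w x
    proof (rule norm_kernel_le)
      have "norm w \<le> norm u + 1"
        using that norm_triangle_sub[of w u] by (auto simp: dist_norm norm_minus_commute)
      then show "Re w - 1 \<le> real R" using R complex_Re_le_cmod[of w] by linarith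
    qed (use that in \<open>auto simp: half_plane_def\<close>)
    ultimately show "\<exists>r g. 0 < r \<and> integrable (restrict_space lborel {1..}) g \<and>
       (\<forall>w\<in>ball u r \<inter> half_plane M. \<forall>x\<in>space (restrict_space lborel {1..}). norm (mellin_kernel w x) \<le> g x)"
      by (intro exI[of _ 1] exI[of _ ?g]) (auto simp: space_restrict_space)
  qed simp
  then show ?thesis
    by (simp add: integral_restrict_space set_lebesgue_integral_def)
qed

lemma kernel_integrable_parts:
  assumes "Re u > 1"
  shows "set_integrable lborel {0<..<1} (mellin_kernel u)" "set_integrable lborel {1..} (mellin_kernel u)"
proof -
  let ?\<Phi> = "\<lambda>u x. complex_of_real (x / (2 * sinh x)) * polylog u x ^ 2"
  have "tame 0 (\<lambda>u x. polylog u x ^ 2)"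
    using tame_mult[OF tame_polylog tame_polylog] by (simp add: power2_eq_square)
  then have "tame 0 ?\<Phi>" by (rule tame_mult[OF expands_imp_tame[OF expands_div_sinh]])
  from mellin_term_integrable(1)[OF this assms, of 0]
  show "set_integrable lborel {0<..<1} (mellin_kernel u)"
    by (subst set_integrable_cong[OF refl]) (auto simp: kernel_eq_mellin_term)
  obtain R :: nat where R: "norm u \<le> R" using real_arch_simple[of "norm u"] by auto
  show "set_integrable lborel {1..} (mellin_kernel u)"
  proof (rule set_integrable_bound)
    show "set_integrable lborel {1..} (\<lambda>x::real. 4 * (fact 0 * 2 ^ (0 + 1)) ^ 2 * (x ^ R / exp x))"
      by (intro set_integrable_mult_right set_integrable_subset[OF integrable_power_exp]) auto
    show "set_borel_measurable lborel {1..} (mellin_kernel u)"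
    proof -
      have "continuous_on {1..} (mellin_kernel u)"
        by (rule continuous_on_subset[OF continuous_on_kernel]) auto
      from borel_measurable_continuous_on_indicator[OF _ this] show ?thesis
        by (simp add: set_borel_measurable_def)
    qed
    have "norm (mellin_kernel u x) \<le> 4 * (fact 0 * 2 ^ (0 + 1)) ^ 2 * (x ^ R / exp x)" if "x \<ge> 1" for x
      by (rule norm_kernel_le) (use that assms R complex_Re_le_cmod[of u] in auto)
    then show "AE x in lborel. x \<in> {1..} \<longrightarrow>
        norm (mellin_kernel u x) \<le> norm (4 * (fact 0 * 2 ^ (0 + 1)) ^ 2 * (x ^ R / exp x))"
      by (auto intro: order.trans[OF _ abs_ge_self])
  qed
qed

lemma kernel_continuation:
  "\<exists>g. g meromorphic_on half_plane M \<and> (\<forall>u. Re u > 1 \<longrightarrow> g u = (LINT x:{0<..}|lborel. mellin_kernel u x))"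
proof -
  obtain g where g: "g meromorphic_on half_plane M" and
    geq: "\<And>u. Re u > 1 \<Longrightarrow> g u = (LINT x:{0<..<1}|lborel. mellin_term (\<lambda>u x. of_real (x / (2 * sinh x)) * polylog u x ^ 2) 0 u x)"
    using continuable_triple[of M] unfolding continuable_def by blast
  have "g u + (LINT x:{1..}|lborel. mellin_kernel u x) = (LINT x:{0<..}|lborel. mellin_kernel u x)" if u: "Re u > 1" for u
  proof -
    have "g u = (LINT x:{0<..<1}|lborel. mellin_kernel u x)"
      unfolding geq[OF u] by (rule set_lebesgue_integral_cong) (auto simp: kernel_eq_mellin_term)
    moreover have un: "{0<..} = {0<..<1} \<union> {1::real..}" and "{0<..<1} \<inter> {1::real..} = {}" by auto
    ultimately show ?thesis
      unfolding un using set_integral_Un[OF _ kernel_integrable_parts[OF u]] by simp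
  qed
  moreover have "(\<lambda>u. LINT x:{1..}|lborel. mellin_kernel u x) meromorphic_on half_plane M"
    by (intro analytic_on_imp_meromorphic_on) (simp add: analytic_on_open kernel_tail_holomorphic)
  ultimately show ?thesis
    using g by (intro exI[of _ "\<lambda>u. g u + (LINT x:{1..}|lborel. mellin_kernel u x)"]) (auto intro!: meromorphic_intros)
qed

section \<open>Zeta and eta as values at \<open>x = 0\<close>\<close>

lemma lerch_0_sums:
  assumes "norm \<epsilon> \<le> 1" "Re u > 1"
  shows "summable (\<lambda>n. norm (lerch_term \<epsilon> u 0 0 n))"
proof (rule summable_comparison_test'[OF summable_Suc_powr[OF assms(2)]])
  fix n
  have "norm (lerch_term \<epsilon> u 0 0 n) = norm \<epsilon> ^ n * norm (complex_of_real (real (Suc n)) powr (- u))"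
    by (simp add: lerch_term_def norm_mult norm_power)
  also have "\<dots> = norm \<epsilon> ^ n * real (Suc n) powr (- Re u)"
    using norm_of_real_powr[of "real (Suc n)" "- u"] by (simp only: uminus_complex.sel)
  also have "\<dots> \<le> 1 * real (Suc n) powr (- Re u)"
    using assms by (intro mult_right_mono power_le_one) auto
  finally show "norm (norm (lerch_term \<epsilon> u 0 0 n)) \<le> real (Suc n) powr (- Re u)" by simp
qed

text \<open>The exponential factor has modulus at most 1, so the terms at \<open>x = 0\<close> serve
  as the majorant in Tannery's theorem.\<close>

lemma lerch_tendsto_0:
  assumes "norm \<epsilon> \<le> 1" "Re u > 1"
  shows "(\<lambda>k. lerch \<epsilon> u (of_real (1 / real (Suc k))) 0) \<longlonglongrightarrow> lerch \<epsilon> u 0 0"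
  unfolding lerch_def
proof (rule conjunct2[OF conjunct2[OF tannerys_theorem]])
  show "summable (\<lambda>n. norm (lerch_term \<epsilon> u 0 0 n))" by (rule lerch_0_sums[OF assms])
  show "(\<lambda>k. lerch_term \<epsilon> u (of_real (1 / real (Suc k))) 0 n) \<longlonglongrightarrow> lerch_term \<epsilon> u 0 0 n" for n
  proof -
    have "(\<lambda>k. complex_of_real (1 / real (Suc k))) \<longlonglongrightarrow> of_real 0"
      by (intro tendsto_intros LIMSEQ_Suc lim_1_over_n)
    then have "(\<lambda>k. \<epsilon> ^ n * (of_nat (Suc n) + 0) powr (- u) * exp (- (of_nat (Suc n) * complex_of_real (1 / real (Suc k)))))
        \<longlonglongrightarrow> \<epsilon> ^ n * (of_nat (Suc n) + 0) powr (- u) * exp (- (of_nat (Suc n) * of_real 0))"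
      by (intro tendsto_mult tendsto_const tendsto_exp tendsto_minus)
    then show ?thesis by (simp only: lerch_term_def of_real_0)
  qed
  show "\<forall>\<^sub>F (n, k) in at_top \<times>\<^sub>F sequentially.
      norm (lerch_term \<epsilon> u (of_real (1 / real (Suc k))) 0 n) \<le> norm (lerch_term \<epsilon> u 0 0 n)"
    by (intro always_eventually)
       (auto simp: lerch_term_def norm_mult intro!: mult_left_le)
qed simp

lemma alt_eq_limit:
  assumes "\<forall>R. \<exists>C. \<forall>u x. norm u \<le> real R \<longrightarrow> x > 0 \<longrightarrow> norm (alt u x 0 - \<eta> u) \<le> C * x" "Re u > 1"
  shows "\<eta> u = lerch (-1) u 0 0"
proof -
  obtain R :: nat where R: "norm u \<le> R" using real_arch_simple[of "norm u"] by auto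
  obtain C where C: "\<And>x. x > 0 \<Longrightarrow> norm (alt u x 0 - \<eta> u) \<le> C * x"
    using spec[OF assms(1), of R] R by blast
  have "(\<lambda>k. alt u (1 / real (Suc k)) 0 - \<eta> u) \<longlonglongrightarrow> 0"
  proof (rule Lim_null_comparison)
    show "\<forall>\<^sub>F k in sequentially. norm (alt u (1 / real (Suc k)) 0 - \<eta> u) \<le> C * (1 / real (Suc k))"
      by (intro always_eventually allI C) simp
    show "(\<lambda>k. C * (1 / real (Suc k))) \<longlonglongrightarrow> 0"
      using tendsto_mult_left[OF LIMSEQ_Suc[OF lim_1_over_n], of C] by simp
  qed
  then have "(\<lambda>k. alt u (1 / real (Suc k)) 0) \<longlonglongrightarrow> \<eta> u" by (simp add: LIM_zero_iff)
  moreover have "(\<lambda>k. alt u (1 / real (Suc k)) 0) \<longlonglongrightarrow> lerch (-1) u 0 0"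
    using lerch_tendsto_0[of "-1" u] assms(2) by simp
  ultimately show ?thesis by (rule LIMSEQ_unique)
qed

text \<open>The limit of the scaling relation at \<open>x = 0\<close>. Along
  \<open>x = 1 / (2 k + 2)\<close> the doubled argument is \<open>1 / (k + 1)\<close>, so both
  occurrences of \<open>polylog\<close> run through the same sequence.\<close>

lemma zeta_eq_eta:
  assumes "Re u > 1"
  shows "(1 - 2 powr (1 - u)) * lerch 1 u 0 0 = lerch (-1) u 0 0"
proof -
  have 1: "(\<lambda>k. polylog u (1 / real (Suc k))) \<longlonglongrightarrow> lerch 1 u 0 0"
    using lerch_tendsto_0[of 1 u] assms by simp
  have "(\<lambda>k. polylog u (1 / real (Suc (2 * k + 1)))) \<longlonglongrightarrow> lerch 1 u 0 0"
    using LIMSEQ_subseq_LIMSEQ[OF 1, of "\<lambda>k. 2 * k + 1"] by (simp add: strict_mono_def comp_def del: of_nat_Suc)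
  then have 2: "(\<lambda>k. polylog u (1 / real (Suc (2 * k + 1))) - 2 powr (1 - u) * polylog u (1 / real (Suc k)))
      \<longlonglongrightarrow> lerch 1 u 0 0 - 2 powr (1 - u) * lerch 1 u 0 0"
    by (intro tendsto_intros 1)
  have "(\<lambda>k. alt u (1 / real (Suc k)) 0) \<longlonglongrightarrow> lerch (-1) u 0 0"
    using lerch_tendsto_0[of "-1" u] assms by simp
  from LIMSEQ_subseq_LIMSEQ[OF this, of "\<lambda>k. 2 * k + 1"]
  have 3: "(\<lambda>k. alt u (1 / real (Suc (2 * k + 1))) 0) \<longlonglongrightarrow> lerch (-1) u 0 0"
    by (simp add: strict_mono_def comp_def del: of_nat_Suc)
  have "polylog u (1 / real (Suc (2 * k + 1))) - 2 powr (1 - u) * polylog u (1 / real (Suc k)) =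
      alt u (1 / real (Suc (2 * k + 1))) 0" for k
  proof -
    have "2 * (1 / real (Suc (2 * k + 1))) = 1 / real (Suc k)" by (simp add: field_simps)
    then show ?thesis using polylog_scaling[of "1 / real (Suc (2 * k + 1))" u]
      by (simp only:) simp
  qed
  then show ?thesis using LIMSEQ_unique[OF 2] 3 by (simp add: algebra_simps)
qed

lemma zeta_eta_continuation:
  shows "\<exists>g. g meromorphic_on UNIV \<and> (\<forall>u. Re u > 1 \<longrightarrow> g u = (lerch 1 u 0 0 ^ 3 + lerch (-1) u 0 0 ^ 3) / 2)"
proof -
  obtain \<eta> where \<eta>: "\<eta> holomorphic_on UNIV"
    "\<forall>R. \<exists>C. \<forall>u x. norm u \<le> real R \<longrightarrow> x > 0 \<longrightarrow> norm (alt u x 0 - \<eta> u) \<le> C * x"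
    using alt_limit by auto
  have e: "\<eta> u = lerch (-1) u 0 0" if "Re u > 1" for u by (rule alt_eq_limit[OF \<eta>(2) that])
  have z: "\<eta> u / (1 - 2 powr (1 - u)) = lerch 1 u 0 0" if "Re u > 1" for u
  proof -
    have "norm (2 powr (1 - u) :: complex) < 1"
      using that powr_less_mono[of "1 - Re u" 0 2] by (simp add: norm_powr_real_powr)
    then have "1 - 2 powr (1 - u) \<noteq> 0" by auto
    then show ?thesis using zeta_eq_eta[OF that] e[OF that] by (simp add: field_simps)
  qed
  have "\<eta> meromorphic_on UNIV"
    by (intro analytic_on_imp_meromorphic_on) (simp add: analytic_on_open \<eta>(1))
  moreover have "(\<lambda>u. 2 powr (1 - u) :: complex) meromorphic_on UNIV"
    by (intro analytic_on_imp_meromorphic_on) (auto simp: analytic_on_open intro!: holomorphic_intros)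
  ultimately have "(\<lambda>u. ((\<eta> u / (1 - 2 powr (1 - u))) ^ 3 + \<eta> u ^ 3) / 2) meromorphic_on UNIV"
    by (intro meromorphic_intros)
  then show ?thesis
    using e z by (intro exI[of _ "\<lambda>u. ((\<eta> u / (1 - 2 powr (1 - u))) ^ 3 + \<eta> u ^ 3) / 2"]) auto
qed

text \<open>\<open>rGamma\<close> is entire, so removing the Gamma factor of the Mellin transform
  introduces no poles. The kernel is continued to one half-plane at a time, hence the
  gluing.\<close>

lemma zeta_kernel_continuation:
  "\<exists>Z. Z meromorphic_on UNIV \<and> (\<forall>u. Re u > 1 \<longrightarrow>
     Z u = (lerch 1 u 0 0 ^ 3 + lerch (-1) u 0 0 ^ 3) / 2 - 3 * (rGamma u * (LINT x:{0<..}|lborel. mellin_kernel u x)))"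
proof (rule meromorphic_on_exhaustion)
  fix M
  obtain g where g: "g meromorphic_on UNIV" "\<And>u. Re u > 1 \<Longrightarrow> g u = (lerch 1 u 0 0 ^ 3 + lerch (-1) u 0 0 ^ 3) / 2"
    using zeta_eta_continuation by blast
  obtain h where h: "h meromorphic_on half_plane M" "\<And>u. Re u > 1 \<Longrightarrow> h u = (LINT x:{0<..}|lborel. mellin_kernel u x)"
    using kernel_continuation by blast
  have "g meromorphic_on half_plane M" using meromorphic_on_subset[OF g(1)] by blast
  moreover have "rGamma meromorphic_on half_plane M"
    by (intro analytic_on_imp_meromorphic_on) (auto simp: analytic_on_open intro!: holomorphic_intros)
  ultimately have "(\<lambda>u. g u - 3 * (rGamma u * h u)) meromorphic_on half_plane M"
    using h(1) by (intro meromorphic_intros)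
  then show "\<exists>f. f meromorphic_on {z. - real M < Re z} \<and> (\<forall>u. Re u > 1 \<longrightarrow>
     f u = (lerch 1 u 0 0 ^ 3 + lerch (-1) u 0 0 ^ 3) / 2 - 3 * (rGamma u * (LINT x:{0<..}|lborel. mellin_kernel u x)))"
    using g(2) h(2) unfolding half_plane_def
    by (intro exI[of _ "\<lambda>u. g u - 3 * (rGamma u * h u)"]) auto
qed

section \<open>Sums over triples\<close>

text \<open>Theorems on exchanging sum and integral concern series over the natural numbers; a
  bijective enumeration of the infinite index type transfers them to unordered sums, which agree
  with series under absolute summability.\<close>

lemma integral_infsum:
  fixes f :: "'i::countable \<Rightarrow> 'a \<Rightarrow> complex"
  assumes inf: "infinite (UNIV :: 'i set)"
    and int: "\<And>i. integrable M (f i)"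
    and sum: "(\<lambda>i. \<integral>x. norm (f i x) \<partial>M) summable_on UNIV"
    and pt: "\<And>x. x \<in> space M \<Longrightarrow> (\<lambda>i. norm (f i x)) summable_on UNIV"
  shows "integrable M (\<lambda>x. \<Sum>\<^sub>\<infinity>i. f i x)"
    and "(\<integral>x. (\<Sum>\<^sub>\<infinity>i. f i x) \<partial>M) = (\<Sum>\<^sub>\<infinity>i. \<integral>x. f i x \<partial>M)"
    and "(\<lambda>i. norm (\<integral>x. f i x \<partial>M)) summable_on UNIV"
proof -
  define e :: "nat \<Rightarrow> 'i" where "e = from_nat_into UNIV"
  have e: "bij_betw e UNIV UNIV"
    unfolding e_def by (rule bij_betw_from_nat_into) (use inf in auto)
  have ns: "(\<lambda>i. g i) summable_on UNIV \<longleftrightarrow> summable (\<lambda>n. g (e n))" if "\<And>i. g i \<ge> 0" for g :: "'i \<Rightarrow> real"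
    using summable_on_reindex_bij_betw[OF e, of g] summable_on_UNIV_nonneg_real_iff[of "\<lambda>n. g (e n)"] that by simp
  have isum: "(\<Sum>\<^sub>\<infinity>i. g i) = (\<Sum>n. g (e n))" if "(\<lambda>i. norm (g i)) summable_on UNIV" for g :: "'i \<Rightarrow> complex"
  proof -
    have s: "summable (\<lambda>n. norm (g (e n)))" using that ns[of "\<lambda>i. norm (g i)"] by simp
    from norm_summable_imp_has_sum[OF s summable_sums[OF summable_norm_cancel[OF s]]]
    have "((\<lambda>n. g (e n)) has_sum (\<Sum>n. g (e n))) UNIV" .
    then show ?thesis using infsum_reindex_bij_betw[OF e, of g] by (simp add: infsumI)
  qed
  have sN: "summable (\<lambda>n. \<integral>x. norm (f (e n) x) \<partial>M)"
    using sum ns[of "\<lambda>i. \<integral>x. norm (f i x) \<partial>M"] by simp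
  have pN: "AE x in M. summable (\<lambda>n. norm (f (e n) x))"
    using pt ns[of "\<lambda>i. norm (f i x)" for x] by (intro AE_I2) simp
  have "integrable M (\<lambda>x. \<Sum>n. f (e n) x)"
    by (rule integrable_suminf[OF int pN sN])
  also have "?this \<longleftrightarrow> integrable M (\<lambda>x. \<Sum>\<^sub>\<infinity>i. f i x)"
    by (rule Bochner_Integration.integrable_cong) (use isum[OF pt] in auto)
  finally show "integrable M (\<lambda>x. \<Sum>\<^sub>\<infinity>i. f i x)" .
  show 3: "(\<lambda>i. norm (\<integral>x. f i x \<partial>M)) summable_on UNIV"
    by (rule summable_on_comparison_test[OF sum]) auto
  have "(\<integral>x. (\<Sum>\<^sub>\<infinity>i. f i x) \<partial>M) = (\<integral>x. (\<Sum>n. f (e n) x) \<partial>M)"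
    by (rule Bochner_Integration.integral_cong) (use isum[OF pt] in auto)
  also have "\<dots> = (\<Sum>n. \<integral>x. f (e n) x \<partial>M)"
    by (rule integral_suminf[OF int pN sN])
  also have "\<dots> = (\<Sum>\<^sub>\<infinity>i. \<integral>x. f i x \<partial>M)"
    using isum[OF 3] by simp
  finally show "(\<integral>x. (\<Sum>\<^sub>\<infinity>i. f i x) \<partial>M) = (\<Sum>\<^sub>\<infinity>i. \<integral>x. f i x \<partial>M)" .
qed

lemma has_sum_times:
  fixes f :: "'a \<Rightarrow> 'c::{real_normed_field, banach}" and g :: "'b \<Rightarrow> 'c"
  assumes "(\<lambda>a. norm (f a)) summable_on UNIV" "(\<lambda>b. norm (g b)) summable_on UNIV"
  shows "(\<lambda>(a, b). norm (f a * g b)) summable_on UNIV"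
    and "(\<Sum>\<^sub>\<infinity>(a, b). f a * g b) = (\<Sum>\<^sub>\<infinity>a. f a) * (\<Sum>\<^sub>\<infinity>b. g b)"
proof -
  have "(\<lambda>(a, b). norm (f a) * norm (g b)) summable_on UNIV \<times> UNIV"
    by (intro summable_on_SigmaI[where g = "\<lambda>a. norm (f a) * (\<Sum>\<^sub>\<infinity>b. norm (g b))"])
       (auto intro!: has_sum_cmult_right has_sum_infsum assms summable_on_cmult_left)
  then show *: "(\<lambda>(a, b). norm (f a * g b)) summable_on UNIV" by (simp add: norm_mult)
  then have "(\<lambda>(a, b). f a * g b) summable_on UNIV \<times> UNIV"
    by (rule_tac abs_summable_summable) (simp add: case_prod_unfold)
  from infsum_Sigma'_banach[OF this, symmetric]
  show "(\<Sum>\<^sub>\<infinity>(a, b). f a * g b) = (\<Sum>\<^sub>\<infinity>a. f a) * (\<Sum>\<^sub>\<infinity>b. g b)"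
    by (simp add: infsum_cmult_left' infsum_cmult_right')
qed

lemma has_sum_times3:
  fixes f :: "'a \<Rightarrow> 'd::{real_normed_field, banach}" and g :: "'b \<Rightarrow> 'd" and h :: "'c \<Rightarrow> 'd"
  assumes "(\<lambda>a. norm (f a)) summable_on UNIV" "(\<lambda>b. norm (g b)) summable_on UNIV" "(\<lambda>c. norm (h c)) summable_on UNIV"
  shows "(\<lambda>(a, b, c). norm (f a * g b * h c)) summable_on UNIV"
    and "(\<Sum>\<^sub>\<infinity>(a, b, c). f a * g b * h c) = (\<Sum>\<^sub>\<infinity>a. f a) * (\<Sum>\<^sub>\<infinity>b. g b) * (\<Sum>\<^sub>\<infinity>c. h c)"
proof -
  note 1 = has_sum_times[OF assms(2,3)]
  have "(\<lambda>p. norm (case p of (b, c) \<Rightarrow> g b * h c)) summable_on UNIV"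
    using 1(1) by (simp add: case_prod_unfold)
  note 2 = has_sum_times[OF assms(1) this]
  show "(\<lambda>(a, b, c). norm (f a * g b * h c)) summable_on UNIV"
    using 2(1) by (simp add: case_prod_unfold mult.assoc)
  show "(\<Sum>\<^sub>\<infinity>(a, b, c). f a * g b * h c) = (\<Sum>\<^sub>\<infinity>a. f a) * (\<Sum>\<^sub>\<infinity>b. g b) * (\<Sum>\<^sub>\<infinity>c. h c)"
    using 2(2) 1(2) by (simp add: case_prod_unfold mult.assoc)
qed

lemma summable_on_UNIV_nat:
  fixes f :: "nat \<Rightarrow> complex"
  assumes "summable (\<lambda>n. norm (f n))"
  shows "(\<lambda>n. norm (f n)) summable_on UNIV" "(\<Sum>\<^sub>\<infinity>n. f n) = (\<Sum>n. f n)"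
proof -
  show "(\<lambda>n. norm (f n)) summable_on UNIV"
    using assms by (subst summable_on_UNIV_nonneg_real_iff) auto
  show "(\<Sum>\<^sub>\<infinity>n. f n) = (\<Sum>n. f n)"
    by (rule infsumI[OF norm_summable_imp_has_sum[OF assms summable_sums[OF summable_norm_cancel[OF assms]]]])
qed

definition dirichlet :: "complex \<Rightarrow> nat \<Rightarrow> complex" where
  "dirichlet u n = of_nat (Suc n) powr (- u)"

lemma summable_dirichlet: "Re u > 1 \<Longrightarrow> (\<lambda>n. norm (dirichlet u n)) summable_on UNIV"
  using summable_on_UNIV_nat(1)[OF lerch_0_sums[of 1 u]] by (simp add: lerch_term_def dirichlet_def)

lemma infsum_dirichlet:
  assumes "Re u > 1"
  shows "(\<Sum>\<^sub>\<infinity>n. dirichlet u n) = lerch 1 u 0 0" "(\<Sum>\<^sub>\<infinity>n. (-1) ^ n * dirichlet u n) = lerch (-1) u 0 0"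
  using summable_on_UNIV_nat(2)[OF lerch_0_sums[of 1 u]] summable_on_UNIV_nat(2)[OF lerch_0_sums[of "-1" u]] assms
  by (simp_all add: lerch_term_def[abs_def] dirichlet_def lerch_def)

text \<open>The indices are highest weights, so \<open>Suc a\<close>, \<open>Suc b\<close>,
  \<open>Suc c\<close> are degrees of irreducible representations of SU(2), and this is a power of
  the degree of their tensor product.\<close>

definition triple_prod :: "complex \<Rightarrow> nat \<times> nat \<times> nat \<Rightarrow> complex" where
  "triple_prod u = (\<lambda>(a, b, c). dirichlet u a * dirichlet u b * dirichlet u c)"

text \<open>Triples with even sum whose first entry exceeds the sum of the others. The excess is
  even and positive, hence \<open>2 + 2 * j\<close>, and \<open>(b, c, j)\<close> is a free
  parametrization.\<close>

definition dominant :: "(nat \<times> nat \<times> nat) set" where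
  "dominant = range (\<lambda>(b, c, j). (b + c + 2 + 2 * j, b, c))"

definition rot :: "nat \<times> nat \<times> nat \<Rightarrow> nat \<times> nat \<times> nat" where
  "rot = (\<lambda>(a, b, c). (c, a, b))"

text \<open>The Clebsch-Gordan triples: the three triangle inequalities hold and the sum is
  even.\<close>

definition triangles :: "(nat \<times> nat \<times> nat) set" where
  "triangles = range (\<lambda>(m1, m2, m3). (m1 + m2, m2 + m3, m3 + m1))"

text \<open>If one entry exceeds the sum of the other two, a cyclic rotation brings it to the front.
  If none does, the halved differences such as \<open>(a + c - b) div 2\<close> are natural numbers
  by parity and are the required parameters.\<close>

lemma even_triples_partition:
  "{(a, b, c). even (a + b + c)} = triangles \<union> (dominant \<union> (rot ` dominant \<union> (rot \<circ> rot) ` dominant))" (is "?E = _")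
proof (intro equalityI subsetI)
  fix p assume "p \<in> ?E"
  then obtain a b c where p: "p = (a, b, c)" and ev: "even (a + b + c)" by auto
  have dom: "(x, y, z) \<in> dominant" if "x > y + z" "even (x + y + z)" for x y z :: nat
  proof -
    obtain j where "x = y + z + 2 + 2 * j"
    proof -
      have "even (x - (y + z))" using \<open>even (x + y + z)\<close> \<open>x > y + z\<close> by auto
      then obtain k where k: "x - (y + z) = 2 * k" by (elim evenE)
      then have "x = y + z + 2 + 2 * (k - 1)" using \<open>x > y + z\<close> by linarith
      then show ?thesis by (rule that)
    qed
    then show ?thesis unfolding dominant_def by (intro image_eqI[of _ _ "(y, z, j)"]) auto
  qed
  consider "a > b + c" | "b > a + c" | "c > a + b" | "a \<le> b + c" "b \<le> a + c" "c \<le> a + b" by linarith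
  then show "p \<in> triangles \<union> (dominant \<union> (rot ` dominant \<union> (rot \<circ> rot) ` dominant))"
  proof cases
    case 1
    then show ?thesis using dom[of b c a] ev p by auto
  next
    case 2
    then have "(b, c, a) \<in> dominant" using dom[of c a b] ev by (auto simp: ac_simps)
    then have "p \<in> rot ` dominant" unfolding p by (intro image_eqI[of _ _ "(b, c, a)"]) (auto simp: rot_def)
    then show ?thesis by blast
  next
    case 3
    then have "(c, a, b) \<in> dominant" using dom[of a b c] ev by (auto simp: ac_simps)
    then have "p \<in> (rot \<circ> rot) ` dominant" unfolding p by (intro image_eqI[of _ _ "(c, a, b)"]) (auto simp: rot_def)
    then show ?thesis by blast
  next
    case 4
    define m1 m2 m3 where "m1 = (a + c - b) div 2" and "m2 = (a + b - c) div 2" and "m3 = (b + c - a) div 2"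
    have "even (a + c - b)" "even (a + b - c)" "even (b + c - a)" using ev 4 by auto
    then have "2 * m1 = a + c - b" "2 * m2 = a + b - c" "2 * m3 = b + c - a" by (auto simp: m1_def m2_def m3_def)
    then have "a = m1 + m2" "b = m2 + m3" "c = m3 + m1" using 4 by linarith+
    then show ?thesis unfolding p triangles_def by (auto intro!: image_eqI[of _ _ "(m1, m2, m3)"])
  qed
next
  fix p assume "p \<in> triangles \<union> (dominant \<union> (rot ` dominant \<union> (rot \<circ> rot) ` dominant))"
  then show "p \<in> ?E" unfolding triangles_def dominant_def rot_def by fastforce
qed

lemma summable_triple_prod: "Re u > 1 \<Longrightarrow> (\<lambda>p. norm (triple_prod u p)) summable_on UNIV"
  using has_sum_times3(1)[OF summable_dirichlet summable_dirichlet summable_dirichlet, of u u u]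
  by (simp add: triple_prod_def case_prod_unfold)

text \<open>The indicator of an even sum is \<open>(1 + (-1) ^ (a + b + c)) / 2\<close>, and both
  resulting sums factor into cubes.\<close>

lemma infsum_triple_prod_even:
  assumes "Re u > 1"
  shows "(\<Sum>\<^sub>\<infinity>p\<in>{(a, b, c). even (a + b + c)}. triple_prod u p) = (lerch 1 u 0 0 ^ 3 + lerch (-1) u 0 0 ^ 3) / 2"
proof -
  let ?d = "dirichlet u" and ?e = "\<lambda>n. (-1) ^ n * dirichlet u n"
  note sd = summable_dirichlet[OF assms]
  have se: "(\<lambda>n. norm (?e n)) summable_on UNIV" using sd by (simp add: norm_mult norm_power)
  note d3 = has_sum_times3[OF sd sd sd] and e3 = has_sum_times3[OF se se se]
  have s1: "(\<lambda>(a, b, c). ?d a * ?d b * ?d c) summable_on UNIV"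
    by (rule abs_summable_summable) (use d3(1) in \<open>simp add: case_prod_unfold\<close>)
  have s2: "(\<lambda>(a, b, c). ?e a * ?e b * ?e c) summable_on UNIV"
    by (rule abs_summable_summable) (use e3(1) in \<open>simp add: case_prod_unfold\<close>)
  have "(\<Sum>\<^sub>\<infinity>p\<in>{(a, b, c). even (a + b + c)}. triple_prod u p) =
      (\<Sum>\<^sub>\<infinity>p. (1/2) * ((case p of (a, b, c) \<Rightarrow> ?d a * ?d b * ?d c) + (case p of (a, b, c) \<Rightarrow> ?e a * ?e b * ?e c)))"
  proof (rule infsum_cong_neutral)
    fix p :: "nat \<times> nat \<times> nat"
    obtain a b c where p: "p = (a, b, c)" by (cases p)
    have e: "?e a * ?e b * ?e c = (-1) ^ (a + b + c) * (?d a * ?d b * ?d c)" by (simp add: power_add)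
    show "(1/2) * ((case p of (a, b, c) \<Rightarrow> ?d a * ?d b * ?d c) + (case p of (a, b, c) \<Rightarrow> ?e a * ?e b * ?e c)) = 0"
      if "p \<in> UNIV - {(a, b, c). even (a + b + c)}"
      using that unfolding p prod.case e by simp
    show "triple_prod u p = (1/2) * ((case p of (a, b, c) \<Rightarrow> ?d a * ?d b * ?d c) + (case p of (a, b, c) \<Rightarrow> ?e a * ?e b * ?e c))"
      if "p \<in> {(a, b, c). even (a + b + c)} \<inter> UNIV"
      using that unfolding p prod.case e by (simp add: triple_prod_def)
  qed auto
  also have "\<dots> = (1/2) * ((\<Sum>\<^sub>\<infinity>(a, b, c). ?d a * ?d b * ?d c) + (\<Sum>\<^sub>\<infinity>(a, b, c). ?e a * ?e b * ?e c))"
    by (simp only: infsum_cmult_right' infsum_add[OF s1 s2])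
  also have "\<dots> = (lerch 1 u 0 0 ^ 3 + lerch (-1) u 0 0 ^ 3) / 2"
    unfolding d3(2) e3(2) infsum_dirichlet[OF assms] by (simp add: power3_eq_cube)
  finally show ?thesis .
qed

lemma inj_rot: "inj_on rot A"
  by (auto simp: inj_on_def rot_def)

lemma triple_prod_rot: "triple_prod u (rot p) = triple_prod u p"
  by (cases p) (simp add: triple_prod_def rot_def)

lemma infsum_triangles_dominant:
  assumes "Re u > 1"
  shows "(\<Sum>\<^sub>\<infinity>p\<in>{(a, b, c). even (a + b + c)}. triple_prod u p) =
      (\<Sum>\<^sub>\<infinity>p\<in>triangles. triple_prod u p) + 3 * (\<Sum>\<^sub>\<infinity>p\<in>dominant. triple_prod u p)"
proof -
  have "triple_prod u summable_on UNIV"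
    by (rule abs_summable_summable) (rule summable_triple_prod[OF assms])
  then have s: "triple_prod u summable_on A" for A
    by (rule summable_on_subset_banach) simp
  have r1: "(\<Sum>\<^sub>\<infinity>p\<in>rot ` dominant. triple_prod u p) = (\<Sum>\<^sub>\<infinity>p\<in>dominant. triple_prod u p)"
    by (subst infsum_reindex[OF inj_rot]) (simp add: comp_def triple_prod_rot)
  have r2: "(\<Sum>\<^sub>\<infinity>p\<in>(rot \<circ> rot) ` dominant. triple_prod u p) = (\<Sum>\<^sub>\<infinity>p\<in>dominant. triple_prod u p)"
    by (subst infsum_reindex[OF comp_inj_on[OF inj_rot inj_rot]]) (simp add: comp_def triple_prod_rot)
  have d0: "triangles \<inter> (dominant \<union> (rot ` dominant \<union> (rot \<circ> rot) ` dominant)) = {}"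
    by (auto simp: triangles_def dominant_def rot_def)
  have d1: "dominant \<inter> (rot ` dominant \<union> (rot \<circ> rot) ` dominant) = {}"
    by (auto simp: dominant_def rot_def)
  have d2: "rot ` dominant \<inter> (rot \<circ> rot) ` dominant = {}"
    by (auto simp: dominant_def rot_def)
  show ?thesis
    unfolding even_triples_partition infsum_Un_disjoint[OF s s d0] infsum_Un_disjoint[OF s s d1]
      infsum_Un_disjoint[OF s s d2] r1 r2 by simp
qed

lemma powr_of_nat_mult: "of_nat (a * b) powr z = of_nat a powr z * (of_nat b powr z :: complex)"
  using powr_times_real[of "of_nat a" "of_nat b" z] by simp

lemma triple_term_eq:
  "triple_term s (m1, m2, m3) = triple_prod (s + 1) (m1 + m2, m2 + m3, m3 + m1)"
proof -
  have "- s - 1 = - (s + 1)" by simp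
  then show ?thesis
    unfolding triple_term_def triple_prod_def prod.case dirichlet_def powr_of_nat_mult
    by (simp only: Suc_eq_plus1)
qed

lemma inj_triangle: "inj (\<lambda>(m1, m2, m3). (m1 + m2, m2 + m3, m3 + m1 :: nat))"
  by (auto simp: inj_on_def)

lemma triple_term_sums:
  assumes "Re s > 0"
  shows "(\<lambda>m. norm (triple_term s m)) summable_on UNIV"
    and "(\<Sum>\<^sub>\<infinity>m. triple_term s m) = (\<Sum>\<^sub>\<infinity>p\<in>triangles. triple_prod (s + 1) p)"
proof -
  let ?f = "\<lambda>(m1, m2, m3). (m1 + m2, m2 + m3, m3 + m1 :: nat)"
  have eq: "triple_term s = triple_prod (s + 1) \<circ> ?f"
    by (auto simp: fun_eq_iff triple_term_eq)
  have "(\<lambda>p. norm (triple_prod (s + 1) p)) summable_on range ?f"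
    by (rule summable_on_subset_banach[OF summable_triple_prod]) (use assms in auto)
  then show "(\<lambda>m. norm (triple_term s m)) summable_on UNIV"
    unfolding eq using summable_on_reindex[OF inj_triangle, of "\<lambda>p. norm (triple_prod (s + 1) p)"]
    by (simp add: comp_def)
  show "(\<Sum>\<^sub>\<infinity>m. triple_term s m) = (\<Sum>\<^sub>\<infinity>p\<in>triangles. triple_prod (s + 1) p)"
    unfolding eq triangles_def by (rule infsum_reindex[OF inj_triangle, symmetric])
qed

section \<open>The sum over dominant triples as a Mellin transform\<close>

lemma Gamma_integral_scaled:
  fixes z :: complex
  assumes z: "Re z > 0" and c: "c > 0"
  shows "set_integrable lborel {0<..} (\<lambda>x. of_real x powr (z - 1) * of_real (exp (- c * x)))"
    and "(LINT x:{0<..}|lborel. of_real x powr (z - 1) * of_real (exp (- c * x))) = Gamma z * of_real c powr (- z)"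
proof -
  let ?g = "\<lambda>x::real. complex_of_real x powr (z - 1) * of_real (exp (- x))"
  let ?h = "\<lambda>x::real. complex_of_real x powr (z - 1) * of_real (exp (- c * x))"
  have 1: "(\<lambda>t. complex_of_real t powr (z - 1) / of_real (exp t)) = ?g"
    by (simp add: fun_eq_iff exp_minus divide_inverse of_real_inverse)
  have "?g absolutely_integrable_on {0<..}"
    using absolutely_integrable_Gamma_integral'[OF z] unfolding 1 .
  then have gi: "set_integrable lborel {0<..} ?g"
    unfolding set_integrable_def by (subst (asm) integrable_completion) auto
  have "(LINT x:{0<..}|lborel. ?g x) = integral {0<..} ?g"
    using set_borel_integral_eq_integral(2)[OF gi] .
  also have "\<dots> = Gamma z"
    using Gamma_integral_complex'[OF z] unfolding 1 by (rule integral_unique)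
  finally have gv: "(LINT x:{0<..}|lborel. ?g x) = Gamma z" .
  have sc: "?g (c * x) = of_real c powr (z - 1) * ?h x" if "x > 0" for x
    using powr_times_real[of "complex_of_real c" "of_real x" "z - 1"] that c by simp
  have ind: "indicator {0<..} (0 + c * x) *\<^sub>R ?g (0 + c * x) = of_real c powr (z - 1) * (indicator {0<..} x *\<^sub>R ?h x)" for x
    using c sc[of x] by (auto simp: indicator_def zero_less_mult_iff)
  have "integrable lborel (\<lambda>x. indicator {0<..} (0 + c * x) *\<^sub>R ?g (0 + c * x))"
    using gi c unfolding set_integrable_def by (subst lborel_integrable_real_affine_iff) auto
  then have i: "integrable lborel (\<lambda>x. of_real c powr (z - 1) * (indicator {0<..} x *\<^sub>R ?h x))"
    unfolding ind .
  have "integrable lborel (\<lambda>x. inverse (of_real c powr (z - 1)) * (of_real c powr (z - 1) * (indicator {0<..} x *\<^sub>R ?h x)))"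
    by (rule integrable_mult_right) (rule i)
  moreover have "inverse (of_real c powr (z - 1)) * (of_real c powr (z - 1) * w) = w" for w :: complex
    using c by (simp add: mult.assoc[symmetric])
  ultimately show "set_integrable lborel {0<..} ?h"
    unfolding set_integrable_def by (simp only:)
  have "Gamma z = (\<integral>x. indicator {0<..} x *\<^sub>R ?g x \<partial>lborel)"
    using gv by (simp add: set_lebesgue_integral_def)
  also have "\<dots> = c *\<^sub>R (\<integral>x. indicator {0<..} (0 + c * x) *\<^sub>R ?g (0 + c * x) \<partial>lborel)"
    using c by (subst lborel_integral_real_affine[of c _ 0]) auto
  also have "\<dots> = of_real c * of_real c powr (z - 1) * (LINT x:{0<..}|lborel. ?h x)"
    unfolding ind by (simp add: set_lebesgue_integral_def scaleR_conv_of_real)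
  also have "of_real c * of_real c powr (z - 1) = (of_real c powr z :: complex)"
    using c powr_add[of "of_real c" 1 "z - 1"] by simp
  finally have "Gamma z = of_real c powr z * (LINT x:{0<..}|lborel. ?h x)" .
  moreover have "(of_real c powr (- z)) * of_real c powr z = (1 :: complex)"
    using c by (simp add: powr_minus)
  ultimately show "(LINT x:{0<..}|lborel. ?h x) = Gamma z * of_real c powr (- z)"
    by (simp only: mult.commute[of "of_real c powr z * _"] mult.assoc[symmetric] mult_1)
qed

text \<open>The exponent is the degree belonging to the dominant entry
  \<open>b + c + 2 + 2 * j\<close>. It splits as \<open>Suc b + Suc c + (2 * j + 1)\<close>, so the
  sum over the three indices factors into two copies of \<open>polylog\<close> and the geometric
  series for \<open>1 / (2 sinh x)\<close>.\<close>

definition laplace_term :: "complex \<Rightarrow> nat \<times> nat \<times> nat \<Rightarrow> real \<Rightarrow> complex" where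
  "laplace_term u = (\<lambda>(b, c, j) x. dirichlet u b * dirichlet u c *
     (of_real x powr (u - 1) * of_real (exp (- real (b + c + 3 + 2 * j) * x))))"

lemma laplace_term_integral:
  assumes "Re u > 1"
  shows "set_integrable lborel {0<..} (laplace_term u (b, c, j))"
    and "(LINT x:{0<..}|lborel. laplace_term u (b, c, j) x) = Gamma u * triple_prod u (b + c + 2 + 2 * j, b, c)"
    and "(LINT x:{0<..}|lborel. norm (laplace_term u (b, c, j) x)) =
      Re (Gamma (of_real (Re u))) * norm (triple_prod u (b + c + 2 + 2 * j, b, c))"
proof -
  define N where "N = real (b + c + 3 + 2 * j)"
  have N: "N > 0" by (simp add: N_def)
  have Nn: "of_nat (Suc (b + c + 2 + 2 * j)) = complex_of_real N" by (simp add: N_def)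
  define h where "h = (\<lambda>(v::complex) x. complex_of_real x powr (v - 1) * of_real (exp (- N * x)))"
  have lt: "laplace_term u (b, c, j) = (\<lambda>x. dirichlet u b * dirichlet u c * h u x)"
    by (simp add: laplace_term_def h_def N_def)
  have tp: "triple_prod u (b + c + 2 + 2 * j, b, c) = of_real N powr (- u) * dirichlet u b * dirichlet u c"
    unfolding triple_prod_def prod.case dirichlet_def[of u "b + c + 2 + 2 * j"] Nn ..
  have u0: "Re u > 0" "Re (complex_of_real (Re u)) > 0" using assms by auto
  note G = Gamma_integral_scaled[OF u0(1) N] and G' = Gamma_integral_scaled[OF u0(2) N]
  show "set_integrable lborel {0<..} (laplace_term u (b, c, j))"
    unfolding lt h_def by (intro set_integrable_mult_right G(1))
  show "(LINT x:{0<..}|lborel. laplace_term u (b, c, j) x) = Gamma u * triple_prod u (b + c + 2 + 2 * j, b, c)"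
    unfolding lt h_def tp using G by (simp add: mult_ac)
  let ?D = "norm (dirichlet u b * dirichlet u c)"
  \<comment> \<open>The norm of the integrand has the same shape with \<open>u\<close> replaced by
    \<open>Re u\<close>, so the Gamma integral also evaluates the norms needed for
    summability.\<close>
  have "complex_of_real (LINT x:{0<..}|lborel. norm (laplace_term u (b, c, j) x)) =
      (LINT x:{0<..}|lborel. complex_of_real (norm (laplace_term u (b, c, j) x)))"
    by (rule set_integral_complex_of_real[symmetric])
  also have "\<dots> = (LINT x:{0<..}|lborel. of_real ?D * h (of_real (Re u)) x)"
  proof (rule set_lebesgue_integral_cong)
    show "\<forall>x. x \<in> {0<..} \<longrightarrow> complex_of_real (norm (laplace_term u (b, c, j) x)) = of_real ?D * h (of_real (Re u)) x"
      unfolding lt h_def by (auto simp: norm_mult norm_of_real_powr powr_of_real[symmetric])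
  qed auto
  also have "\<dots> = of_real ?D * (Gamma (of_real (Re u)) * of_real N powr (- of_real (Re u)))"
    unfolding h_def using G' by simp
  also have "of_real N powr (- complex_of_real (Re u)) = of_real (norm (complex_of_real N powr (- u)))"
    using N by (simp add: norm_of_real_powr powr_of_real[symmetric])
  finally have "(LINT x:{0<..}|lborel. norm (laplace_term u (b, c, j) x)) =
      Re (of_real ?D * (Gamma (of_real (Re u)) * of_real (norm (complex_of_real N powr (- u)))))"
    by (metis Re_complex_of_real)
  then show "(LINT x:{0<..}|lborel. norm (laplace_term u (b, c, j) x)) =
      Re (Gamma (of_real (Re u))) * norm (triple_prod u (b + c + 2 + 2 * j, b, c))"
    unfolding tp by (simp add: norm_mult)
qed

lemma infsum_exp_odd:
  assumes "x > 0"
  shows "(\<lambda>j::nat. norm (complex_of_real (exp (- real (2 * j + 1) * x)))) summable_on UNIV"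
    and "(\<Sum>\<^sub>\<infinity>j::nat. complex_of_real (exp (- real (2 * j + 1) * x))) = of_real (1 / (2 * sinh x))"
proof -
  define q where "q = exp (- (2 * x))"
  have q: "0 < q" "q < 1" using assms by (auto simp: q_def)
  have e: "exp (- real (2 * j + 1) * x) = exp (- x) * q ^ j" for j
    unfolding q_def exp_of_nat_mult[symmetric] exp_add[symmetric] by (simp add: algebra_simps)
  have "(\<lambda>j. exp (- x) * q ^ j) sums (exp (- x) * (1 / (1 - q)))"
    by (intro sums_mult geometric_sums) (use q in auto)
  also have "exp (- x) * (1 / (1 - q)) = 1 / (2 * sinh x)"
  proof -
    have "q = exp (- x) * exp (- x)" "exp (- x) * exp x = 1"
      by (simp_all add: q_def flip: exp_add)
    then have "exp (- x) * (2 * sinh x) = 1 - q"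
      by (simp add: sinh_field_def right_diff_distrib)
    moreover have "sinh x > 0" using assms by simp
    ultimately show ?thesis using q by (simp add: field_simps)
  qed
  finally have s: "(\<lambda>j. exp (- real (2 * j + 1) * x)) sums (1 / (2 * sinh x))" unfolding e .
  have n: "summable (\<lambda>j. norm (complex_of_real (exp (- real (2 * j + 1) * x))))"
    using s by (simp add: sums_iff)
  show "(\<lambda>j::nat. norm (complex_of_real (exp (- real (2 * j + 1) * x)))) summable_on UNIV"
    by (rule summable_on_UNIV_nat(1)[OF n])
  show "(\<Sum>\<^sub>\<infinity>j::nat. complex_of_real (exp (- real (2 * j + 1) * x))) = of_real (1 / (2 * sinh x))"
    unfolding summable_on_UNIV_nat(2)[OF n] using s by (intro sums_unique[symmetric] sums_of_real)
qed

lemma infsum_laplace_term: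
  assumes x: "x > 0"
  shows "(\<lambda>p. norm (laplace_term u p x)) summable_on UNIV"
    and "(\<Sum>\<^sub>\<infinity>p. laplace_term u p x) = mellin_kernel u x"
proof -
  let ?L = "\<lambda>n. lerch_term 1 u (of_real x) 0 n"
  let ?e = "\<lambda>j::nat. complex_of_real (exp (- real (2 * j + 1) * x))"
  have sn: "summable (\<lambda>n. norm (?L n))"
    by (rule lerch_term_eventually_bounded) (use x in auto)
  note L = summable_on_UNIV_nat[OF sn] and e = infsum_exp_odd[OF x]
  note P = has_sum_times3[OF L(1) L(1) e(1)]
  have eq: "laplace_term u p x = of_real x powr (u - 1) * (case p of (b, c, j) \<Rightarrow> ?L b * ?L c * ?e j)" for p
  proof -
    obtain b c j where p: "p = (b, c, j)" by (cases p)
    have "exp (- real (b + c + 3 + 2 * j) * x) = exp (- (real (Suc b) * x)) * exp (- (real (Suc c) * x)) * exp (- real (2 * j + 1) * x)"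
      unfolding exp_add[symmetric] by (simp add: algebra_simps)
    moreover have "?L n = dirichlet u n * of_real (exp (- (real (Suc n) * x)))" for n
      by (simp add: lerch_term_def dirichlet_def exp_of_real[symmetric] del: of_nat_Suc)
    ultimately show ?thesis unfolding p by (simp add: laplace_term_def mult_ac del: of_nat_Suc)
  qed
  show "(\<lambda>p. norm (laplace_term u p x)) summable_on UNIV"
    unfolding eq norm_mult using P(1) by (intro summable_on_cmult_right) (simp add: case_prod_unfold norm_mult)
  have "(\<Sum>\<^sub>\<infinity>p. laplace_term u p x) = of_real x powr (u - 1) * ((\<Sum>\<^sub>\<infinity>b. ?L b) * (\<Sum>\<^sub>\<infinity>c. ?L c) * (\<Sum>\<^sub>\<infinity>j. ?e j))"
    unfolding eq infsum_cmult_right' P(2) ..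
  also have "\<dots> = mellin_kernel u x"
    unfolding L(2) e(2) by (simp add: mellin_kernel_def lerch_def power2_eq_square)
  finally show "(\<Sum>\<^sub>\<infinity>p. laplace_term u p x) = mellin_kernel u x" .
qed

text \<open>Sum and integral may be exchanged since the integrated norms are a constant times the
  absolutely summable terms of \<open>triple_prod\<close>.\<close>

lemma infsum_dominant:
  assumes u: "Re u > 1"
  shows "(\<Sum>\<^sub>\<infinity>p\<in>dominant. triple_prod u p) = rGamma u * (LINT x:{0<..}|lborel. mellin_kernel u x)"
proof -
  let ?f = "\<lambda>(b, c, j). (b + c + 2 + 2 * j, b, c :: nat)"
  let ?M = "restrict_space lborel {0::real<..}"
  have inj: "inj ?f" by (auto simp: inj_on_def)
  have sm: "(\<lambda>p. norm (triple_prod u (?f p))) summable_on UNIV"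
    using summable_on_reindex[OF inj, of "\<lambda>p. norm (triple_prod u p)"]
      summable_on_subset_banach[OF summable_triple_prod[OF u], of "range ?f"] by (simp add: comp_def)
  have int: "integrable ?M (laplace_term u p)" for p
    using laplace_term_integral(1)[OF u] unfolding set_integrable_def
    by (cases p) (subst integrable_restrict_space, auto)
  have I: "(\<integral>x. g x \<partial>?M) = (LINT x:{0<..}|lborel. g x)" for g :: "real \<Rightarrow> 'b::{banach, second_countable_topology}"
    by (subst integral_restrict_space) (auto simp: set_lebesgue_integral_def)
  have nrm: "(\<integral>x. norm (laplace_term u p x) \<partial>?M) = Re (Gamma (of_real (Re u))) * norm (triple_prod u (?f p))" for p
    unfolding I by (cases p) (simp add: laplace_term_integral(3)[OF u])
  have "(\<lambda>p. \<integral>x. norm (laplace_term u p x) \<partial>?M) summable_on UNIV"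
    unfolding nrm by (intro summable_on_cmult_right sm)
  note ii = integral_infsum[OF _ int this infsum_laplace_term(1)]
  have inf: "infinite (UNIV :: (nat \<times> nat \<times> nat) set)"
    by (simp add: finite_prod)
  have "(LINT x:{0<..}|lborel. mellin_kernel u x) = (\<integral>x. (\<Sum>\<^sub>\<infinity>p. laplace_term u p x) \<partial>?M)"
    unfolding I[symmetric] by (rule Bochner_Integration.integral_cong) (auto simp: space_restrict_space infsum_laplace_term(2))
  also have "\<dots> = (\<Sum>\<^sub>\<infinity>p. \<integral>x. laplace_term u p x \<partial>?M)"
    by (rule ii(2)) (use inf in \<open>auto simp: space_restrict_space\<close>)
  also have "\<dots> = (\<Sum>\<^sub>\<infinity>p. Gamma u * triple_prod u (?f p))"
    unfolding I by (rule infsum_cong) (auto simp: laplace_term_integral(2)[OF u])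
  also have "\<dots> = Gamma u * (\<Sum>\<^sub>\<infinity>p. triple_prod u (?f p))" by (rule infsum_cmult_right')
  also have "(\<Sum>\<^sub>\<infinity>p. triple_prod u (?f p)) = (\<Sum>\<^sub>\<infinity>p\<in>dominant. triple_prod u p)"
    unfolding dominant_def using infsum_reindex[OF inj, of "triple_prod u"] by (simp add: comp_def)
  finally have "(LINT x:{0<..}|lborel. mellin_kernel u x) = Gamma u * (\<Sum>\<^sub>\<infinity>p\<in>dominant. triple_prod u p)" .
  moreover have "u \<notin> \<int>\<^sub>\<le>\<^sub>0" using u by (auto elim!: nonpos_Ints_cases)
  then have "rGamma u * Gamma u = 1" by (simp add: rGamma_inverse_Gamma Gamma_eq_zero_iff)
  ultimately show ?thesis by (simp add: mult.assoc[symmetric])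
qed

theorem triple_sum_continuation:
  "\<exists>Z. Z meromorphic_on UNIV \<and> (\<forall>s. Re s > 0 \<longrightarrow> Z s = (\<Sum>\<^sub>\<infinity>m. triple_term s m))"
proof -
  obtain Z where Z: "Z meromorphic_on UNIV" "\<And>u. Re u > 1 \<Longrightarrow>
     Z u = (lerch 1 u 0 0 ^ 3 + lerch (-1) u 0 0 ^ 3) / 2 - 3 * (rGamma u * (LINT x:{0<..}|lborel. mellin_kernel u x))"
    using zeta_kernel_continuation by blast
  have "(\<lambda>s. Z (s + 1)) meromorphic_on UNIV"
    by (rule meromorphic_on_compose[OF Z(1)]) (auto intro!: analytic_intros)
  moreover have "Z (s + 1) = (\<Sum>\<^sub>\<infinity>m. triple_term s m)" if "Re s > 0" for s
  proof -
    have u: "Re (s + 1) > 1" using that by simp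
    show ?thesis
      using infsum_triangles_dominant[OF u] infsum_triple_prod_even[OF u] infsum_dominant[OF u]
      unfolding Z(2)[OF u] triple_term_sums(2)[OF that] by (simp add: algebra_simps)
  qed
  ultimately show ?thesis by (intro exI[of _ "\<lambda>s. Z (s + 1)"]) auto
qed

section \<open>Schur's lemma for unitary representations\<close>

lemma mat_adjoint_carrier: "A \<in> carrier_mat n m \<Longrightarrow> mat_adjoint A \<in> carrier_mat m n"
  unfolding mat_adjoint_def by (auto simp: mat_of_rows_def)

lemma mat_adjoint_index:
  fixes A :: "complex mat"
  assumes "A \<in> carrier_mat n m" "i < m" "j < n"
  shows "mat_adjoint A $$ (i, j) = cnj (A $$ (j, i))"
  using assms unfolding mat_adjoint_def by (auto simp: mat_of_rows_index)

lemma mat_adjoint_adjoint: "A \<in> carrier_mat n m \<Longrightarrow> mat_adjoint (mat_adjoint A) = (A :: complex mat)"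
  using mat_adjoint_carrier[of A n m] mat_adjoint_carrier[of "mat_adjoint A" m n]
  by (intro eq_matI) (auto simp: mat_adjoint_index[of _ n m] mat_adjoint_index[of _ m n])

lemma mat_adjoint_mult:
  assumes "A \<in> carrier_mat n m" "B \<in> carrier_mat m l"
  shows "mat_adjoint (A * B) = mat_adjoint B * (mat_adjoint A :: complex mat)"
proof (rule eq_matI)
  note c = mat_adjoint_carrier[OF assms(1)] mat_adjoint_carrier[OF assms(2)] mult_carrier_mat[OF assms]
  fix i j assume "i < dim_row (mat_adjoint B * mat_adjoint A)" "j < dim_col (mat_adjoint B * mat_adjoint A)"
  then have ij: "i < l" "j < n" using c by auto
  show "mat_adjoint (A * B) $$ (i, j) = (mat_adjoint B * mat_adjoint A) $$ (i, j)"
    using ij assms c mat_adjoint_index[OF c(3) ij]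
    by (simp add: scalar_prod_def mat_adjoint_index[OF assms(1)] mat_adjoint_index[OF assms(2)] mult.commute)
qed (use assms mat_adjoint_carrier[of A n m] mat_adjoint_carrier[of B m l] mat_adjoint_carrier[of "A * B" n l] in auto)

lemma smult_smult_mat: "a \<cdot>\<^sub>m (b \<cdot>\<^sub>m A) = (a * b) \<cdot>\<^sub>m (A :: 'a::semigroup_mult mat)"
  by (intro eq_matI) (auto simp: mult.assoc)

lemma unitary_groupD:
  assumes "U \<in> carrier (unitary_group n)"
  shows "U \<in> carrier_mat n n" "mat_adjoint U \<in> carrier_mat n n"
    "U * mat_adjoint U = 1\<^sub>m n" "mat_adjoint U * U = 1\<^sub>m n"
proof -
  show 1: "U \<in> carrier_mat n n" "U * mat_adjoint U = 1\<^sub>m n" using assms by (auto simp: unitary_group_def)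
  show 2: "mat_adjoint U \<in> carrier_mat n n" by (rule mat_adjoint_carrier[OF 1(1)])
  show "mat_adjoint U * U = 1\<^sub>m n" by (rule mat_mult_left_right_inverse[OF 1(1) 2 1(2)])
qed

lemma unitary_rows:
  assumes "U \<in> carrier (unitary_group n)" "i < n" "j < n"
  shows "(\<Sum>k<n. U $$ (i, k) * cnj (U $$ (j, k))) = (if i = j then 1 else 0)"
proof -
  note U = unitary_groupD[OF assms(1)]
  have "(U * mat_adjoint U) $$ (i, j) = (\<Sum>k<n. U $$ (i, k) * cnj (U $$ (j, k)))"
    using assms(2,3) U(1,2) by (simp add: scalar_prod_def mat_adjoint_index[OF U(1)] atLeast0LessThan)
  then show ?thesis using assms(2,3) unfolding U(3) by simp
qed

lemma unitary_cols:
  assumes "U \<in> carrier (unitary_group n)" "i < n" "j < n"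
  shows "(\<Sum>k<n. cnj (U $$ (k, i)) * U $$ (k, j)) = (if i = j then 1 else 0)"
proof -
  note U = unitary_groupD[OF assms(1)]
  have "(mat_adjoint U * U) $$ (i, j) = (\<Sum>k<n. cnj (U $$ (k, i)) * U $$ (k, j))"
    using assms(2,3) U(1,2) by (simp add: scalar_prod_def mat_adjoint_index[OF U(1)] atLeast0LessThan)
  then show ?thesis using assms(2,3) unfolding U(4) by simp
qed

lemma unitary_entry_le_1:
  assumes "U \<in> carrier (unitary_group n)" "i < n" "j < n"
  shows "norm (U $$ (i, j)) \<le> 1"
proof -
  have "(norm (U $$ (i, j)))\<^sup>2 \<le> (\<Sum>k<n. (norm (U $$ (i, k)))\<^sup>2)"
    using assms(3) by (intro member_le_sum) auto
  also have "complex_of_real \<dots> = (\<Sum>k<n. U $$ (i, k) * cnj (U $$ (i, k)))"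
    by (simp only: of_real_sum complex_norm_square)
  then have "(\<Sum>k<n. (norm (U $$ (i, k)))\<^sup>2) = 1"
    unfolding unitary_rows[OF assms(1,2,2)] by (simp only: of_real_eq_1_iff simp_thms if_True)
  finally show ?thesis by (simp add: power_le_one_iff abs_square_le_1)
qed

lemma unitary_repD:
  assumes "unitary_rep K n \<rho>"
  shows "g \<in> carrier K \<Longrightarrow> \<rho> g \<in> carrier (unitary_group n)"
    "g \<in> carrier K \<Longrightarrow> \<rho> g \<in> carrier_mat n n"
    "g \<in> carrier K \<Longrightarrow> h \<in> carrier K \<Longrightarrow> \<rho> (g \<otimes>\<^bsub>K\<^esub> h) = \<rho> g * \<rho> h"
    "i < n \<Longrightarrow> j < n \<Longrightarrow> continuous_on (carrier K) (\<lambda>g. \<rho> g $$ (i, j))"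
  using assms unfolding unitary_rep_def hom_def unitary_group_def by auto

lemma unitary_rep_mult_index:
  assumes "unitary_rep K n \<rho>" "g \<in> carrier K" "h \<in> carrier K" "i < n" "j < n"
  shows "\<rho> (g \<otimes>\<^bsub>K\<^esub> h) $$ (i, j) = (\<Sum>k<n. \<rho> g $$ (i, k) * \<rho> h $$ (k, j))"
  using unitary_repD(2)[OF assms(1,2)] unitary_repD(2)[OF assms(1,3)] assms(4,5)
  by (simp add: unitary_repD(3)[OF assms(1-3)] scalar_prod_def atLeast0LessThan)

lemma subspace_module_vecI:
  assumes "W \<subseteq> carrier_vec n" "0\<^sub>v n \<in> W"
    "\<And>v w. v \<in> W \<Longrightarrow> w \<in> W \<Longrightarrow> v + w \<in> W" "\<And>c v. v \<in> W \<Longrightarrow> c \<cdot>\<^sub>v v \<in> W"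
  shows "VectorSpace.subspace class_ring W (module_vec TYPE(complex) n)"
proof -
  interpret vec_space "TYPE(complex)" n .
  show ?thesis
    by (intro subspace.intro submodule.intro)
       (use assms vec_vs vec_module in \<open>auto simp: module_vec_def\<close>)
qed

lemma subspace_module_vecD:
  assumes "VectorSpace.subspace class_ring W (module_vec TYPE(complex) n)"
  shows "W \<subseteq> carrier_vec n" "0\<^sub>v n \<in> W"
    "v \<in> W \<Longrightarrow> w \<in> W \<Longrightarrow> v + w \<in> W" "v \<in> W \<Longrightarrow> c \<cdot>\<^sub>v v \<in> W"
proof -
  have s: "submodule class_ring W (module_vec TYPE(complex) n)"
    using assms by (rule subspace.submod)
  show "W \<subseteq> carrier_vec n" "0\<^sub>v n \<in> W"
    "v \<in> W \<Longrightarrow> w \<in> W \<Longrightarrow> v + w \<in> W" "v \<in> W \<Longrightarrow> c \<cdot>\<^sub>v v \<in> W"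
    using submodule.subset[OF s] submodule.zero_closed[OF s] submodule.m_closed[OF s] submodule.smult_closed[OF s]
    by (auto simp: module_vec_def)
qed

text \<open>An eigenspace of \<open>A\<close>, which exists over the complex numbers as
  \<open>n > 0\<close>, is a nonzero invariant subspace and therefore the whole space.\<close>

lemma irreducible_commutant_scalar:
  assumes irr: "irreducible_unitary_rep K n \<pi>" and A: "A \<in> carrier_mat n n"
    and comm: "\<And>g. g \<in> carrier K \<Longrightarrow> A * \<pi> g = \<pi> g * A"
  shows "\<exists>c. A = c \<cdot>\<^sub>m 1\<^sub>m n"
proof -
  have rep: "unitary_rep K n \<pi>" and n: "n > 0"
    using irr by (auto simp: irreducible_unitary_rep_def)
  obtain c where "c \<in> spectrum A" using spectrum_non_empty[OF A n] by blast
  then obtain v where v: "v \<in> carrier_vec n" "v \<noteq> 0\<^sub>v n" "A *\<^sub>v v = c \<cdot>\<^sub>v v"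
    using A by (auto simp: spectrum_def eigenvalue_def eigenvector_def)
  define W where "W = {w \<in> carrier_vec n. A *\<^sub>v w = c \<cdot>\<^sub>v w}"
  have "VectorSpace.subspace class_ring W (module_vec TYPE(complex) n)"
    using A by (intro subspace_module_vecI)
      (auto simp: W_def mult_add_distrib_mat_vec[OF A] smult_add_distrib_vec mult_mat_vec smult_smult_assoc mult.commute)
  moreover have "\<pi> g *\<^sub>v w \<in> W" if g: "g \<in> carrier K" and w: "w \<in> W" for g w
  proof -
    have wc: "w \<in> carrier_vec n" and we: "A *\<^sub>v w = c \<cdot>\<^sub>v w" using w by (auto simp: W_def)
    have P: "\<pi> g \<in> carrier_mat n n" by (rule unitary_repD(2)[OF rep g])
    have "A *\<^sub>v (\<pi> g *\<^sub>v w) = (A * \<pi> g) *\<^sub>v w" using A P wc by simp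
    also have "\<dots> = \<pi> g *\<^sub>v (A *\<^sub>v w)" unfolding comm[OF g] using A P wc by simp
    also have "\<dots> = c \<cdot>\<^sub>v (\<pi> g *\<^sub>v w)" unfolding we using P wc by (simp add: mult_mat_vec)
    finally show ?thesis using P wc by (simp add: W_def)
  qed
  ultimately have "W = {0\<^sub>v n} \<or> W = carrier_vec n"
    using irr unfolding irreducible_unitary_rep_def by blast
  moreover have "v \<in> W" using v by (simp add: W_def)
  ultimately have "W = carrier_vec n" using v(2) by blast
  then have Aw: "A *\<^sub>v w = c \<cdot>\<^sub>v w" if "w \<in> carrier_vec n" for w using that by (auto simp: W_def)
  have "A = c \<cdot>\<^sub>m 1\<^sub>m n"
  proof (rule eq_matI)
    fix i j assume "i < dim_row (c \<cdot>\<^sub>m 1\<^sub>m n)" "j < dim_col (c \<cdot>\<^sub>m 1\<^sub>m n)"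
    then have ij: "i < n" "j < n" by auto
    have "A $$ (i, j) = (A *\<^sub>v unit_vec n j) $ i" using A ij by (simp add: scalar_prod_right_unit)
    also have "\<dots> = (c \<cdot>\<^sub>m 1\<^sub>m n) $$ (i, j)" using Aw[of "unit_vec n j"] ij by (simp add: unit_vec_def)
    finally show "A $$ (i, j) = (c \<cdot>\<^sub>m 1\<^sub>m n) $$ (i, j)" .
  qed (use A in auto)
  then show ?thesis ..
qed

text \<open>
  \<open>T\<^sup>* T\<close> and \<open>T T\<^sup>*\<close> are scalar, with the same scalar, so a nonzero intertwiner is a multiple of a unitary one.
\<close>

lemma nonzero_intertwiner_imp_equivalent:
  assumes \<rho>: "irreducible_unitary_rep K n \<rho>" and \<pi>: "irreducible_unitary_rep K m \<pi>"
    and T: "T \<in> carrier_mat n m" "T \<noteq> 0\<^sub>m n m"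
    and tw: "\<And>g. g \<in> carrier K \<Longrightarrow> \<rho> g * T = T * \<pi> g"
  shows "n = m \<and> (\<pi>, \<rho>) \<in> rep_equivalence K"
proof -
  define S where "S = mat_adjoint T"
  have S: "S \<in> carrier_mat m n" unfolding S_def by (rule mat_adjoint_carrier[OF T(1)])
  have r\<rho>: "unitary_rep K n \<rho>" and r\<pi>: "unitary_rep K m \<pi>"
    using \<rho> \<pi> by (auto simp: irreducible_unitary_rep_def)
  \<comment> \<open>Taking adjoints in the intertwining relation and using that the representations
    are unitary shows that the adjoint intertwines in the other direction.\<close>
  have twS: "\<pi> g * S = S * \<rho> g" if g: "g \<in> carrier K" for g
  proof -
    note R = unitary_groupD[OF unitary_repD(1)[OF r\<rho> g]] and P = unitary_groupD[OF unitary_repD(1)[OF r\<pi> g]]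
    have "T = \<rho> g * T * mat_adjoint (\<pi> g)"
      unfolding tw[OF g] using assoc_mult_mat[OF T(1) P(1,2)] T(1) P(3) by simp
    then have "S = mat_adjoint (\<rho> g * T * mat_adjoint (\<pi> g))" by (simp add: S_def)
    also have "\<dots> = \<pi> g * (S * mat_adjoint (\<rho> g))"
      unfolding S_def
      by (simp add: mat_adjoint_mult[OF mult_carrier_mat[OF R(1) T(1)] P(2)] mat_adjoint_mult[OF R(1) T(1)]
          mat_adjoint_adjoint[OF P(1)])
    finally have "S * \<rho> g = \<pi> g * (S * mat_adjoint (\<rho> g)) * \<rho> g" by simp
    also have "\<dots> = \<pi> g * (S * (mat_adjoint (\<rho> g) * \<rho> g))"
      using S R(1,2) P(1) by (simp add: assoc_mult_mat[of _ m m _ n _ n] assoc_mult_mat[of _ m n _ n _ n])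
    also have "\<dots> = \<pi> g * S" using S unfolding R(4) by simp
    finally show ?thesis ..
  qed
  have ST: "S * T \<in> carrier_mat m m" and TS: "T * S \<in> carrier_mat n n" using S T(1) by auto
  obtain c where c: "S * T = c \<cdot>\<^sub>m 1\<^sub>m m"
  proof -
    have "S * T * \<pi> g = \<pi> g * (S * T)" if g: "g \<in> carrier K" for g
    proof -
      note R = unitary_repD(2)[OF r\<rho> g] and P = unitary_repD(2)[OF r\<pi> g]
      have "S * T * \<pi> g = S * (\<rho> g * T)" using S T(1) P tw[OF g] by (simp add: assoc_mult_mat[of _ m n _ m _ m])
      also have "\<dots> = (\<pi> g * S) * T" unfolding twS[OF g] using S T(1) R by (simp add: assoc_mult_mat[of _ m n _ n _ m])
      finally show ?thesis using S T(1) P by (simp add: assoc_mult_mat[of _ m m _ n _ m])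
    qed
    from irreducible_commutant_scalar[OF \<pi> ST this] show ?thesis using that by blast
  qed
  obtain d where d: "T * S = d \<cdot>\<^sub>m 1\<^sub>m n"
  proof -
    have "T * S * \<rho> g = \<rho> g * (T * S)" if g: "g \<in> carrier K" for g
    proof -
      note R = unitary_repD(2)[OF r\<rho> g] and P = unitary_repD(2)[OF r\<pi> g]
      have "T * S * \<rho> g = T * (\<pi> g * S)" using S T(1) R twS[OF g] by (simp add: assoc_mult_mat[of _ n m _ n _ n])
      also have "\<dots> = (\<rho> g * T) * S" unfolding tw[OF g] using S T(1) P by (simp add: assoc_mult_mat[of _ n m _ m _ n])
      finally show ?thesis using S T(1) R by (simp add: assoc_mult_mat[of _ n n _ m _ n])
    qed
    from irreducible_commutant_scalar[OF \<rho> TS this] show ?thesis using that by blast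
  qed
  \<comment> \<open>A nonzero entry makes the scalar \<open>d\<close> positive, for \<open>d\<close>
    is the squared norm of each row of \<open>T\<close>.\<close>
  obtain i0 j0 where ij: "i0 < n" "j0 < m" "T $$ (i0, j0) \<noteq> 0"
    using T by (metis eq_matI index_zero_mat(1,2,3) carrier_matD)
  have sq: "complex_of_real (\<Sum>j<m. (norm (T $$ (i, j)))\<^sup>2) = d" if "i < n" for i
  proof -
    have "d = (T * S) $$ (i, i)" unfolding d using that by simp
    also have "\<dots> = (\<Sum>j<m. T $$ (i, j) * cnj (T $$ (i, j)))"
      using that T(1) S by (simp add: S_def scalar_prod_def mat_adjoint_index[OF T(1)] atLeast0LessThan)
    finally show ?thesis by (simp only: of_real_sum complex_norm_square)
  qed
  define e where "e = (\<Sum>j<m. (norm (T $$ (i0, j)))\<^sup>2)"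
  have de: "d = of_real e" using sq[OF ij(1)] by (simp add: e_def)
  have e: "e > 0"
    unfolding e_def using ij by (intro sum_pos2[of _ j0]) auto
  have "c \<cdot>\<^sub>m T = T * (S * T)" unfolding c using T(1) by (simp add: mult_smult_distrib[OF T(1) one_carrier_mat])
  also have "\<dots> = (T * S) * T" using T(1) S by simp
  also have "\<dots> = d \<cdot>\<^sub>m T" unfolding d using T(1) by (simp add: mult_smult_assoc_mat[of _ n n])
  finally have "(c \<cdot>\<^sub>m T) $$ (i0, j0) = (d \<cdot>\<^sub>m T) $$ (i0, j0)" by simp
  then have cd: "c = d" using ij T(1) by simp
  \<comment> \<open>The traces of \<open>T * S\<close> and \<open>S * T\<close> coincide; with equal
    nonzero scalars this compares the degrees.\<close>
  have "(\<Sum>i<n. (T * S) $$ (i, i)) = (\<Sum>j<m. (S * T) $$ (j, j))"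
    using T(1) S by (simp add: scalar_prod_def atLeast0LessThan) (subst sum.swap, simp add: mult.commute)
  then have "of_nat n * d = of_nat m * d" unfolding c d cd by simp
  then have nm: "n = m" using e by (simp add: de)
  define U where "U = complex_of_real (1 / sqrt e) \<cdot>\<^sub>m T"
  have T': "T \<in> carrier_mat n n" and S': "S \<in> carrier_mat n n" using T(1) S nm by auto
  have Uc: "U \<in> carrier_mat n n" using T' by (simp add: U_def)
  have "mat_adjoint U = complex_of_real (1 / sqrt e) \<cdot>\<^sub>m S"
  proof (rule eq_matI)
    fix i j assume "i < dim_row (complex_of_real (1 / sqrt e) \<cdot>\<^sub>m S)" "j < dim_col (complex_of_real (1 / sqrt e) \<cdot>\<^sub>m S)"
    then have ij: "i < n" "j < n" using S' by auto
    show "mat_adjoint U $$ (i, j) = (complex_of_real (1 / sqrt e) \<cdot>\<^sub>m S) $$ (i, j)"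
      unfolding mat_adjoint_index[OF Uc ij] using ij S' T' mat_adjoint_index[OF T' ij]
      by (simp add: U_def S_def)
  qed (use mat_adjoint_carrier[OF Uc] S' in auto)
  then have "U * mat_adjoint U = (complex_of_real (1 / sqrt e) * complex_of_real (1 / sqrt e)) \<cdot>\<^sub>m (T * S)"
    unfolding U_def using T' S' by (simp add: mult_smult_distrib[of _ n n] mult_smult_assoc_mat[of _ n n] smult_smult_mat)
  also have "\<dots> = 1\<^sub>m n"
  proof -
    have "complex_of_real (1 / sqrt e) * complex_of_real (1 / sqrt e) * of_real e = of_real (1 / sqrt e * (1 / sqrt e) * e)"
      by (simp only: of_real_mult)
    also have "1 / sqrt e * (1 / sqrt e) * e = 1" using e by (simp add: real_sqrt_mult_self)
    finally have "complex_of_real (1 / sqrt e) * complex_of_real (1 / sqrt e) * d = 1" by (simp add: de)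
    then show ?thesis unfolding d smult_smult_mat by (intro eq_matI) auto
  qed
  finally have "U \<in> carrier (unitary_group n)" using Uc by (simp add: unitary_group_def)
  moreover have "U * \<pi> g = \<rho> g * U" if g: "g \<in> carrier K" for g
    using tw[OF g] T' unitary_repD(2)[OF r\<rho> g] unitary_repD(2)[OF r\<pi> g] nm
    by (simp add: U_def mult_smult_distrib[of _ n n] mult_smult_assoc_mat[of _ n n])
  ultimately show ?thesis using nm \<rho> \<pi> unfolding rep_equivalence_def by blast
qed

section \<open>Orthogonality of characters\<close>

text \<open>Continuity of the left translations makes them measurable, as the change of variables
  behind \<open>distr\<close> requires.\<close>

locale haar_group = group K for K :: "('g::topological_space) monoid" (structure) +
  fixes \<mu> :: "'g measure"
  assumes haar: "normalized_haar_measure K \<mu>"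
    and continuous_left_mult: "g \<in> carrier K \<Longrightarrow> continuous_on (carrier K) (\<lambda>x. g \<otimes> x)"
begin

sublocale prob_space \<mu>
  using haar by (simp add: normalized_haar_measure_def)

lemma space_haar: "space \<mu> = carrier K"
  and sets_haar: "sets \<mu> = sets (restrict_space borel (carrier K))"
  and distr_haar: "g \<in> carrier K \<Longrightarrow> distr \<mu> \<mu> (\<lambda>x. g \<otimes> x) = \<mu>"
  using haar by (auto simp: normalized_haar_measure_def)

lemma continuous_imp_measurable:
  fixes f :: "'g \<Rightarrow> 'b::topological_space"
  assumes "continuous_on (carrier K) f"
  shows "f \<in> borel_measurable \<mu>"
  using borel_measurable_continuous_on_restrict[OF assms]
  by (simp cong: measurable_cong_sets add: measurable_cong_sets[OF sets_haar refl])

lemma integrable_continuous_bounded: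
  fixes f :: "'g \<Rightarrow> complex"
  assumes "continuous_on (carrier K) f" "\<And>x. x \<in> carrier K \<Longrightarrow> norm (f x) \<le> B"
  shows "integrable \<mu> f"
  by (rule integrable_const_bound[of _ B])
     (use assms in \<open>auto intro!: AE_I2 continuous_imp_measurable simp: space_haar\<close>)

lemma integral_left_mult:
  fixes f :: "'g \<Rightarrow> complex"
  assumes "g \<in> carrier K" "continuous_on (carrier K) f"
  shows "(\<integral>x. f (g \<otimes> x) \<partial>\<mu>) = (\<integral>x. f x \<partial>\<mu>)"
proof -
  have "(\<lambda>x. g \<otimes> x) \<in> measurable \<mu> borel"
    by (rule continuous_imp_measurable[OF continuous_left_mult[OF assms(1)]])
  then have "(\<lambda>x. g \<otimes> x) \<in> measurable \<mu> (restrict_space borel (carrier K))"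
    by (rule measurable_restrict_space2[rotated]) (use assms(1) in \<open>auto simp: space_haar\<close>)
  then have m: "(\<lambda>x. g \<otimes> x) \<in> measurable \<mu> \<mu>"
    by (simp add: measurable_cong_sets[OF refl sets_haar])
  have "(\<integral>x. f x \<partial>\<mu>) = (\<integral>x. f x \<partial>distr \<mu> \<mu> (\<lambda>x. g \<otimes> x))" by (simp add: distr_haar assms(1))
  also have "\<dots> = (\<integral>x. f (g \<otimes> x) \<partial>\<mu>)"
    by (rule integral_distr[OF m continuous_imp_measurable[OF assms(2)]])
  finally show ?thesis ..
qed

lemma integrable_coeff:
  assumes "unitary_rep K n \<rho>" "unitary_rep K m \<pi>" "i < n" "k < n" "j < m" "l < m"
  shows "integrable \<mu> (\<lambda>g. \<rho> g $$ (i, k) * cnj (\<pi> g $$ (j, l)))"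
proof (rule integrable_continuous_bounded[where B = 1])
  show "continuous_on (carrier K) (\<lambda>g. \<rho> g $$ (i, k) * cnj (\<pi> g $$ (j, l)))"
    by (intro continuous_intros unitary_repD(4)[OF assms(1)] unitary_repD(4)[OF assms(2)] assms)
  show "norm (\<rho> g $$ (i, k) * cnj (\<pi> g $$ (j, l))) \<le> 1" if "g \<in> carrier K" for g
    using unitary_entry_le_1[OF unitary_repD(1)[OF assms(1) that] assms(3,4)]
      unitary_entry_le_1[OF unitary_repD(1)[OF assms(2) that] assms(5,6)]
    by (simp add: norm_mult mult_le_one)
qed

text \<open>The average over the group of \<open>\<rho> g * E * mat_adjoint (\<pi> g)\<close>, where
  \<open>E\<close> is the matrix unit at position \<open>(k, l)\<close>.\<close>

definition coeff_mat :: "nat \<Rightarrow> ('g \<Rightarrow> complex mat) \<Rightarrow> nat \<Rightarrow> ('g \<Rightarrow> complex mat) \<Rightarrow> nat \<Rightarrow> nat \<Rightarrow> complex mat" where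
  "coeff_mat n \<rho> m \<pi> k l = Matrix.mat n m (\<lambda>(i, j). \<integral>g. \<rho> g $$ (i, k) * cnj (\<pi> g $$ (j, l)) \<partial>\<mu>)"

text \<open>Multiplying the average by \<open>\<rho> h\<close> replaces \<open>\<rho> g\<close> by
  \<open>\<rho> (h g)\<close>. The other factor is brought to \<open>h g\<close> as well at the cost
  of \<open>\<pi> h\<close> on the right, and left invariance of the measure removes
  \<open>h\<close> from the integrand.\<close>

lemma coeff_mat_intertwines:
  assumes \<rho>: "unitary_rep K n \<rho>" and \<pi>: "unitary_rep K m \<pi>" and kl: "k < n" "l < m" and h: "h \<in> carrier K"
  shows "\<rho> h * coeff_mat n \<rho> m \<pi> k l = coeff_mat n \<rho> m \<pi> k l * \<pi> h"
proof (rule eq_matI)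
  note R = unitary_repD(2)[OF \<rho> h] and P = unitary_repD(2)[OF \<pi> h]
  note I = integrable_coeff[OF \<rho> \<pi>]
  let ?F = "\<lambda>i j g. \<rho> g $$ (i, k) * cnj (\<pi> g $$ (j, l))"
  fix i j assume "i < dim_row (coeff_mat n \<rho> m \<pi> k l * \<pi> h)" "j < dim_col (coeff_mat n \<rho> m \<pi> k l * \<pi> h)"
  then have ij: "i < n" "j < m" using P by (auto simp: coeff_mat_def)
  have "(\<rho> h * coeff_mat n \<rho> m \<pi> k l) $$ (i, j) = (\<Sum>a<n. \<rho> h $$ (i, a) * (\<integral>g. ?F a j g \<partial>\<mu>))"
    using R ij by (simp add: scalar_prod_def coeff_mat_def atLeast0LessThan)
  also have "\<dots> = (\<integral>g. (\<Sum>a<n. \<rho> h $$ (i, a) * ?F a j g) \<partial>\<mu>)"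
    using ij kl by (subst Bochner_Integration.integral_sum) (auto intro!: I)
  also have "\<dots> = (\<integral>g. \<rho> (h \<otimes> g) $$ (i, k) * cnj (\<pi> g $$ (j, l)) \<partial>\<mu>)"
    by (rule Bochner_Integration.integral_cong)
       (auto simp: space_haar unitary_rep_mult_index[OF \<rho> h _ ij(1) kl(1)] sum_distrib_right mult.assoc)
  also have "\<dots> = (\<integral>g. (\<Sum>b<m. \<pi> h $$ (b, j) * ?F i b (h \<otimes> g)) \<partial>\<mu>)"
  proof (rule Bochner_Integration.integral_cong)
    fix g assume "g \<in> space \<mu>"
    then have g: "g \<in> carrier K" by (simp add: space_haar)
    \<comment> \<open>Unitarity of \<open>\<pi> h\<close> expresses the adjoint of
      \<open>\<pi> g\<close> through the adjoint of \<open>\<pi> (h g)\<close> times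
      \<open>\<pi> h\<close>.\<close>
    have "(\<Sum>b<m. \<pi> h $$ (b, j) * cnj (\<pi> (h \<otimes> g) $$ (b, l))) =
        (\<Sum>b<m. \<Sum>c<m. \<pi> h $$ (b, j) * cnj (\<pi> h $$ (b, c)) * cnj (\<pi> g $$ (c, l)))"
      by (intro sum.cong refl) (simp add: unitary_rep_mult_index[OF \<pi> h g _ kl(2)] sum_distrib_left mult.assoc)
    also have "\<dots> = (\<Sum>c<m. (\<Sum>b<m. cnj (\<pi> h $$ (b, c)) * \<pi> h $$ (b, j)) * cnj (\<pi> g $$ (c, l)))"
      by (subst sum.swap) (simp add: sum_distrib_left sum_distrib_right mult_ac)
    also have "\<dots> = (\<Sum>c<m. if c = j then cnj (\<pi> g $$ (c, l)) else 0)"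
      by (intro sum.cong refl) (simp add: unitary_cols[OF unitary_repD(1)[OF \<pi> h] _ ij(2)])
    also have "\<dots> = cnj (\<pi> g $$ (j, l))" using ij by simp
    finally have "cnj (\<pi> g $$ (j, l)) = (\<Sum>b<m. \<pi> h $$ (b, j) * cnj (\<pi> (h \<otimes> g) $$ (b, l)))" ..
    then show "\<rho> (h \<otimes> g) $$ (i, k) * cnj (\<pi> g $$ (j, l)) = (\<Sum>b<m. \<pi> h $$ (b, j) * ?F i b (h \<otimes> g))"
      by (simp add: sum_distrib_left mult_ac)
  qed simp
  also have "\<dots> = (\<integral>g. (\<Sum>b<m. \<pi> h $$ (b, j) * ?F i b g) \<partial>\<mu>)"
    by (rule integral_left_mult[OF h])
       (use ij kl in \<open>auto intro!: continuous_intros unitary_repD(4)[OF \<rho>] unitary_repD(4)[OF \<pi>]\<close>)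
  also have "\<dots> = (\<Sum>b<m. \<pi> h $$ (b, j) * (\<integral>g. ?F i b g \<partial>\<mu>))"
    using ij kl by (subst Bochner_Integration.integral_sum) (auto intro!: I)
  also have "\<dots> = (coeff_mat n \<rho> m \<pi> k l * \<pi> h) $$ (i, j)"
    using P ij by (simp add: scalar_prod_def coeff_mat_def atLeast0LessThan mult.commute)
  finally show "(\<rho> h * coeff_mat n \<rho> m \<pi> k l) $$ (i, j) = (coeff_mat n \<rho> m \<pi> k l * \<pi> h) $$ (i, j)" .
qed (use unitary_repD(2)[OF \<rho> h] unitary_repD(2)[OF \<pi> h] in \<open>auto simp: coeff_mat_def\<close>)

lemma coeff_orthogonal:
  assumes \<rho>: "irreducible_unitary_rep K n \<rho>" and \<pi>: "irreducible_unitary_rep K m \<pi>"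
    and ne: "(\<pi>, \<rho>) \<notin> rep_equivalence K" and ij: "i < n" "k < n" "j < m" "l < m"
  shows "(\<integral>g. \<rho> g $$ (i, k) * cnj (\<pi> g $$ (j, l)) \<partial>\<mu>) = 0"
proof -
  have r: "unitary_rep K n \<rho>" "unitary_rep K m \<pi>" using \<rho> \<pi> by (auto simp: irreducible_unitary_rep_def)
  have "coeff_mat n \<rho> m \<pi> k l = 0\<^sub>m n m"
    using nonzero_intertwiner_imp_equivalent[OF \<rho> \<pi> _ _ coeff_mat_intertwines[OF r ij(2,4)]] ne
    by (auto simp: coeff_mat_def)
  then have "coeff_mat n \<rho> m \<pi> k l $$ (i, j) = 0" using ij by simp
  then show ?thesis using ij by (simp add: coeff_mat_def)
qed

text \<open>Schur's lemma makes the average a scalar matrix, and its trace is known: orthonormality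
  of the columns of \<open>\<rho> g\<close> makes the integrand of the trace the constant 1 or
  0.\<close>

lemma coeff_self:
  assumes \<rho>: "irreducible_unitary_rep K n \<rho>" and ij: "i < n" "k < n" "j < n" "l < n"
  shows "(\<integral>g. \<rho> g $$ (i, k) * cnj (\<rho> g $$ (j, l)) \<partial>\<mu>) = (if i = j \<and> k = l then 1 / of_nat n else 0)"
proof -
  have r: "unitary_rep K n \<rho>" using \<rho> by (auto simp: irreducible_unitary_rep_def)
  have T: "coeff_mat n \<rho> n \<rho> k l \<in> carrier_mat n n" by (simp add: coeff_mat_def)
  obtain c where c: "coeff_mat n \<rho> n \<rho> k l = c \<cdot>\<^sub>m 1\<^sub>m n"
    using irreducible_commutant_scalar[OF \<rho> T] coeff_mat_intertwines[OF r r ij(2,4)] by metis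
  have e: "(\<integral>g. \<rho> g $$ (i, k) * cnj (\<rho> g $$ (j, l)) \<partial>\<mu>) = (if i = j then c else 0)" if "i < n" "j < n" for i j
    using arg_cong[OF c, of "\<lambda>A. A $$ (i, j)"] that by (simp add: coeff_mat_def)
  have "of_nat n * c = (\<Sum>i<n. \<integral>g. \<rho> g $$ (i, k) * cnj (\<rho> g $$ (i, l)) \<partial>\<mu>)"
    by (simp add: e)
  also have "\<dots> = (\<integral>g. (\<Sum>i<n. \<rho> g $$ (i, k) * cnj (\<rho> g $$ (i, l))) \<partial>\<mu>)"
    using ij by (subst Bochner_Integration.integral_sum) (auto intro!: integrable_coeff[OF r r])
  also have "\<dots> = (\<integral>g. (if k = l then 1 else 0) \<partial>\<mu>)"
  proof (rule Bochner_Integration.integral_cong)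
    fix g assume "g \<in> space \<mu>"
    then have "\<rho> g \<in> carrier (unitary_group n)" using unitary_repD(1)[OF r] by (simp add: space_haar)
    from unitary_cols[OF this ij(4,2)]
    show "(\<Sum>i<n. \<rho> g $$ (i, k) * cnj (\<rho> g $$ (i, l))) = (if k = l then 1 else 0)"
      by (simp only: mult.commute[of "cnj _"] eq_commute[of l k])
  qed simp
  also have "\<dots> = (if k = l then 1 else 0)" by (simp add: prob_space)
  finally have "c = (if k = l then 1 / of_nat n else 0)" using ij by (auto simp: field_simps split: if_splits)
  then show ?thesis using e[OF ij(1,3)] by simp
qed

end

definition trace_char :: "nat \<Rightarrow> ('g \<Rightarrow> complex mat) \<Rightarrow> 'g \<Rightarrow> complex" where
  "trace_char n \<rho> g = (\<Sum>i<n. \<rho> g $$ (i, i))"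

context haar_group begin

lemma char_orthogonal:
  assumes \<rho>: "irreducible_unitary_rep K n \<rho>" and \<pi>: "irreducible_unitary_rep K m \<pi>"
    and ne: "(\<pi>, \<rho>) \<notin> rep_equivalence K"
  shows "(\<integral>g. trace_char n \<rho> g * cnj (trace_char m \<pi> g) \<partial>\<mu>) = 0"
proof -
  have r: "unitary_rep K n \<rho>" "unitary_rep K m \<pi>" using \<rho> \<pi> by (auto simp: irreducible_unitary_rep_def)
  have "(\<integral>g. trace_char n \<rho> g * cnj (trace_char m \<pi> g) \<partial>\<mu>) =
      (\<Sum>i<n. \<Sum>j<m. \<integral>g. \<rho> g $$ (i, i) * cnj (\<pi> g $$ (j, j)) \<partial>\<mu>)"
    unfolding trace_char_def sum_product cnj_sum
    by (subst Bochner_Integration.integral_sum, fastforce intro!: Bochner_Integration.integrable_sum integrable_coeff[OF r])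
       (auto intro!: sum.cong Bochner_Integration.integral_sum integrable_coeff[OF r])
  also have "\<dots> = 0" using coeff_orthogonal[OF \<rho> \<pi> ne] by simp
  finally show ?thesis .
qed

lemma char_self:
  assumes \<rho>: "irreducible_unitary_rep K n \<rho>"
  shows "(\<integral>g. trace_char n \<rho> g * cnj (trace_char n \<rho> g) \<partial>\<mu>) = 1"
proof -
  have r: "unitary_rep K n \<rho>" and n: "n > 0" using \<rho> by (auto simp: irreducible_unitary_rep_def)
  have "(\<integral>g. trace_char n \<rho> g * cnj (trace_char n \<rho> g) \<partial>\<mu>) =
      (\<Sum>i<n. \<Sum>j<n. \<integral>g. \<rho> g $$ (i, i) * cnj (\<rho> g $$ (j, j)) \<partial>\<mu>)"
    unfolding trace_char_def sum_product cnj_sum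
    by (subst Bochner_Integration.integral_sum, fastforce intro!: Bochner_Integration.integrable_sum integrable_coeff[OF r r])
       (auto intro!: sum.cong Bochner_Integration.integral_sum integrable_coeff[OF r r])
  also have "\<dots> = (\<Sum>i<n. \<Sum>j<n. if j = i then 1 / of_nat n else 0)"
    by (intro sum.cong refl) (auto simp: coeff_self[OF \<rho>])
  also have "\<dots> = 1" using n by simp
  finally show ?thesis .
qed

end

lemma sum_diag_mult_comm:
  assumes "A \<in> carrier_mat n m" "B \<in> carrier_mat m n"
  shows "(\<Sum>i<n. (A * B) $$ (i, i)) = (\<Sum>k<m. (B * A) $$ (k, k) :: complex)"
  using assms by (simp add: scalar_prod_def atLeast0LessThan) (subst sum.swap, simp add: mult.commute)

lemma rep_equivalence_char:
  assumes "(\<rho>, \<sigma>) \<in> rep_equivalence K" "irreducible_unitary_rep K n \<rho>" "irreducible_unitary_rep K m \<sigma>"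
    and g: "g \<in> carrier K"
  shows "trace_char n \<rho> g = trace_char m \<sigma> g"
proof -
  obtain n' U where U: "irreducible_unitary_rep K n' \<rho>" "irreducible_unitary_rep K n' \<sigma>"
    "U \<in> carrier (unitary_group n')" "U * \<rho> g = \<sigma> g * U"
    using assms(1) g unfolding rep_equivalence_def by blast
  have r: "unitary_rep K n \<rho>" "unitary_rep K m \<sigma>" "unitary_rep K n' \<rho>" "unitary_rep K n' \<sigma>"
    using assms(2,3) U(1,2) by (auto simp: irreducible_unitary_rep_def)
  have c: "\<rho> g \<in> carrier_mat n n" "\<rho> g \<in> carrier_mat n' n'" "\<sigma> g \<in> carrier_mat m m" "\<sigma> g \<in> carrier_mat n' n'"
    using unitary_repD(2)[OF r(1) g] unitary_repD(2)[OF r(3) g] unitary_repD(2)[OF r(2) g] unitary_repD(2)[OF r(4) g] .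
  \<comment> \<open>The size of the matrix at \<open>g\<close> determines the degree, which
    reconciles the degrees from the different hypotheses.\<close>
  then have n: "n = n'" "m = n'" by auto
  note V = unitary_groupD[OF U(3)]
  have "\<rho> g = (mat_adjoint U * U) * \<rho> g" unfolding V(4) using c(2) by simp
  also have "\<dots> = mat_adjoint U * (\<sigma> g * U)" unfolding U(4)[symmetric] by (rule assoc_mult_mat[OF V(2,1) c(2)])
  finally have e: "\<rho> g = mat_adjoint U * (\<sigma> g * U)" .
  have "trace_char n \<rho> g = (\<Sum>i<n'. (mat_adjoint U * (\<sigma> g * U)) $$ (i, i))"
    unfolding trace_char_def n e ..
  also have "\<dots> = (\<Sum>k<n'. (\<sigma> g * U * mat_adjoint U) $$ (k, k))"
    by (rule sum_diag_mult_comm[OF V(2) mult_carrier_mat[OF c(4) V(1)]])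
  also have "\<sigma> g * U * mat_adjoint U = \<sigma> g"
    unfolding assoc_mult_mat[OF c(4) V(1,2)] V(3) using c(4) by simp
  finally show ?thesis by (simp add: trace_char_def n)
qed

text \<open>The point \<open>e\<close> serves transitivity: the middle representation comes with two
  degrees, and the size of its value at \<open>e\<close> identifies them.\<close>

lemma equiv_rep_equivalence:
  assumes e: "e \<in> carrier K"
  shows "equiv (irreps K) (rep_equivalence K)"
proof (intro equivI)
  show "rep_equivalence K \<subseteq> irreps K \<times> irreps K" by (auto simp: rep_equivalence_def irreps_def)
  show "refl_on (irreps K) (rep_equivalence K)"
  proof (rule refl_onI)
    fix \<rho> assume "\<rho> \<in> irreps K"
    then obtain n where n: "irreducible_unitary_rep K n \<rho>" by (auto simp: irreps_def)
    have "(1\<^sub>m n :: complex mat) * mat_adjoint (1\<^sub>m n) = 1\<^sub>m n"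
      using mat_adjoint_carrier[of "1\<^sub>m n :: complex mat" n n]
      by (intro eq_matI) (auto simp: mat_adjoint_index[OF one_carrier_mat])
    then have u: "1\<^sub>m n \<in> carrier (unitary_group n)" by (simp add: unitary_group_def)
    have "1\<^sub>m n * \<rho> g = \<rho> g * 1\<^sub>m n" if "g \<in> carrier K" for g
      using unitary_repD(2)[of K n \<rho> g] n that by (simp add: irreducible_unitary_rep_def)
    then show "(\<rho>, \<rho>) \<in> rep_equivalence K" using n u unfolding rep_equivalence_def by blast
  qed
  show "sym (rep_equivalence K)"
  proof (rule symI)
    fix \<rho> \<sigma> assume "(\<rho>, \<sigma>) \<in> rep_equivalence K"
    then obtain n U where U: "irreducible_unitary_rep K n \<rho>" "irreducible_unitary_rep K n \<sigma>"
      "U \<in> carrier (unitary_group n)" "\<And>g. g \<in> carrier K \<Longrightarrow> U * \<rho> g = \<sigma> g * U"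
      unfolding rep_equivalence_def by blast
    note V = unitary_groupD[OF U(3)]
    have v: "mat_adjoint U \<in> carrier (unitary_group n)"
      using V by (simp add: unitary_group_def mat_adjoint_adjoint[OF V(1)])
    have "mat_adjoint U * \<sigma> g = \<rho> g * mat_adjoint U" if g: "g \<in> carrier K" for g
    proof -
      have c: "\<rho> g \<in> carrier_mat n n" "\<sigma> g \<in> carrier_mat n n"
        using U(1,2) unitary_repD(2) g by (auto simp: irreducible_unitary_rep_def)
      have "mat_adjoint U * \<sigma> g = mat_adjoint U * (\<sigma> g * U * mat_adjoint U)" using V c by simp
      also have "\<sigma> g * U = U * \<rho> g" using U(4)[OF g] ..
      also have "mat_adjoint U * (U * \<rho> g * mat_adjoint U) = (mat_adjoint U * U) * \<rho> g * mat_adjoint U"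
        using V(1,2) c by (simp add: assoc_mult_mat[of _ n n _ n _ n])
      finally show ?thesis using V c by simp
    qed
    then show "(\<sigma>, \<rho>) \<in> rep_equivalence K" using U v unfolding rep_equivalence_def by blast
  qed
  show "trans (rep_equivalence K)"
  proof (rule transI)
    fix \<rho> \<sigma> \<tau> assume "(\<rho>, \<sigma>) \<in> rep_equivalence K" "(\<sigma>, \<tau>) \<in> rep_equivalence K"
    then obtain n U m V where U: "irreducible_unitary_rep K n \<rho>" "irreducible_unitary_rep K n \<sigma>"
      "U \<in> carrier (unitary_group n)" "\<And>g. g \<in> carrier K \<Longrightarrow> U * \<rho> g = \<sigma> g * U"
      and V: "irreducible_unitary_rep K m \<sigma>" "irreducible_unitary_rep K m \<tau>"
      "V \<in> carrier (unitary_group m)" "\<And>g. g \<in> carrier K \<Longrightarrow> V * \<sigma> g = \<tau> g * V"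
      unfolding rep_equivalence_def by blast
    have "\<sigma> e \<in> carrier_mat n n" "\<sigma> e \<in> carrier_mat m m"
      using U(2) V(1) unitary_repD(2)[OF _ e] by (auto simp: irreducible_unitary_rep_def)
    then have m: "m = n" by auto
    note UD = unitary_groupD[OF U(3)] and VD = unitary_groupD[OF V(3)[unfolded m]]
    have "V * U * mat_adjoint (V * U) = V * (U * mat_adjoint U) * mat_adjoint V"
      unfolding mat_adjoint_mult[OF VD(1) UD(1)] using UD(1,2) VD(1,2) by (simp add: assoc_mult_mat[of _ n n _ n _ n])
    then have "V * U \<in> carrier (unitary_group n)"
      using UD VD by (simp add: unitary_group_def)
    moreover have "V * U * \<rho> g = \<tau> g * (V * U)" if g: "g \<in> carrier K" for g
    proof -
      have c: "\<rho> g \<in> carrier_mat n n" "\<sigma> g \<in> carrier_mat n n" "\<tau> g \<in> carrier_mat n n"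
        using U(1,2) V(2) unitary_repD(2)[OF _ g] by (auto simp: irreducible_unitary_rep_def m)
      have "V * U * \<rho> g = V * (\<sigma> g * U)" using UD(1) VD(1) c U(4)[OF g] by (simp add: assoc_mult_mat[of _ n n _ n _ n])
      also have "\<dots> = \<tau> g * V * U" using UD(1) VD(1) c V(4)[OF g, symmetric] by (simp add: assoc_mult_mat[of _ n n _ n _ n])
      finally show ?thesis using UD(1) VD(1) c by (simp add: assoc_mult_mat[of _ n n _ n _ n])
    qed
    ultimately show "(\<rho>, \<tau>) \<in> rep_equivalence K"
      using U(1) V(2) unfolding rep_equivalence_def m by blast
  qed
qed

section \<open>Weight representations and tensor products\<close>

text \<open>A sufficient condition for irreducibility that can be checked on matrix entries and
  passes to tensor products of representations of two groups. The separating element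
  \<open>t\<close> plays the role of a torus element and may depend on the pair of indices.\<close>

definition weight_rep :: "('g::topological_space) monoid \<Rightarrow> nat \<Rightarrow> ('g \<Rightarrow> complex mat) \<Rightarrow> bool" where
  "weight_rep K n \<rho> \<longleftrightarrow> unitary_rep K n \<rho> \<and>
     (\<forall>i<n. \<forall>j<n. i \<noteq> j \<longrightarrow> (\<exists>t\<in>carrier K. (\<forall>a<n. \<forall>b<n. a \<noteq> b \<longrightarrow> \<rho> t $$ (a, b) = 0) \<and>
        \<rho> t $$ (i, i) \<noteq> \<rho> t $$ (j, j))) \<and>
     (\<exists>p<n. \<forall>i<n. (\<exists>g\<in>carrier K. \<rho> g $$ (p, i) \<noteq> 0) \<and> (\<exists>g\<in>carrier K. \<rho> g $$ (i, p) \<noteq> 0))"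

lemma weight_rep_separates:
  "weight_rep K n \<rho> \<Longrightarrow> i < n \<Longrightarrow> j < n \<Longrightarrow> i \<noteq> j \<Longrightarrow>
    \<exists>t\<in>carrier K. (\<forall>a<n. \<forall>b<n. a \<noteq> b \<longrightarrow> \<rho> t $$ (a, b) = 0) \<and> \<rho> t $$ (i, i) \<noteq> \<rho> t $$ (j, j)"
  by (simp add: weight_rep_def)

text \<open>
  Elements acting diagonally with different eigenvalues isolate the coordinates of a vector in an
  invariant subspace; the vector of index \<open>p\<close> is then linked to all others in both directions.
\<close>

lemma weight_rep_irreducible:
  assumes "weight_rep K n \<rho>"
  shows "irreducible_unitary_rep K n \<rho>"
  unfolding irreducible_unitary_rep_def
proof (intro conjI allI impI)
  show rep: "unitary_rep K n \<rho>" using assms by (simp add: weight_rep_def)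
  obtain p where p: "p < n" and pi: "\<And>i. i < n \<Longrightarrow> \<exists>g\<in>carrier K. \<rho> g $$ (p, i) \<noteq> 0"
    and ip: "\<And>i. i < n \<Longrightarrow> \<exists>g\<in>carrier K. \<rho> g $$ (i, p) \<noteq> 0"
    using assms unfolding weight_rep_def by blast
  show "n > 0" using p by simp
  fix W assume "VectorSpace.subspace class_ring W (module_vec TYPE(complex) n) \<and>
      (\<forall>g\<in>carrier K. \<forall>w\<in>W. \<rho> g *\<^sub>v w \<in> W)"
  then have sub: "VectorSpace.subspace class_ring W (module_vec TYPE(complex) n)"
    and inv: "\<And>g w. g \<in> carrier K \<Longrightarrow> w \<in> W \<Longrightarrow> \<rho> g *\<^sub>v w \<in> W" by auto
  note W = subspace_module_vecD[OF sub]
  have isolate: "w \<in> W \<Longrightarrow> i < n \<Longrightarrow> w $ i \<noteq> 0 \<Longrightarrow> unit_vec n i \<in> W" for w i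
  proof (induction "card {j. j < n \<and> w $ j \<noteq> 0}" arbitrary: w rule: less_induct)
    case less
    have wc: "w \<in> carrier_vec n" using less.prems(1) W(1) by blast
    show ?case
    proof (cases "\<exists>j<n. j \<noteq> i \<and> w $ j \<noteq> 0")
      case False
      have "(1 / (w $ i)) \<cdot>\<^sub>v w \<in> W" by (rule W(4)[OF less.prems(1)])
      also have "(1 / (w $ i)) \<cdot>\<^sub>v w = unit_vec n i"
        using False less.prems(2,3) wc by (intro eq_vecI) (auto simp: unit_vec_def)
      finally show ?thesis .
    next
      case True
      then obtain j where j: "j < n" "j \<noteq> i" "w $ j \<noteq> 0" by blast
      obtain t where t: "t \<in> carrier K" "\<And>a b. a < n \<Longrightarrow> b < n \<Longrightarrow> a \<noteq> b \<Longrightarrow> \<rho> t $$ (a, b) = 0"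
        "\<rho> t $$ (i, i) \<noteq> \<rho> t $$ (j, j)"
        using weight_rep_separates[OF assms less.prems(2) j(1)] j(2) by blast
      have R: "\<rho> t \<in> carrier_mat n n" by (rule unitary_repD(2)[OF rep t(1)])
      \<comment> \<open>Subtracting the eigenvalue at \<open>j\<close> kills the coordinate
        \<open>j\<close> but keeps the coordinate \<open>i\<close>, while no vanishing coordinate
        reappears; so the support shrinks.\<close>
      define w' where "w' = \<rho> t *\<^sub>v w + (- (\<rho> t $$ (j, j))) \<cdot>\<^sub>v w"
      have w'W: "w' \<in> W" unfolding w'_def by (intro W(3) W(4) inv t(1) less.prems(1))
      have w'i: "w' $ a = (\<rho> t $$ (a, a) - \<rho> t $$ (j, j)) * w $ a" if a: "a < n" for a
      proof -
        have "(\<rho> t *\<^sub>v w) $ a = (\<Sum>b<n. \<rho> t $$ (a, b) * w $ b)"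
          using R wc a by (simp add: scalar_prod_def atLeast0LessThan)
        also have "\<dots> = (\<Sum>b<n. if b = a then \<rho> t $$ (a, a) * w $ a else 0)"
          by (intro sum.cong refl) (use t(2) a in auto)
        also have "\<dots> = \<rho> t $$ (a, a) * w $ a" using a by simp
        finally show ?thesis using R wc a by (simp add: w'_def left_diff_distrib)
      qed
      show ?thesis
      proof (rule less.hyps[OF _ w'W less.prems(2)])
        have "w' $ j = 0" using w'i[OF j(1)] by simp
        moreover have "w $ b \<noteq> 0" if "b < n" "w' $ b \<noteq> 0" for b using w'i[OF that(1)] that(2) by force
        ultimately have "{b. b < n \<and> w' $ b \<noteq> 0} \<subset> {b. b < n \<and> w $ b \<noteq> 0}"
          using j by blast
        then show "card {b. b < n \<and> w' $ b \<noteq> 0} < card {b. b < n \<and> w $ b \<noteq> 0}"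
          by (intro psubset_card_mono) auto
        show "w' $ i \<noteq> 0" using w'i[OF less.prems(2)] t(3) less.prems(3) by simp
      qed
    qed
  qed
  have move: "unit_vec n a \<in> W" if b: "unit_vec n b \<in> W" "a < n" "b < n" "g \<in> carrier K" "\<rho> g $$ (a, b) \<noteq> 0" for a b g
  proof (rule isolate[OF inv[OF b(4,1)] b(2)])
    show "(\<rho> g *\<^sub>v unit_vec n b) $ a \<noteq> 0"
      using unitary_repD(2)[OF rep b(4)] b(2,3,5) by (simp add: scalar_prod_right_unit)
  qed
  show "W = {0\<^sub>v n} \<or> W = carrier_vec n"
  proof (cases "W \<subseteq> {0\<^sub>v n}")
    case True
    then show ?thesis using W(2) by blast
  next
    case False
    then obtain w where w: "w \<in> W" "w \<noteq> 0\<^sub>v n" by blast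
    then obtain i where i: "i < n" "w $ i \<noteq> 0"
      using W(1) by (metis carrier_vecD eq_vecI index_zero_vec(1,2) subsetD)
    have "unit_vec n i \<in> W" by (rule isolate[OF w(1) i])
    moreover obtain g where "g \<in> carrier K" "\<rho> g $$ (p, i) \<noteq> 0" using pi[OF i(1)] by blast
    ultimately have pW: "unit_vec n p \<in> W" using move p i(1) by blast
    have all: "unit_vec n a \<in> W" if "a < n" for a
      using ip[OF that] move[OF pW that p] by blast
    have "v \<in> W" if v: "v \<in> carrier_vec n" for v
    proof -
      have "k \<le> n \<Longrightarrow> Matrix.vec n (\<lambda>a. if a < k then v $ a else 0) \<in> W" for k
      proof (induction k)
        case 0
        have "Matrix.vec n (\<lambda>a. if a < 0 then v $ a else 0) = 0\<^sub>v n" by (intro eq_vecI) auto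
        then show ?case using W(2) by simp
      next
        case (Suc k)
        have "Matrix.vec n (\<lambda>a. if a < Suc k then v $ a else 0) =
            Matrix.vec n (\<lambda>a. if a < k then v $ a else 0) + (v $ k) \<cdot>\<^sub>v unit_vec n k"
          using Suc.prems by (intro eq_vecI) (auto simp: unit_vec_def less_Suc_eq)
        then show ?case using Suc all[of k] by (auto intro: W(3,4))
      qed
      from this[of n] have "Matrix.vec n (\<lambda>a. if a < n then v $ a else 0) \<in> W" by simp
      also have "Matrix.vec n (\<lambda>a. if a < n then v $ a else 0) = v"
        using v by (intro eq_vecI) auto
      finally show ?thesis .
    qed
    then show ?thesis using W(1) by blast
  qed
qed

text \<open>The Kronecker product: a pair of indices \<open>(a, b)\<close> is coded as the number
  \<open>a * m + b\<close>. Each factor has its own group, so this is a representation of the direct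
  product.\<close>

definition tensor_rep :: "nat \<Rightarrow> nat \<Rightarrow> ('g \<Rightarrow> complex mat) \<Rightarrow> ('h \<Rightarrow> complex mat) \<Rightarrow> 'g \<times> 'h \<Rightarrow> complex mat" where
  "tensor_rep n m \<rho> \<pi> = (\<lambda>(g, h). Matrix.mat (n * m) (n * m)
     (\<lambda>(i, j). \<rho> g $$ (i div m, j div m) * \<pi> h $$ (i mod m, j mod m)))"

lemma sum_div_mod:
  fixes f :: "nat \<Rightarrow> nat \<Rightarrow> 'a::comm_monoid_add"
  assumes "m > 0"
  shows "(\<Sum>k<n * m. f (k div m) (k mod m)) = (\<Sum>a<n. \<Sum>b<m. f a b)"
proof -
  have "(\<Sum>a<n. \<Sum>b<m. f a b) = (\<Sum>(a, b)\<in>{..<n} \<times> {..<m}. f a b)"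
    by (simp add: sum.cartesian_product)
  also have "\<dots> = (\<Sum>k<n * m. f (k div m) (k mod m))"
  proof (rule sum.reindex_bij_witness[of _ "\<lambda>k. (k div m, k mod m)" "\<lambda>(a, b). a * m + b"])
    fix p assume "p \<in> {..<n} \<times> {..<m}"
    then obtain a b where p: "p = (a, b)" "a < n" "b < m" by auto
    have "a * m + b < Suc a * m" using p(3) by simp
    also have "\<dots> \<le> n * m" using p(2) by (intro mult_le_mono1) simp
    finally show "(case p of (a, b) \<Rightarrow> a * m + b) \<in> {..<n * m}" by (simp add: p(1))
  qed (use assms in \<open>auto simp: less_mult_imp_div_less\<close>)
  finally show ?thesis ..
qed

lemma div_mod_less: "i < n * m \<Longrightarrow> i div m < n" "i < n * m \<Longrightarrow> i mod m < m" for i n m :: nat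
  by (auto simp: less_mult_imp_div_less intro!: mod_less_divisor Nat.gr0I)

lemma div_mod_eq_iff: "i div m = j div m \<and> i mod m = j mod m \<longleftrightarrow> i = j" for i j m :: nat
  by (metis div_mult_mod_eq)

lemma unitary_groupI:
  assumes U: "U \<in> carrier_mat n n"
    and r: "\<And>i j. i < n \<Longrightarrow> j < n \<Longrightarrow> (\<Sum>k<n. U $$ (i, k) * cnj (U $$ (j, k))) = (if i = j then 1 else 0)"
  shows "U \<in> carrier (unitary_group n)"
proof -
  have "U * mat_adjoint U = 1\<^sub>m n"
  proof (rule eq_matI)
    fix i j assume "i < dim_row (1\<^sub>m n :: complex mat)" "j < dim_col (1\<^sub>m n :: complex mat)"
    then have "i < n" "j < n" by auto
    then show "(U * mat_adjoint U) $$ (i, j) = 1\<^sub>m n $$ (i, j)"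
      using U mat_adjoint_carrier[OF U] r[of i j]
      by (simp add: scalar_prod_def mat_adjoint_index[OF U] atLeast0LessThan)
  qed (use U mat_adjoint_carrier[OF U] in auto)
  then show ?thesis using U by (simp add: unitary_group_def)
qed

lemma unitary_repI:
  assumes "\<And>g. g \<in> carrier K \<Longrightarrow> \<rho> g \<in> carrier (unitary_group n)"
    "\<And>g h. g \<in> carrier K \<Longrightarrow> h \<in> carrier K \<Longrightarrow> \<rho> (g \<otimes>\<^bsub>K\<^esub> h) = \<rho> g * \<rho> h"
    "\<And>i j. i < n \<Longrightarrow> j < n \<Longrightarrow> continuous_on (carrier K) (\<lambda>g. \<rho> g $$ (i, j))"
  shows "unitary_rep K n \<rho>"
  using assms unfolding unitary_rep_def hom_def by (auto simp: unitary_group_def)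

lemma tensor_rep_index:
  "i < n * m \<Longrightarrow> j < n * m \<Longrightarrow>
    tensor_rep n m \<rho> \<pi> (g, h) $$ (i, j) = \<rho> g $$ (i div m, j div m) * \<pi> h $$ (i mod m, j mod m)"
  by (simp add: tensor_rep_def)

lemma tensor_rep_unitary:
  assumes \<rho>: "unitary_rep G n \<rho>" and \<pi>: "unitary_rep H m \<pi>" and m: "m > 0"
  shows "unitary_rep (G \<times>\<times> H) (n * m) (tensor_rep n m \<rho> \<pi>)"
proof (rule unitary_repI)
  fix x assume "x \<in> carrier (G \<times>\<times> H)"
  then obtain g h where x: "x = (g, h)" "g \<in> carrier G" "h \<in> carrier H" by auto
  show "tensor_rep n m \<rho> \<pi> x \<in> carrier (unitary_group (n * m))"
  proof (rule unitary_groupI)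
    fix i j assume ij: "i < n * m" "j < n * m"
    have "(\<Sum>k<n * m. tensor_rep n m \<rho> \<pi> x $$ (i, k) * cnj (tensor_rep n m \<rho> \<pi> x $$ (j, k))) =
        (\<Sum>k<n * m. (\<rho> g $$ (i div m, k div m) * cnj (\<rho> g $$ (j div m, k div m))) *
           (\<pi> h $$ (i mod m, k mod m) * cnj (\<pi> h $$ (j mod m, k mod m))))"
    proof (rule sum.cong[OF refl])
      fix k assume "k \<in> {..<n * m}"
      then have k: "k < n * m" by simp
      show "tensor_rep n m \<rho> \<pi> x $$ (i, k) * cnj (tensor_rep n m \<rho> \<pi> x $$ (j, k)) =
          (\<rho> g $$ (i div m, k div m) * cnj (\<rho> g $$ (j div m, k div m))) *
           (\<pi> h $$ (i mod m, k mod m) * cnj (\<pi> h $$ (j mod m, k mod m)))"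
        unfolding x(1) tensor_rep_index[OF ij(1) k] tensor_rep_index[OF ij(2) k] by (simp add: mult_ac)
    qed
    also have "\<dots> = (\<Sum>a<n. \<rho> g $$ (i div m, a) * cnj (\<rho> g $$ (j div m, a))) *
        (\<Sum>b<m. \<pi> h $$ (i mod m, b) * cnj (\<pi> h $$ (j mod m, b)))"
      by (subst sum_div_mod[OF m]) (simp add: sum_product)
    also have "\<dots> = (if i = j then 1 else 0)"
      using unitary_rows[OF unitary_repD(1)[OF \<rho> x(2)] div_mod_less(1)[OF ij(1)] div_mod_less(1)[OF ij(2)]]
        unitary_rows[OF unitary_repD(1)[OF \<pi> x(3)] div_mod_less(2)[OF ij(1)] div_mod_less(2)[OF ij(2)]]
        div_mod_eq_iff[of i m j]
      by auto
    finally show "(\<Sum>k<n * m. tensor_rep n m \<rho> \<pi> x $$ (i, k) * cnj (tensor_rep n m \<rho> \<pi> x $$ (j, k))) =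
        (if i = j then 1 else 0)" .
  qed (simp add: x tensor_rep_def)
  fix y assume "y \<in> carrier (G \<times>\<times> H)"
  then obtain g' h' where y: "y = (g', h')" "g' \<in> carrier G" "h' \<in> carrier H" by auto
  show "tensor_rep n m \<rho> \<pi> (x \<otimes>\<^bsub>G \<times>\<times> H\<^esub> y) = tensor_rep n m \<rho> \<pi> x * tensor_rep n m \<rho> \<pi> y"
  proof (rule eq_matI)
    fix i j assume "i < dim_row (tensor_rep n m \<rho> \<pi> x * tensor_rep n m \<rho> \<pi> y)"
      "j < dim_col (tensor_rep n m \<rho> \<pi> x * tensor_rep n m \<rho> \<pi> y)"
    then have ij: "i < n * m" "j < n * m" by (auto simp: x y tensor_rep_def)
    have "(tensor_rep n m \<rho> \<pi> x * tensor_rep n m \<rho> \<pi> y) $$ (i, j) =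
        (\<Sum>k<n * m. (\<rho> g $$ (i div m, k div m) * \<rho> g' $$ (k div m, j div m)) *
           (\<pi> h $$ (i mod m, k mod m) * \<pi> h' $$ (k mod m, j mod m)))"
      using ij by (simp add: x y tensor_rep_def scalar_prod_def atLeast0LessThan mult_ac)
    also have "\<dots> = (\<Sum>a<n. \<rho> g $$ (i div m, a) * \<rho> g' $$ (a, j div m)) *
        (\<Sum>b<m. \<pi> h $$ (i mod m, b) * \<pi> h' $$ (b, j mod m))"
      by (subst sum_div_mod[OF m]) (simp add: sum_product)
    also have "\<dots> = tensor_rep n m \<rho> \<pi> (x \<otimes>\<^bsub>G \<times>\<times> H\<^esub> y) $$ (i, j)"
      using unitary_rep_mult_index[OF \<rho> x(2) y(2) div_mod_less(1)[OF ij(1)] div_mod_less(1)[OF ij(2)]]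
        unitary_rep_mult_index[OF \<pi> x(3) y(3) div_mod_less(2)[OF ij(1)] div_mod_less(2)[OF ij(2)]] ij
      by (simp add: x y tensor_rep_index)
    finally show "tensor_rep n m \<rho> \<pi> (x \<otimes>\<^bsub>G \<times>\<times> H\<^esub> y) $$ (i, j) =
        (tensor_rep n m \<rho> \<pi> x * tensor_rep n m \<rho> \<pi> y) $$ (i, j)" ..
  qed (auto simp: x y tensor_rep_def)
next
  fix i j assume ij: "i < n * m" "j < n * m"
  note d = div_mod_less[OF ij(1)] div_mod_less[OF ij(2)]
  have "continuous_on (carrier G \<times> carrier H) (\<lambda>x. \<rho> (fst x) $$ (i div m, j div m))"
    by (rule continuous_on_compose2[OF unitary_repD(4)[OF \<rho> d(1,3)] continuous_on_fst[OF continuous_on_id]]) auto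
  moreover have "continuous_on (carrier G \<times> carrier H) (\<lambda>x. \<pi> (snd x) $$ (i mod m, j mod m))"
    by (rule continuous_on_compose2[OF unitary_repD(4)[OF \<pi> d(2,4)] continuous_on_snd[OF continuous_on_id]]) auto
  ultimately have "continuous_on (carrier G \<times> carrier H)
      (\<lambda>x. \<rho> (fst x) $$ (i div m, j div m) * \<pi> (snd x) $$ (i mod m, j mod m))"
    by (rule continuous_on_mult)
  then show "continuous_on (carrier (G \<times>\<times> H)) (\<lambda>g. tensor_rep n m \<rho> \<pi> g $$ (i, j))"
    using ij by (simp add: tensor_rep_def case_prod_unfold)
qed

lemma trace_char_tensor:
  assumes "m > 0"
  shows "trace_char (n * m) (tensor_rep n m \<rho> \<pi>) (g, h) = trace_char n \<rho> g * trace_char m \<pi> h"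
  unfolding trace_char_def sum_product using sum_div_mod[OF assms, of "\<lambda>a b. \<rho> g $$ (a, a) * \<pi> h $$ (b, b)" n]
  by (simp add: tensor_rep_index)

text \<open>Different indices differ in one of their two coordinates. A separating element for that
  factor, paired with the identity of the other group, acts diagonally and separates them. Entries
  linking to the two base indices multiply to nonzero entries linking to
  \<open>p * m + q\<close>.\<close>

lemma tensor_weight_rep:
  assumes G: "group G" and H: "group H" and \<rho>: "weight_rep G n \<rho>" and \<pi>: "weight_rep H m \<pi>"
  shows "weight_rep (G \<times>\<times> H) (n * m) (tensor_rep n m \<rho> \<pi>)"
  unfolding weight_rep_def
proof (intro conjI allI impI)
  have r: "unitary_rep G n \<rho>" "unitary_rep H m \<pi>" using \<rho> \<pi> by (auto simp: weight_rep_def)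
  obtain p where p: "p < n" "\<And>i. i < n \<Longrightarrow> \<exists>g\<in>carrier G. \<rho> g $$ (p, i) \<noteq> 0" "\<And>i. i < n \<Longrightarrow> \<exists>g\<in>carrier G. \<rho> g $$ (i, p) \<noteq> 0"
    using \<rho> unfolding weight_rep_def by blast
  obtain q where q: "q < m" "\<And>i. i < m \<Longrightarrow> \<exists>g\<in>carrier H. \<pi> g $$ (q, i) \<noteq> 0" "\<And>i. i < m \<Longrightarrow> \<exists>g\<in>carrier H. \<pi> g $$ (i, q) \<noteq> 0"
    using \<pi> unfolding weight_rep_def by blast
  have m: "m > 0" using q(1) by simp
  show "unitary_rep (G \<times>\<times> H) (n * m) (tensor_rep n m \<rho> \<pi>)" by (rule tensor_rep_unitary[OF r m])
  have one: "\<rho> \<one>\<^bsub>G\<^esub> = 1\<^sub>m n" "\<pi> \<one>\<^bsub>H\<^esub> = 1\<^sub>m m"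
  proof -
    have *: "\<sigma> \<one>\<^bsub>K\<^esub> = 1\<^sub>m k" if K: "group K" and s: "unitary_rep K k \<sigma>" for K :: "('x::topological_space) monoid" and k \<sigma>
    proof -
      interpret K: group K by fact
      note U = unitary_groupD[OF unitary_repD(1)[OF s K.one_closed]]
      have "\<sigma> \<one>\<^bsub>K\<^esub> * \<sigma> \<one>\<^bsub>K\<^esub> = \<sigma> \<one>\<^bsub>K\<^esub>" using unitary_repD(3)[OF s K.one_closed K.one_closed] by simp
      then have "mat_adjoint (\<sigma> \<one>\<^bsub>K\<^esub>) * (\<sigma> \<one>\<^bsub>K\<^esub> * \<sigma> \<one>\<^bsub>K\<^esub>) = 1\<^sub>m k" using U by simp
      then show ?thesis using U assoc_mult_mat[OF U(2,1,1)] by simp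
    qed
    show "\<rho> \<one>\<^bsub>G\<^esub> = 1\<^sub>m n" "\<pi> \<one>\<^bsub>H\<^esub> = 1\<^sub>m m" using *[OF G r(1)] *[OF H r(2)] .
  qed
  have oneG: "\<one>\<^bsub>G\<^esub> \<in> carrier G" "\<one>\<^bsub>H\<^esub> \<in> carrier H" using G H by (auto intro: group.is_monoid monoid.one_closed)
  {
    fix i j assume ij: "i < n * m" "j < n * m" "i \<noteq> j"
    note d = div_mod_less[OF ij(1)] div_mod_less[OF ij(2)]
    have abd: "a div m \<noteq> b div m \<or> a mod m \<noteq> b mod m" if "a \<noteq> b" for a b
      using div_mod_eq_iff[of a m b] that by blast
    show "\<exists>t\<in>carrier (G \<times>\<times> H). (\<forall>a<n * m. \<forall>b<n * m. a \<noteq> b \<longrightarrow> tensor_rep n m \<rho> \<pi> t $$ (a, b) = 0) \<and>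
        tensor_rep n m \<rho> \<pi> t $$ (i, i) \<noteq> tensor_rep n m \<rho> \<pi> t $$ (j, j)"
    proof (cases "i div m = j div m")
      case False
      obtain t where t: "t \<in> carrier G" "\<And>a b. a < n \<Longrightarrow> b < n \<Longrightarrow> a \<noteq> b \<Longrightarrow> \<rho> t $$ (a, b) = 0"
        "\<rho> t $$ (i div m, i div m) \<noteq> \<rho> t $$ (j div m, j div m)"
        using weight_rep_separates[OF \<rho> d(1,3) False] by blast
      show ?thesis
      proof (intro bexI[of _ "(t, \<one>\<^bsub>H\<^esub>)"] conjI allI impI)
        show "tensor_rep n m \<rho> \<pi> (t, \<one>\<^bsub>H\<^esub>) $$ (i, i) \<noteq> tensor_rep n m \<rho> \<pi> (t, \<one>\<^bsub>H\<^esub>) $$ (j, j)"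
          using ij d t(3) by (simp add: tensor_rep_index one)
        fix a b assume "a < n * m" "b < n * m" "a \<noteq> b"
        then show "tensor_rep n m \<rho> \<pi> (t, \<one>\<^bsub>H\<^esub>) $$ (a, b) = 0"
          using abd[of a b] div_mod_less[of a n m] div_mod_less[of b n m] t(2) by (auto simp: tensor_rep_index one)
      qed (use t oneG in auto)
    next
      case True
      then have ne: "i mod m \<noteq> j mod m" using abd[OF ij(3)] by blast
      obtain t where t: "t \<in> carrier H" "\<And>a b. a < m \<Longrightarrow> b < m \<Longrightarrow> a \<noteq> b \<Longrightarrow> \<pi> t $$ (a, b) = 0"
        "\<pi> t $$ (i mod m, i mod m) \<noteq> \<pi> t $$ (j mod m, j mod m)"
        using weight_rep_separates[OF \<pi> d(2,4) ne] by blast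
      show ?thesis
      proof (intro bexI[of _ "(\<one>\<^bsub>G\<^esub>, t)"] conjI allI impI)
        show "tensor_rep n m \<rho> \<pi> (\<one>\<^bsub>G\<^esub>, t) $$ (i, i) \<noteq> tensor_rep n m \<rho> \<pi> (\<one>\<^bsub>G\<^esub>, t) $$ (j, j)"
          using ij d t(3) by (simp add: tensor_rep_index one)
        fix a b assume "a < n * m" "b < n * m" "a \<noteq> b"
        then show "tensor_rep n m \<rho> \<pi> (\<one>\<^bsub>G\<^esub>, t) $$ (a, b) = 0"
          using abd[of a b] div_mod_less[of a n m] div_mod_less[of b n m] t(2) by (auto simp: tensor_rep_index one)
      qed (use t oneG in auto)
    qed
  }
  have pq: "p * m + q < n * m"
  proof -
    have "p * m + q < Suc p * m" using q(1) by simp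
    also have "\<dots> \<le> n * m" using p(1) by (intro mult_le_mono1) simp
    finally show ?thesis .
  qed
  have pqd: "(p * m + q) div m = p" "(p * m + q) mod m = q" using q(1) by auto
  show "\<exists>s<n * m. \<forall>i<n * m. (\<exists>g\<in>carrier (G \<times>\<times> H). tensor_rep n m \<rho> \<pi> g $$ (s, i) \<noteq> 0) \<and>
      (\<exists>g\<in>carrier (G \<times>\<times> H). tensor_rep n m \<rho> \<pi> g $$ (i, s) \<noteq> 0)"
  proof (intro exI[of _ "p * m + q"] conjI allI impI pq)
    fix i assume i: "i < n * m"
    note d = div_mod_less[OF i]
    obtain g h where "g \<in> carrier G" "\<rho> g $$ (p, i div m) \<noteq> 0" "h \<in> carrier H" "\<pi> h $$ (q, i mod m) \<noteq> 0"
      using p(2)[OF d(1)] q(2)[OF d(2)] by blast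
    then show "\<exists>g\<in>carrier (G \<times>\<times> H). tensor_rep n m \<rho> \<pi> g $$ (p * m + q, i) \<noteq> 0"
      using i pq q(1) by (intro bexI[of _ "(g, h)"]) (auto simp: tensor_rep_index pqd)
    obtain g h where "g \<in> carrier G" "\<rho> g $$ (i div m, p) \<noteq> 0" "h \<in> carrier H" "\<pi> h $$ (i mod m, q) \<noteq> 0"
      using p(3)[OF d(1)] q(3)[OF d(2)] by blast
    then show "\<exists>g\<in>carrier (G \<times>\<times> H). tensor_rep n m \<rho> \<pi> g $$ (i, p * m + q) \<noteq> 0"
      using i pq q(1) by (intro bexI[of _ "(g, h)"]) (auto simp: tensor_rep_index pqd)
  qed
qed

section \<open>Haar measure on a direct product\<close>

lemma sets_pair_restrict_borel:
  fixes A :: "'a::second_countable_topology set" and B :: "'b::second_countable_topology set"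
  shows "sets (restrict_space borel A \<Otimes>\<^sub>M restrict_space borel B) = sets (restrict_space borel (A \<times> B))"
proof
  show "sets (restrict_space borel A \<Otimes>\<^sub>M restrict_space borel B) \<subseteq> sets (restrict_space borel (A \<times> B))"
  proof (rule sets_pair_in_sets)
    fix a b assume "a \<in> sets (restrict_space borel A)" "b \<in> sets (restrict_space borel B)"
    then obtain a' b' where ab: "a = A \<inter> a'" "a' \<in> sets borel" "b = B \<inter> b'" "b' \<in> sets borel"
      by (auto simp: sets_restrict_space)
    have "a' \<times> b' \<in> sets (borel \<Otimes>\<^sub>M borel)" using ab by auto
    then have "a' \<times> b' \<in> sets borel" unfolding borel_prod .
    moreover have "a \<times> b = (A \<times> B) \<inter> (a' \<times> b')" using ab by auto
    ultimately show "a \<times> b \<in> sets (restrict_space borel (A \<times> B))"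
      by (auto simp: sets_restrict_space)
  qed
  show "sets (restrict_space borel (A \<times> B)) \<subseteq> sets (restrict_space borel A \<Otimes>\<^sub>M restrict_space borel B)"
  proof
    fix S assume "S \<in> sets (restrict_space borel (A \<times> B))"
    then obtain S' where S: "S = (A \<times> B) \<inter> S'" "S' \<in> sets borel"
      unfolding sets_restrict_space by blast
    from S(2) have S2: "S' \<in> sets (borel \<Otimes>\<^sub>M borel)" unfolding borel_prod .
    have "(\<lambda>x. (fst x, snd x)) \<in> measurable (restrict_space borel A \<Otimes>\<^sub>M restrict_space borel B) (borel \<Otimes>\<^sub>M borel)"
      by (intro measurable_Pair measurable_compose[OF measurable_fst] measurable_compose[OF measurable_snd]
          measurable_restrict_space1) auto
    from measurable_sets[OF this S2]
    have "(\<lambda>x. (fst x, snd x)) -` S' \<inter> (A \<times> B) \<in> sets (restrict_space borel A \<Otimes>\<^sub>M restrict_space borel B)"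
      by (simp add: space_pair_measure space_restrict_space)
    then show "S \<in> sets (restrict_space borel A \<Otimes>\<^sub>M restrict_space borel B)"
      using S(1) by (simp add: Int_commute)
  qed
qed

text \<open>A left translation of the direct product is a product of left translations, so its
  push-forward can be computed factor by factor. Second countability identifies the product
  sigma-algebra with the Borel one.\<close>

lemma haar_group_DirProd:
  fixes G :: "('g::second_countable_topology) monoid" and H :: "('h::second_countable_topology) monoid"
  assumes "haar_group G \<mu>" "haar_group H \<nu>"
  shows "haar_group (G \<times>\<times> H) (\<mu> \<Otimes>\<^sub>M \<nu>)"
proof -
  interpret G: haar_group G \<mu> by fact
  interpret H: haar_group H \<nu> by fact
  interpret P: pair_prob_space \<mu> \<nu> ..
  have meas: "(\<lambda>x. g \<otimes>\<^bsub>K\<^esub> x) \<in> measurable \<kappa> \<kappa>" if "haar_group K \<kappa>" "g \<in> carrier K"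
    for K :: "('x::second_countable_topology) monoid" and \<kappa> g
  proof -
    interpret K: haar_group K \<kappa> by fact
    have "(\<lambda>x. g \<otimes>\<^bsub>K\<^esub> x) \<in> measurable \<kappa> borel"
      by (rule K.continuous_imp_measurable[OF K.continuous_left_mult[OF that(2)]])
    then have "(\<lambda>x. g \<otimes>\<^bsub>K\<^esub> x) \<in> measurable \<kappa> (restrict_space borel (carrier K))"
      by (rule measurable_restrict_space2[rotated]) (use that(2) in \<open>auto simp: K.space_haar\<close>)
    then show ?thesis by (simp add: measurable_cong_sets[OF refl K.sets_haar])
  qed
  show ?thesis
  proof (intro haar_group.intro haar_group_axioms.intro)
    show "group (G \<times>\<times> H)" by (rule DirProd_group) unfold_locales
    show "normalized_haar_measure (G \<times>\<times> H) (\<mu> \<Otimes>\<^sub>M \<nu>)"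
      unfolding normalized_haar_measure_def
    proof (intro conjI ballI)
      show "prob_space (\<mu> \<Otimes>\<^sub>M \<nu>)" by (rule P.prob_space_axioms)
      show "space (\<mu> \<Otimes>\<^sub>M \<nu>) = carrier (G \<times>\<times> H)" by (simp add: space_pair_measure G.space_haar H.space_haar)
      show "sets (\<mu> \<Otimes>\<^sub>M \<nu>) = sets (restrict_space borel (carrier (G \<times>\<times> H)))"
        unfolding carrier_DirProd sets_pair_restrict_borel[symmetric]
        by (rule sets_pair_measure_cong[OF G.sets_haar H.sets_haar])
      fix x assume "x \<in> carrier (G \<times>\<times> H)"
      then obtain g h where x: "x = (g, h)" "g \<in> carrier G" "h \<in> carrier H" by auto
      have "distr \<mu> \<mu> (\<lambda>y. g \<otimes>\<^bsub>G\<^esub> y) \<Otimes>\<^sub>M distr \<nu> \<nu> (\<lambda>y. h \<otimes>\<^bsub>H\<^esub> y) =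
          distr (\<mu> \<Otimes>\<^sub>M \<nu>) (\<mu> \<Otimes>\<^sub>M \<nu>) (\<lambda>(y, z). (g \<otimes>\<^bsub>G\<^esub> y, h \<otimes>\<^bsub>H\<^esub> z))"
        by (intro pair_measure_distr meas G.haar_group_axioms H.haar_group_axioms x)
           (simp add: H.distr_haar x H.sigma_finite_measure_axioms)
      also have "(\<lambda>(y, z). (g \<otimes>\<^bsub>G\<^esub> y, h \<otimes>\<^bsub>H\<^esub> z)) = (\<lambda>y. x \<otimes>\<^bsub>G \<times>\<times> H\<^esub> y)"
        by (auto simp: x(1) fun_eq_iff)
      finally show "distr (\<mu> \<Otimes>\<^sub>M \<nu>) (\<mu> \<Otimes>\<^sub>M \<nu>) (\<lambda>y. x \<otimes>\<^bsub>G \<times>\<times> H\<^esub> y) = \<mu> \<Otimes>\<^sub>M \<nu>"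
        by (simp add: G.distr_haar H.distr_haar x)
    qed
    fix x assume "x \<in> carrier (G \<times>\<times> H)"
    then obtain g h where x: "x = (g, h)" "g \<in> carrier G" "h \<in> carrier H" by auto
    have "continuous_on (carrier G \<times> carrier H) (\<lambda>y. g \<otimes>\<^bsub>G\<^esub> fst y)"
      by (rule continuous_on_compose2[OF G.continuous_left_mult[OF x(2)] continuous_on_fst[OF continuous_on_id]]) auto
    moreover have "continuous_on (carrier G \<times> carrier H) (\<lambda>y. h \<otimes>\<^bsub>H\<^esub> snd y)"
      by (rule continuous_on_compose2[OF H.continuous_left_mult[OF x(3)] continuous_on_snd[OF continuous_on_id]]) auto
    ultimately have "continuous_on (carrier G \<times> carrier H) (\<lambda>y. (g \<otimes>\<^bsub>G\<^esub> fst y, h \<otimes>\<^bsub>H\<^esub> snd y))"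
      by (rule continuous_on_Pair)
    then show "continuous_on (carrier (G \<times>\<times> H)) (\<lambda>y. x \<otimes>\<^bsub>G \<times>\<times> H\<^esub> y)"
      by (simp add: x(1) mult_DirProd')
  qed
qed

section \<open>The symmetric powers\<close>

abbreviation ent :: "'a^'n^'m \<Rightarrow> 'm \<Rightarrow> 'n \<Rightarrow> 'a" where
  "ent A i j \<equiv> vec_nth (vec_nth A i) j"

definition su :: "complex \<Rightarrow> complex \<Rightarrow> complex^2^2" where
  "su a b = (\<chi> i j. if i = 1 then (if j = 1 then a else b) else (if j = 1 then - cnj b else cnj a))"

lemma su_nth [simp]: "ent (su a b) 1 1 = a" "ent (su a b) 1 2 = b" "ent (su a b) 2 1 = - cnj b" "ent (su a b) 2 2 = cnj a"
  by (simp_all add: su_def)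

lemma su_mult: "su a b ** su c d = su (a * c - b * cnj d) (a * d + b * cnj c)"
  by (simp add: Finite_Cartesian_Product.vec_eq_iff forall_2 matrix_matrix_mult_def sum_2 algebra_simps)

lemma su_one: "su 1 0 = Finite_Cartesian_Product.mat 1"
  by (simp add: Finite_Cartesian_Product.vec_eq_iff forall_2 Finite_Cartesian_Product.mat_def)

lemma conj_transpose_nth [simp]: "ent (conj_transpose A) i j = cnj (ent A j i)"
  by (simp add: conj_transpose_def)

lemma conj_transpose_su: "conj_transpose (su a b) = su (cnj a) (- b)"
  by (simp add: Finite_Cartesian_Product.vec_eq_iff forall_2)

lemma SU2_carrier: "carrier SU2 = {su a b |a b. a * cnj a + b * cnj b = 1}"
proof (intro equalityI subsetI)
  fix A assume "A \<in> carrier SU2"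
  then have A: "A ** conj_transpose A = Finite_Cartesian_Product.mat 1" "Determinants.det A = 1"
    by (auto simp: SU2_def)
  define p q r s where "p = ent A 1 1" and "q = ent A 1 2" and "r = ent A 2 1" and "s = ent A 2 2"
  have e: "p * cnj p + q * cnj q = 1" "p * cnj r + q * cnj s = 0" "r * cnj r + s * cnj s = 1"
    using A(1) by (auto simp: Finite_Cartesian_Product.vec_eq_iff forall_2 matrix_matrix_mult_def sum_2 Finite_Cartesian_Product.mat_def p_def q_def r_def s_def)
  have d: "p * s - q * r = 1"
    using A(2) by (simp add: det_2 p_def q_def r_def s_def)
  \<comment> \<open>Multiplying the determinant equation by \<open>cnj s\<close> and using that the
    rows are orthonormal identifies \<open>cnj s\<close> with \<open>p\<close>; the same with
    \<open>cnj r\<close> identifies it with \<open>- q\<close>.\<close>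
  have "cnj s = p * (s * cnj s) - r * (q * cnj s)"
    using arg_cong[OF d, of "\<lambda>z. cnj s * z"] by (simp add: algebra_simps)
  also have "q * cnj s = - (p * cnj r)" using e(2) by (simp add: add_eq_0_iff)
  also have "p * (s * cnj s) - r * - (p * cnj r) = p * (r * cnj r + s * cnj s)" by (simp add: algebra_simps)
  finally have s: "cnj s = p" using e(3) by simp
  have "cnj r = s * (p * cnj r) - q * (r * cnj r)"
    using arg_cong[OF d, of "\<lambda>z. cnj r * z"] by (simp add: algebra_simps)
  also have "p * cnj r = - (q * cnj s)" using e(2) by (simp add: add_eq_0_iff2)
  also have "s * - (q * cnj s) - q * (r * cnj r) = - q * (r * cnj r + s * cnj s)" by (simp add: algebra_simps)
  finally have r: "cnj r = - q" using e(3) by simp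
  have "s = cnj p" "r = - cnj q" using s r by (metis complex_cnj_cnj complex_cnj_minus)+
  then have "A = su p q"
    by (simp add: Finite_Cartesian_Product.vec_eq_iff forall_2 p_def q_def r_def s_def)
  then show "A \<in> {su a b |a b. a * cnj a + b * cnj b = 1}" using e(1) by blast
next
  fix A assume "A \<in> {su a b |a b. a * cnj a + b * cnj b = 1}"
  then obtain a b where A: "A = su a b" "a * cnj a + b * cnj b = 1" by blast
  then show "A \<in> carrier SU2"
    by (simp add: SU2_def conj_transpose_su su_mult su_one[symmetric] det_2 add.commute mult.commute)
qed

lemma su_in_SU2: "a * cnj a + b * cnj b = 1 \<Longrightarrow> su a b \<in> carrier SU2"
  by (auto simp: SU2_carrier)

lemma SU2_mult [simp]: "A \<otimes>\<^bsub>SU2\<^esub> B = A ** B" and SU2_one [simp]: "\<one>\<^bsub>SU2\<^esub> = Finite_Cartesian_Product.mat 1"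
  by (simp_all add: SU2_def)

lemma SU2_conj_transpose: "A \<in> carrier SU2 \<Longrightarrow> conj_transpose A \<in> carrier SU2"
proof -
  assume "A \<in> carrier SU2"
  then obtain a b where "A = su a b" "a * cnj a + b * cnj b = 1" by (auto simp: SU2_carrier)
  then show ?thesis using su_in_SU2[of "cnj a" "- b"] by (simp add: conj_transpose_su mult.commute)
qed

lemma group_SU2: "group SU2"
proof (rule groupI)
  fix A B assume "A \<in> carrier SU2" "B \<in> carrier SU2"
  then obtain a b c d where AB: "A = su a b" "a * cnj a + b * cnj b = 1" "B = su c d" "c * cnj c + d * cnj d = 1"
    by (auto simp: SU2_carrier)
  have "(a * c - b * cnj d) * cnj (a * c - b * cnj d) + (a * d + b * cnj c) * cnj (a * d + b * cnj c) =
      (a * cnj a + b * cnj b) * (c * cnj c + d * cnj d)"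
    by (simp add: algebra_simps)
  then show "A \<otimes>\<^bsub>SU2\<^esub> B \<in> carrier SU2"
    unfolding AB(1,3) SU2_mult su_mult using AB(2,4) by (intro su_in_SU2) simp
next
  show "\<one>\<^bsub>SU2\<^esub> \<in> carrier SU2" using su_in_SU2[of 1 0] by (simp add: su_one)
next
  fix A assume A: "A \<in> carrier SU2"
  then obtain a b where ab: "A = su a b" "a * cnj a + b * cnj b = 1" by (auto simp: SU2_carrier)
  have "conj_transpose A ** A = Finite_Cartesian_Product.mat 1"
    using ab(2) unfolding ab(1) conj_transpose_su su_mult su_one[symmetric] by (simp add: mult.commute)
  then show "\<exists>B\<in>carrier SU2. B \<otimes>\<^bsub>SU2\<^esub> A = \<one>\<^bsub>SU2\<^esub>" using SU2_conj_transpose[OF A] by auto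
qed (auto simp: matrix_mul_assoc)

lemma continuous_on_entry: "continuous_on S (\<lambda>A :: complex^'n^'m. vec_nth (vec_nth A i) j)"
  by (intro continuous_intros continuous_on_component)

lemma continuous_on_matrix_left_mult: "continuous_on S (\<lambda>B. (A :: complex^2^2) ** B)"
  unfolding matrix_matrix_mult_def
  by (intro continuous_on_vec_lambda continuous_intros continuous_on_entry)

lemma haar_group_SU2: "normalized_haar_measure SU2 \<mu> \<Longrightarrow> haar_group SU2 \<mu>"
  by (intro haar_group.intro haar_group_axioms.intro group_SU2) (auto intro: continuous_on_matrix_left_mult)

text \<open>
  \<open>sym_coeff n A i j\<close> is the matrix of the substitution \<open>z \<mapsto> A z\<close> on the monomials
  \<open>z\<^sub>1\<^sup>n\<^sup>-\<^sup>i z\<^sub>2\<^sup>i\<close> of degree \<open>n\<close>, read off after dehomogenizing.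
\<close>

definition sym_coeff :: "nat \<Rightarrow> complex^2^2 \<Rightarrow> nat \<Rightarrow> nat \<Rightarrow> complex" where
  "sym_coeff n A i j = coeff ([:ent A 1 1, ent A 1 2:] ^ (n - i) * [:ent A 2 1, ent A 2 2:] ^ i) j"

text \<open>The homogenization of \<open>p\<close> in degree \<open>n\<close>, evaluated at
  \<open>(z, w)\<close>.\<close>

definition hom_eval :: "nat \<Rightarrow> complex poly \<Rightarrow> complex \<Rightarrow> complex \<Rightarrow> complex" where
  "hom_eval n p z w = (\<Sum>j\<le>n. coeff p j * z ^ (n - j) * w ^ j)"

lemma hom_step:
  fixes p :: "complex poly"
  assumes "degree p \<le> n"
  shows "hom_eval (Suc n) ([:a, b:] * p) z w = (a * z + b * w) * hom_eval n p z w"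
proof -
  have p0: "coeff p (Suc n) = 0" using assms by (simp add: coeff_eq_0)
  have "(\<Sum>j\<le>Suc n. coeff ([:a, b:] * p) j * z ^ (Suc n - j) * w ^ j) =
      (\<Sum>j\<le>Suc n. a * coeff p j * z ^ (Suc n - j) * w ^ j) +
      (\<Sum>j\<le>Suc n. coeff (pCons 0 (Polynomial.smult b p)) j * z ^ (Suc n - j) * w ^ j)"
    unfolding sum.distrib[symmetric] by (intro sum.cong refl) (simp add: distrib_right)
  also have "(\<Sum>j\<le>Suc n. a * coeff p j * z ^ (Suc n - j) * w ^ j) = (\<Sum>j\<le>n. a * coeff p j * z ^ (Suc n - j) * w ^ j)"
    by (simp add: p0)
  also have "\<dots> = a * z * (\<Sum>j\<le>n. coeff p j * z ^ (n - j) * w ^ j)"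
    by (auto simp: sum_distrib_left Suc_diff_le mult_ac intro!: sum.cong)
  also have "(\<Sum>j\<le>Suc n. coeff (pCons 0 (Polynomial.smult b p)) j * z ^ (Suc n - j) * w ^ j) =
      b * w * (\<Sum>j\<le>n. coeff p j * z ^ (n - j) * w ^ j)"
    by (subst sum.atMost_Suc_shift) (simp add: sum_distrib_left mult_ac)
  finally show ?thesis by (simp only: hom_eval_def distrib_right)
qed

lemma degree_linear_power: "degree ([:a, b:] ^ k * [:c, d:] ^ l) \<le> k + l" for a b c d :: complex
proof -
  have "degree ([:a, b:] ^ k * [:c, d:] ^ l) \<le> degree ([:a, b:] ^ k) + degree ([:c, d:] ^ l)" by (rule degree_mult_le)
  also have "\<dots> \<le> degree [:a, b:] * k + degree [:c, d:] * l" by (intro add_mono degree_power_le)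
  also have "\<dots> \<le> 1 * k + 1 * l" by (intro add_mono mult_right_mono) auto
  finally show ?thesis by simp
qed

lemma hom_linear_powers:
  "hom_eval (k + l) ([:a, b:] ^ k * [:c, d:] ^ l) z w = (a * z + b * w) ^ k * (c * z + d * w) ^ l"
proof (induction k)
  case 0
  have "hom_eval l ([:c, d:] ^ l) z w = (c * z + d * w) ^ l"
  proof (induction l)
    case 0
    show ?case by (simp add: hom_eval_def)
  next
    case (Suc l)
    have "degree ([:c, d:] ^ l) \<le> l" using degree_linear_power[of 0 0 0 c d l] by simp
    from hom_step[OF this] show ?case by (simp only: power_Suc Suc)
  qed
  then show ?case by simp
next
  case (Suc k)
  from hom_step[OF degree_linear_power] show ?case
    by (simp only: power_Suc add_Suc mult.assoc Suc)
qed

lemma sym_coeff_hom: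
  assumes "i \<le> n"
  shows "(\<Sum>j\<le>n. sym_coeff n A i j * z ^ (n - j) * w ^ j) =
    (ent A 1 1 * z + ent A 1 2 * w) ^ (n - i) * (ent A 2 1 * z + ent A 2 2 * w) ^ i"
  using hom_linear_powers[of "n - i" i "ent A 1 1" "ent A 1 2" "ent A 2 1" "ent A 2 2" z w] assms
  by (simp add: sym_coeff_def hom_eval_def)

lemma sym_coeff_poly:
  assumes "i \<le> n"
  shows "(\<Sum>j\<le>n. sym_coeff n A i j * w ^ j) = (ent A 1 1 + ent A 1 2 * w) ^ (n - i) * (ent A 2 1 + ent A 2 2 * w) ^ i"
  using sym_coeff_hom[OF assms, of A 1 w] by simp

lemma polyfun_coeffs_eq:
  fixes c d :: "nat \<Rightarrow> complex"
  assumes "\<And>x. (\<Sum>i\<le>n. c i * x ^ i) = (\<Sum>i\<le>n. d i * x ^ i)" "i \<le> n"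
  shows "c i = d i"
  using assms polyfun_eq_coeffs[of c n d] by blast

text \<open>Both sides are coefficients of one polynomial, obtained by substituting \<open>A\<close>
  into a monomial and then \<open>B\<close>. The inner substitution yields a general pair
  \<open>(z, w)\<close> instead of \<open>(1, x)\<close>, which is why the homogeneous identity
  \<open>sym_coeff_hom\<close> is needed.\<close>

lemma sym_coeff_mult:
  assumes "i \<le> n" "k \<le> n"
  shows "sym_coeff n (A ** B) i k = (\<Sum>j\<le>n. sym_coeff n A i j * sym_coeff n B j k)"
proof (rule polyfun_coeffs_eq[OF _ assms(2)])
  fix x :: complex
  define z w where "z = ent B 1 1 + ent B 1 2 * x" and "w = ent B 2 1 + ent B 2 2 * x"
  have "(\<Sum>k\<le>n. (\<Sum>j\<le>n. sym_coeff n A i j * sym_coeff n B j k) * x ^ k) =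
      (\<Sum>j\<le>n. sym_coeff n A i j * (\<Sum>k\<le>n. sym_coeff n B j k * x ^ k))"
    by (simp add: sum_distrib_left sum_distrib_right mult.assoc) (rule sum.swap)
  also have "\<dots> = (\<Sum>j\<le>n. sym_coeff n A i j * z ^ (n - j) * w ^ j)"
    by (intro sum.cong refl) (simp add: sym_coeff_poly z_def w_def mult.assoc)
  also have "\<dots> = (ent A 1 1 * z + ent A 1 2 * w) ^ (n - i) * (ent A 2 1 * z + ent A 2 2 * w) ^ i"
    by (rule sym_coeff_hom[OF assms(1)])
  also have "ent A 1 1 * z + ent A 1 2 * w = ent (A ** B) 1 1 + ent (A ** B) 1 2 * x"
    by (simp add: matrix_matrix_mult_def sum_2 z_def w_def algebra_simps)
  also have "ent A 2 1 * z + ent A 2 2 * w = ent (A ** B) 2 1 + ent (A ** B) 2 2 * x"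
    by (simp add: matrix_matrix_mult_def sum_2 z_def w_def algebra_simps)
  finally show "(\<Sum>i'\<le>n. sym_coeff n (A ** B) i i' * x ^ i') =
      (\<Sum>k\<le>n. (\<Sum>j\<le>n. sym_coeff n A i j * sym_coeff n B j k) * x ^ k)"
    by (simp add: sym_coeff_poly[OF assms(1)])
qed

lemma sym_coeff_diag:
  assumes "i \<le> n" "j \<le> n"
  shows "sym_coeff n (su a 0) i j = (if i = j then a ^ (n - i) * cnj a ^ i else 0)"
proof (rule polyfun_coeffs_eq[OF _ assms(2)])
  fix x :: complex
  show "(\<Sum>k\<le>n. sym_coeff n (su a 0) i k * x ^ k) = (\<Sum>k\<le>n. (if i = k then a ^ (n - i) * cnj a ^ i else 0) * x ^ k)"
    using assms(1) by (simp add: sym_coeff_poly power_mult_distrib if_distrib[of "\<lambda>y. y * _"] cong: if_cong)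
qed

lemma sum_sym_coeff_binomial:
  "(\<Sum>i\<le>n. (\<Sum>j\<le>n. of_nat (n choose i) * sym_coeff n A i j * x ^ j) * y ^ i) =
    ((ent A 1 1 + ent A 1 2 * x) + (ent A 2 1 + ent A 2 2 * x) * y) ^ n"
proof -
  have "(\<Sum>i\<le>n. (\<Sum>j\<le>n. of_nat (n choose i) * sym_coeff n A i j * x ^ j) * y ^ i) =
      (\<Sum>i\<le>n. of_nat (n choose i) * (\<Sum>j\<le>n. sym_coeff n A i j * x ^ j) * y ^ i)"
    by (simp add: sum_distrib_left mult.assoc)
  also have "\<dots> = (\<Sum>i\<le>n. of_nat (n choose i) * ((ent A 2 1 + ent A 2 2 * x) * y) ^ i * (ent A 1 1 + ent A 1 2 * x) ^ (n - i))"
  proof (rule sum.cong[OF refl])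
    fix i assume "i \<in> {..n}"
    then have i: "i \<le> n" by simp
    show "of_nat (n choose i) * (\<Sum>j\<le>n. sym_coeff n A i j * x ^ j) * y ^ i =
        of_nat (n choose i) * ((ent A 2 1 + ent A 2 2 * x) * y) ^ i * (ent A 1 1 + ent A 1 2 * x) ^ (n - i)"
      unfolding sym_coeff_poly[OF i] power_mult_distrib by (simp only: mult_ac)
  qed
  also have "\<dots> = ((ent A 2 1 + ent A 2 2 * x) * y + (ent A 1 1 + ent A 1 2 * x)) ^ n"
    by (rule binomial_ring[symmetric])
  finally show ?thesis by (simp add: add.commute)
qed

text \<open>By \<open>sum_sym_coeff_binomial\<close> the generating function in \<open>x\<close> and
  \<open>y\<close> is the power of the bilinear form of \<open>A\<close> at \<open>(1, y)\<close>
  and \<open>(1, x)\<close>. Conjugation replaces \<open>A\<close> by its adjoint and exchanges the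
  two variables, so comparing coefficients gives the relation.\<close>

lemma sym_coeff_conj_transpose:
  assumes "i \<le> n" "j \<le> n"
  shows "of_nat (n choose i) * sym_coeff n (conj_transpose A) i j = of_nat (n choose j) * cnj (sym_coeff n A j i)"
proof -
  have *: "(\<Sum>j\<le>n. of_nat (n choose i) * sym_coeff n (conj_transpose A) i j * x ^ j) =
      (\<Sum>j\<le>n. of_nat (n choose j) * cnj (sym_coeff n A j i) * x ^ j)" for x
  proof (rule polyfun_coeffs_eq[OF _ assms(1)])
    fix y :: complex
    let ?B = "conj_transpose A"
    have base: "cnj ((ent A 1 1 + ent A 1 2 * cnj y) + (ent A 2 1 + ent A 2 2 * cnj y) * cnj x) =
        (ent ?B 1 1 + ent ?B 1 2 * x) + (ent ?B 2 1 + ent ?B 2 2 * x) * y"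
      by (simp add: algebra_simps)
    have "(\<Sum>i\<le>n. (\<Sum>j\<le>n. of_nat (n choose j) * cnj (sym_coeff n A j i) * x ^ j) * y ^ i) =
        cnj (\<Sum>j\<le>n. (\<Sum>i\<le>n. of_nat (n choose j) * sym_coeff n A j i * cnj y ^ i) * cnj x ^ j)"
      unfolding cnj_sum complex_cnj_mult complex_cnj_power complex_cnj_of_nat complex_cnj_cnj sum_distrib_right
      by (subst sum.swap) (simp only: mult_ac)
    also have "\<dots> = (\<Sum>i\<le>n. (\<Sum>j\<le>n. of_nat (n choose i) * sym_coeff n (conj_transpose A) i j * x ^ j) * y ^ i)"
      unfolding sum_sym_coeff_binomial complex_cnj_power base ..
    finally show "(\<Sum>i\<le>n. (\<Sum>j\<le>n. of_nat (n choose i) * sym_coeff n (conj_transpose A) i j * x ^ j) * y ^ i) =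
        (\<Sum>i\<le>n. (\<Sum>j\<le>n. of_nat (n choose j) * cnj (sym_coeff n A j i) * x ^ j) * y ^ i)" ..
  qed
  show ?thesis by (rule polyfun_coeffs_eq[OF * assms(2)])
qed

text \<open>The monomials are orthogonal for the invariant inner product, but their lengths involve
  binomial coefficients; conjugating by the square roots makes the matrices unitary.\<close>

definition sym_rep :: "nat \<Rightarrow> complex^2^2 \<Rightarrow> complex mat" where
  "sym_rep n A = Matrix.mat (Suc n) (Suc n)
     (\<lambda>(i, j). of_real (sqrt (n choose i) / sqrt (n choose j)) * sym_coeff n A i j)"

lemma sym_rep_index: "i < Suc n \<Longrightarrow> j < Suc n \<Longrightarrow>
    sym_rep n A $$ (i, j) = of_real (sqrt (n choose i) / sqrt (n choose j)) * sym_coeff n A i j"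
  by (simp add: sym_rep_def)

lemma sym_rep_mult: "sym_rep n (A ** B) = sym_rep n A * sym_rep n B"
proof (rule eq_matI)
  fix i k assume "i < dim_row (sym_rep n A * sym_rep n B)" "k < dim_col (sym_rep n A * sym_rep n B)"
  then have ik: "i < Suc n" "k < Suc n" by (auto simp: sym_rep_def)
  have "(sym_rep n A * sym_rep n B) $$ (i, k) = (\<Sum>j\<le>n. sym_rep n A $$ (i, j) * sym_rep n B $$ (j, k))"
    using ik by (simp add: sym_rep_def scalar_prod_def atLeast0LessThan lessThan_Suc_atMost)
  also have "\<dots> = (\<Sum>j\<le>n. of_real (sqrt (n choose i) / sqrt (n choose k)) * (sym_coeff n A i j * sym_coeff n B j k))"
    by (intro sum.cong refl) (use ik in \<open>simp add: sym_rep_index\<close>)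
  also have "\<dots> = sym_rep n (A ** B) $$ (i, k)"
    using ik by (simp add: sym_rep_index sym_coeff_mult sum_distrib_left)
  finally show "sym_rep n (A ** B) $$ (i, k) = (sym_rep n A * sym_rep n B) $$ (i, k)" ..
qed (auto simp: sym_rep_def)

lemma sym_rep_one: "sym_rep n (Finite_Cartesian_Product.mat 1) = 1\<^sub>m (Suc n)"
  unfolding su_one[symmetric]
  by (rule eq_matI) (auto simp: sym_rep_def sym_coeff_diag)

lemma sym_rep_conj_transpose: "mat_adjoint (sym_rep n A) = sym_rep n (conj_transpose A)"
proof -
  have c: "sym_rep n A \<in> carrier_mat (Suc n) (Suc n)" for A by (simp add: sym_rep_def)
  show ?thesis
  proof (rule eq_matI)
    fix i j assume "i < dim_row (sym_rep n (conj_transpose A))" "j < dim_col (sym_rep n (conj_transpose A))"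
    then have ij: "i < Suc n" "j < Suc n" by (auto simp: sym_rep_def)
    define p q where "p = real (n choose i)" and "q = real (n choose j)"
    have pq: "p > 0" "q > 0" using ij by (auto simp: p_def q_def)
    have "sqrt p * sqrt p = p" "sqrt q * sqrt q = q" using pq by auto
    then have e: "sqrt q / sqrt p = 1 / (sqrt p * sqrt q) * q" "sqrt p / sqrt q = 1 / (sqrt p * sqrt q) * p"
      using pq by (auto simp: field_simps)
    have "of_real p * sym_coeff n (conj_transpose A) i j = of_real q * cnj (sym_coeff n A j i)"
      using sym_coeff_conj_transpose[of i n j A] ij by (simp add: p_def q_def)
    then have "of_real (sqrt q / sqrt p) * cnj (sym_coeff n A j i) = of_real (sqrt p / sqrt q) * sym_coeff n (conj_transpose A) i j"
      unfolding e of_real_mult mult.assoc by (simp only:)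
    then show "mat_adjoint (sym_rep n A) $$ (i, j) = sym_rep n (conj_transpose A) $$ (i, j)"
      unfolding mat_adjoint_index[OF c ij] using ij by (simp add: sym_rep_index p_def q_def)
  qed (use mat_adjoint_carrier[OF c[of A]] c[of "conj_transpose A"] in auto)
qed

lemma continuous_on_coeff_mult:
  fixes p q :: "'a::topological_space \<Rightarrow> complex poly"
  assumes "\<And>j. continuous_on S (\<lambda>x. coeff (p x) j)" "\<And>j. continuous_on S (\<lambda>x. coeff (q x) j)"
  shows "continuous_on S (\<lambda>x. coeff (p x * q x) j)"
  unfolding coeff_mult by (intro continuous_intros assms)

lemma continuous_on_coeff_power:
  fixes p :: "'a::topological_space \<Rightarrow> complex poly"
  assumes "\<And>j. continuous_on S (\<lambda>x. coeff (p x) j)"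
  shows "continuous_on S (\<lambda>x. coeff (p x ^ k) j)"
  by (induction k arbitrary: j) (auto intro!: continuous_on_coeff_mult assms)

lemma continuous_on_coeff_linear:
  "continuous_on S f \<Longrightarrow> continuous_on S g \<Longrightarrow> continuous_on S (\<lambda>x. coeff [:f x, g x:] j)"
  by (cases j; cases "j - 1") (auto simp: coeff_pCons split: nat.splits)

lemma sym_rep_unitary: "unitary_rep SU2 (Suc n) (sym_rep n)"
proof (rule unitary_repI)
  fix A assume A: "A \<in> carrier SU2"
  have "A ** conj_transpose A = Finite_Cartesian_Product.mat 1" using A by (simp add: SU2_def)
  then have "sym_rep n A * mat_adjoint (sym_rep n A) = 1\<^sub>m (Suc n)"
    unfolding sym_rep_conj_transpose sym_rep_mult[symmetric] by (simp add: sym_rep_one)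
  then show "sym_rep n A \<in> carrier (unitary_group (Suc n))"
    by (simp add: unitary_group_def sym_rep_def)
next
  fix i j assume ij: "i < Suc n" "j < Suc n"
  show "continuous_on (carrier SU2) (\<lambda>A. sym_rep n A $$ (i, j))"
    unfolding sym_rep_index[OF ij] sym_coeff_def
    by (intro continuous_intros continuous_on_coeff_mult continuous_on_coeff_power continuous_on_coeff_linear continuous_on_entry)
qed (simp add: sym_rep_mult)

lemma cnj_cis_mult: "cis t * cnj (cis t) = 1"
  by (simp add: cis_cnj cis_mult)

lemma sym_rep_weight: "weight_rep SU2 (Suc n) (sym_rep n)"
  unfolding weight_rep_def
proof (intro conjI allI impI sym_rep_unitary)
  fix i j assume ij: "i < Suc n" "j < Suc n" "i \<noteq> j"
  \<comment> \<open>The eigenvalues have angles \<open>t * (n - 2 * i)\<close>. This choice of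
    \<open>t\<close> keeps any two angles within 2 of each other, which is less than \<pi>, so
    different indices give different eigenvalues.\<close>
  define t where "t = 1 / real (Suc n)"
  have diag: "sym_rep n (su (cis t) 0) $$ (a, b) = (if a = b then cis (t * (real n - 2 * real a)) else 0)"
    if ab: "a < Suc n" "b < Suc n" for a b
  proof -
    have "cis t ^ (n - a) * cnj (cis t) ^ a = cis (real (n - a) * t + real a * (- t))"
      by (simp only: cis_cnj Complex.DeMoivre cis_mult)
    also have "real (n - a) * t + real a * (- t) = t * (real n - 2 * real a)"
      using ab by (simp add: of_nat_diff algebra_simps)
    finally show ?thesis using ab by (cases "a = b") (auto simp: sym_rep_index sym_coeff_diag)
  qed
  have "cis (t * (real n - 2 * real i)) \<noteq> cis (t * (real n - 2 * real j))"
  proof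
    assume "cis (t * (real n - 2 * real i)) = cis (t * (real n - 2 * real j))"
    then have "cis (t * (real n - 2 * real i)) / cis (t * (real n - 2 * real j)) = 1" by simp
    then have "cis (t * (2 * (real j - real i))) = 1"
      unfolding cis_divide by (simp add: algebra_simps)
    then have c: "cos (t * (2 * (real j - real i))) = 1" by (simp add: complex_eq_iff)
    have "\<bar>t * (2 * (real j - real i))\<bar> = t * (2 * \<bar>real j - real i\<bar>)" 
      using abs_of_nonneg[of t] by (simp only: abs_mult abs_numeral) (simp add: t_def)
    also have "\<dots> \<le> t * (2 * real (Suc n))" using ij by (intro mult_left_mono) (auto simp: t_def)
    also have "t * (2 * real (Suc n)) = 2 * (t * real (Suc n))" by (rule mult.left_commute)
    also have "t * real (Suc n) = 1" by (simp add: t_def)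
    finally have b: "\<bar>t * (2 * (real j - real i))\<bar> \<le> 2" by (simp only: mult_1_right)
    have "\<bar>t * (2 * (real j - real i))\<bar> = 0"
    proof (rule cos_inj_pi)
      show "cos \<bar>t * (2 * (real j - real i))\<bar> = cos 0" unfolding cos_abs_real c by (rule cos_zero[symmetric])
      show "\<bar>t * (2 * (real j - real i))\<bar> \<le> pi" 
      proof -
        have "(2::real) \<le> pi" using pi_gt3 by linarith
        then show ?thesis by (rule order.trans[OF b])
      qed
    qed (rule abs_ge_zero order_refl pi_ge_zero)+
    then have "t * (2 * (real j - real i)) = 0" by (simp only: abs_eq_0)
    then show False using ij(3) by (simp add: t_def)
  qed
  then show "\<exists>t\<in>carrier SU2. (\<forall>a<Suc n. \<forall>b<Suc n. a \<noteq> b \<longrightarrow> sym_rep n t $$ (a, b) = 0) \<and>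
      sym_rep n t $$ (i, i) \<noteq> sym_rep n t $$ (j, j)"
    using ij diag by (intro bexI[of _ "su (cis t) 0"]) (auto intro!: su_in_SU2 simp: cnj_cis_mult)
next
  \<comment> \<open>In the matrix \<open>su a a\<close> no entry is zero, so its symmetric power has
    no zero in the first row and the first column; the index 0 is the base index.\<close>
  define a where "a = complex_of_real (1 / sqrt 2)"
  have a0: "a \<noteq> 0" by (simp add: a_def)
  have "a * cnj a = of_real (1 / sqrt 2 * (1 / sqrt 2))"
    unfolding a_def complex_cnj_complex_of_real of_real_mult ..
  also have "1 / sqrt 2 * (1 / sqrt 2) = (1 / 2 :: real)" by (simp add: field_simps)
  finally have aa: "a * cnj a = of_real (1 / 2)" .
  have su: "su a a \<in> carrier SU2" by (intro su_in_SU2) (unfold aa, simp)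
  have r: "sym_coeff n (su a a) 0 j = of_nat (n choose j) * a ^ (n - j) * a ^ j" if "j \<le> n" for j
  proof (rule polyfun_coeffs_eq[OF _ that])
    fix x :: complex
    have "(\<Sum>k\<le>n. of_nat (n choose k) * a ^ (n - k) * a ^ k * x ^ k) = (\<Sum>k\<le>n. of_nat (n choose k) * (a * x) ^ k * a ^ (n - k))"
      by (intro sum.cong refl) (simp add: power_mult_distrib mult_ac)
    also have "\<dots> = (a * x + a) ^ n" by (rule binomial_ring[symmetric])
    finally show "(\<Sum>k\<le>n. sym_coeff n (su a a) 0 k * x ^ k) = (\<Sum>k\<le>n. of_nat (n choose k) * a ^ (n - k) * a ^ k * x ^ k)"
      by (simp add: sym_coeff_poly add.commute)
  qed
  have c: "sym_coeff n (su a a) i 0 = a ^ (n - i) * (- cnj a) ^ i" if "i \<le> n" for i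
  proof -
    have "(\<Sum>j\<le>n. sym_coeff n (su a a) i j * 0 ^ j) = (\<Sum>j\<le>n. if j = 0 then sym_coeff n (su a a) i j else 0)"
      by (intro sum.cong) auto
    then show ?thesis using sym_coeff_poly[OF that, of "su a a" 0] by simp
  qed
  show "\<exists>p<Suc n. \<forall>i<Suc n. (\<exists>g\<in>carrier SU2. sym_rep n g $$ (p, i) \<noteq> 0) \<and> (\<exists>g\<in>carrier SU2. sym_rep n g $$ (i, p) \<noteq> 0)"
    using su a0 by (intro exI[of _ 0] conjI allI impI bexI[of _ "su a a"]) (auto simp: sym_rep_index r c)
qed

section \<open>The unitary dual of \<open>SU(2)\<^sup>3\<close>\<close>

text \<open>The Chebyshev polynomial of the second kind at half the argument,
  \<open>U_n (t / 2)\<close>. In this normalization the argument is the trace itself.\<close>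

fun cheb :: "nat \<Rightarrow> real \<Rightarrow> real" where
  "cheb 0 t = 1"
| "cheb (Suc 0) t = t"
| "cheb (Suc (Suc n)) t = t * cheb (Suc n) t - cheb n t"

lemma cheb_step: "t * cheb (Suc n) t = cheb (Suc (Suc n)) t + cheb n t"
  by simp

lemma continuous_on_cheb [continuous_intros]: "continuous_on S f \<Longrightarrow> continuous_on S (\<lambda>x. cheb n (f x))"
  by (induction n rule: induct_nat_012) (auto intro!: continuous_intros)

text \<open>The left side is the trace of the symmetric power at the diagonal matrix with entries
  \<open>a\<close> and \<open>cnj a\<close>; its recursion multiplies by \<open>a + cnj a\<close>,
  the trace of that matrix.\<close>

lemma sum_powers_eq_cheb:
  assumes a: "a * cnj a = 1"
  shows "(\<Sum>i\<le>n. a ^ (n - i) * cnj a ^ i) = of_real (cheb n (2 * Re a))"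
proof -
  define S where "S = (\<lambda>n. \<Sum>i\<le>n. a ^ (n - i) * cnj a ^ i)"
  have step: "S (Suc n) = a * S n + cnj a ^ Suc n" for n
  proof -
    have "(\<Sum>i\<le>n. a ^ (Suc n - i) * cnj a ^ i) = a * S n"
      unfolding S_def sum_distrib_left
      by (intro sum.cong refl) (simp add: Suc_diff_le mult.assoc)
    then show ?thesis by (simp add: S_def)
  qed
  have rec: "S (Suc (Suc n)) = (a + cnj a) * S (Suc n) - S n" for n
  proof -
    have "cnj a * S (Suc n) = (a * cnj a) * S n + cnj a ^ Suc (Suc n)"
      unfolding step[of n] by (simp add: algebra_simps)
    then have "cnj a * S (Suc n) = S n + cnj a ^ Suc (Suc n)" by (simp only: a mult_1)
    then show ?thesis unfolding step[of "Suc n"] distrib_right by (simp only: add_diff_cancel_left' add.assoc diff_add_eq) simp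
  qed
  have "S n = of_real (cheb n (2 * Re a))"
  proof (induction n rule: less_induct)
    case (less n)
    consider "n = 0" | "n = 1" | m where "n = Suc (Suc m)" by (metis One_nat_def not0_implies_Suc)
    then show ?case
    proof cases
      case 1
      then show ?thesis by (simp add: S_def)
    next
      case 2
      then show ?thesis using complex_add_cnj[of a] by (simp add: S_def)
    next
      case 3
      have "S n = of_real (2 * Re a) * of_real (cheb (Suc m) (2 * Re a)) - of_real (cheb m (2 * Re a))"
        unfolding 3 rec complex_add_cnj using less[of m] less[of "Suc m"] 3 by simp
      then show ?thesis unfolding 3 by simp
    qed
  qed
  then show ?thesis by (simp add: S_def)
qed

section \<open>Conjugacy to diagonal matrices\<close>

definition trace_SU2 :: "complex^2^2 \<Rightarrow> real" where
  "trace_SU2 A = Re (ent A 1 1 + ent A 2 2)"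

text \<open>For \<open>\<bar>t\<bar> \<le> 2\<close> this is the eigenvalue with nonnegative
  imaginary part of a matrix of trace \<open>t\<close> in SU(2). Fixing this branch makes the
  diagonal representative continuous in \<open>t\<close>.\<close>

definition diag_angle :: "real \<Rightarrow> complex" where
  "diag_angle t = of_real (t / 2) + \<i> * of_real (sqrt (1 - (t / 2)\<^sup>2))"

definition diag_SU2 :: "real \<Rightarrow> complex^2^2" where
  "diag_SU2 t = su (diag_angle t) 0"

lemma diag_angle_sel: "Re (diag_angle t) = t / 2" "Im (diag_angle t) = sqrt (1 - (t / 2)\<^sup>2)"
  by (simp_all add: diag_angle_def)

lemma half_square_le_1: "\<bar>t\<bar> \<le> 2 \<Longrightarrow> (t / 2)\<^sup>2 \<le> 1" for t :: real
  by (simp add: abs_square_le_1)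

lemma diag_angle_unit:
  assumes "\<bar>t\<bar> \<le> 2"
  shows "diag_angle t * cnj (diag_angle t) = 1"
proof -
  have "(sqrt (1 - (t / 2)\<^sup>2))\<^sup>2 = 1 - (t / 2)\<^sup>2"
    using half_square_le_1[OF assms] by (intro real_sqrt_pow2) simp
  then show ?thesis
    by (simp add: complex_mult_cnj diag_angle_sel)
qed

lemma diag_SU2_in: "\<bar>t\<bar> \<le> 2 \<Longrightarrow> diag_SU2 t \<in> carrier SU2"
  unfolding diag_SU2_def by (rule su_in_SU2) (simp add: diag_angle_unit)

lemma trace_diag_SU2: "trace_SU2 (diag_SU2 t) = t"
  by (simp add: trace_SU2_def diag_SU2_def diag_angle_sel)

lemma continuous_on_su:
  assumes "continuous_on S f" "continuous_on S g"
  shows "continuous_on S (\<lambda>x. su (f x) (g x))"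
  unfolding su_def
proof (intro continuous_on_vec_lambda)
  fix i j :: 2
  show "continuous_on S (\<lambda>x. if i = 1 then (if j = 1 then f x else g x) else (if j = 1 then - cnj (g x) else cnj (f x)))"
    using assms by (cases "i = 1"; cases "j = 1") (auto intro!: continuous_intros)
qed

lemma continuous_on_diag_SU2: "continuous_on S diag_SU2"
  unfolding diag_SU2_def[abs_def] diag_angle_def
  by (intro continuous_on_su continuous_intros) simp_all

lemma continuous_on_trace_SU2: "continuous_on S f \<Longrightarrow> continuous_on S (\<lambda>x. trace_SU2 (f x))"
  unfolding trace_SU2_def
  by (intro continuous_intros continuous_on_compose2[OF continuous_on_entry]) auto

lemma SU2_conjugate_diag:
  assumes A: "A \<in> carrier SU2"
  shows "\<bar>trace_SU2 A\<bar> \<le> 2" "\<exists>h\<in>carrier SU2. A ** h = h ** diag_SU2 (trace_SU2 A)"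
proof -
  obtain \<alpha> \<beta> where ab: "A = su \<alpha> \<beta>" "\<alpha> * cnj \<alpha> + \<beta> * cnj \<beta> = 1"
    using A by (auto simp: SU2_carrier)
  have n1: "(norm \<alpha>)\<^sup>2 + (norm \<beta>)\<^sup>2 = 1"
  proof -
    have "complex_of_real ((norm \<alpha>)\<^sup>2 + (norm \<beta>)\<^sup>2) = 1"
      unfolding of_real_add complex_norm_square by (rule ab(2))
    then show ?thesis by (simp only: of_real_eq_1_iff)
  qed
  have tr: "trace_SU2 A = 2 * Re \<alpha>" by (simp add: ab(1) trace_SU2_def)
  have re: "\<bar>Re \<alpha>\<bar> \<le> 1"
  proof -
    have "(norm \<alpha>)\<^sup>2 \<le> 1" using n1 zero_le_power2[of "norm \<beta>"] by linarith
    then have "norm \<alpha> \<le> 1" by (simp add: power_le_one_iff)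
    then show ?thesis using abs_Re_le_cmod[of \<alpha>] by linarith
  qed
  show t2: "\<bar>trace_SU2 A\<bar> \<le> 2" unfolding tr using re by simp
  define l where "l = diag_angle (trace_SU2 A)"
  have l: "Re l = Re \<alpha>" "Im l = sqrt (1 - (Re \<alpha>)\<^sup>2)" by (simp_all add: l_def diag_angle_sel tr)
  have lu: "l * cnj l = 1" unfolding l_def by (rule diag_angle_unit[OF t2])
  have d: "diag_SU2 (trace_SU2 A) = su l 0" by (simp add: diag_SU2_def l_def)
  show "\<exists>h\<in>carrier SU2. A ** h = h ** diag_SU2 (trace_SU2 A)"
  \<comment> \<open>For \<open>\<beta> = 0\<close> the eigenvector used in the other case may
    vanish. The matrix is then diagonal already, and at most its two entries have to be exchanged,
    by \<open>su 0 1\<close>.\<close>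
  proof (cases "\<beta> = 0")
    case True
    have "(Re \<alpha>)\<^sup>2 + (Im \<alpha>)\<^sup>2 = 1" using n1 True by (simp add: cmod_power2)
    then have "(Im \<alpha>)\<^sup>2 = 1 - (Re \<alpha>)\<^sup>2" by simp
    then have "Im l = \<bar>Im \<alpha>\<bar>" unfolding l(2) by (metis real_sqrt_abs)
    then have "l = \<alpha> \<or> l = cnj \<alpha>" using l(1) by (auto simp: complex_eq_iff abs_if split: if_splits)
    then show ?thesis
    proof
      assume "l = \<alpha>"
      then have "A ** su 1 0 = su 1 0 ** su l 0" by (simp add: ab(1) True su_mult)
      then show ?thesis unfolding d by (intro bexI[of _ "su 1 0"]) (simp_all add: su_in_SU2)
    next
      assume "l = cnj \<alpha>"
      then have "A ** su 0 1 = su 0 1 ** su l 0" by (simp add: ab(1) True su_mult)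
      then show ?thesis unfolding d by (intro bexI[of _ "su 0 1"]) (simp_all add: su_in_SU2)
    qed
  next
    case False
    \<comment> \<open>The vector \<open>(\<beta>, v)\<close> is an eigenvector of \<open>A\<close>
      for the eigenvalue \<open>l\<close>; normalized, it becomes the first column of
      \<open>h\<close>.\<close>
    define v where "v = l - \<alpha>"
    define N where "N = (norm \<beta>)\<^sup>2 + (norm v)\<^sup>2"
    have N: "N > 0" using False by (simp add: N_def add_pos_nonneg)
    define r where "r = complex_of_real (1 / sqrt N)"
    have rr: "r * r * of_real N = 1"
    proof -
      have "r * r * of_real N = of_real (1 / sqrt N * (1 / sqrt N) * N)" unfolding r_def by (simp only: of_real_mult)
      also have "1 / sqrt N * (1 / sqrt N) * N = 1" using N by (simp add: real_sqrt_mult_self)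
      finally show ?thesis by simp
    qed
    have rc: "cnj r = r" by (simp add: r_def)
    have Nc: "of_real N = \<beta> * cnj \<beta> + v * cnj v" unfolding N_def of_real_add complex_norm_square ..
    have h: "su (\<beta> * r) (- (cnj v * r)) \<in> carrier SU2"
    proof (rule su_in_SU2)
      have "\<beta> * r * cnj (\<beta> * r) + - (cnj v * r) * cnj (- (cnj v * r)) = r * r * (\<beta> * cnj \<beta> + v * cnj v)"
        by (simp add: rc algebra_simps)
      then show "\<beta> * r * cnj (\<beta> * r) + - (cnj v * r) * cnj (- (cnj v * r)) = 1" using rr by (simp only: Nc)
    qed
    have e1: "\<alpha> * \<beta> + \<beta> * v = \<beta> * l" by (simp add: v_def algebra_simps)
    \<comment> \<open>\<open>l\<close> and \<open>cnj l\<close> have the trace of \<open>A\<close>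
      as their sum and 1 as their product, so they satisfy its characteristic equation.\<close>
    have cn: "cnj l = \<alpha> + cnj \<alpha> - l"
      using complex_add_cnj[of \<alpha>] complex_add_cnj[of l] l(1) by (simp add: algebra_simps)
    have "l * (\<alpha> + cnj \<alpha> - l) = 1" using lu unfolding cn .
    then have "cnj \<alpha> * v - \<beta> * cnj \<beta> = l * v"
      using ab(2) by (simp add: v_def algebra_simps)
    then have e2: "\<alpha> * cnj v - cnj \<beta> * \<beta> = cnj l * cnj v"
      by (metis complex_cnj_cnj complex_cnj_diff complex_cnj_mult)
    have "A ** su (\<beta> * r) (- (cnj v * r)) = su ((\<alpha> * \<beta> + \<beta> * v) * r) (- ((\<alpha> * cnj v - cnj \<beta> * \<beta>) * r))"
      unfolding ab(1) su_mult by (simp add: rc algebra_simps)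
    also have "\<dots> = su (\<beta> * r) (- (cnj v * r)) ** su l 0"
      unfolding e1 e2 su_mult by (simp add: algebra_simps)
    finally show ?thesis unfolding d using h by blast
  qed
qed

lemma trace_char_conjugate:
  assumes rep: "unitary_rep K n \<rho>" and c: "g \<in> carrier K" "h \<in> carrier K" "d \<in> carrier K"
    and e: "g \<otimes>\<^bsub>K\<^esub> h = h \<otimes>\<^bsub>K\<^esub> d"
  shows "trace_char n \<rho> g = trace_char n \<rho> d"
proof -
  note H = unitary_groupD[OF unitary_repD(1)[OF rep c(2)]]
  note G = unitary_repD(2)[OF rep c(1)] and D = unitary_repD(2)[OF rep c(3)]
  have gh: "\<rho> g * \<rho> h = \<rho> h * \<rho> d" using e unitary_repD(3)[OF rep c(1,2)] unitary_repD(3)[OF rep c(2,3)] by simp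
  have "\<rho> g = \<rho> g * (\<rho> h * mat_adjoint (\<rho> h))" unfolding H(3) using G by simp
  also have "\<dots> = \<rho> h * \<rho> d * mat_adjoint (\<rho> h)" unfolding gh[symmetric] by (rule assoc_mult_mat[OF G H(1,2), symmetric])
  finally have 1: "\<rho> g = \<rho> h * \<rho> d * mat_adjoint (\<rho> h)" .
  have "mat_adjoint (\<rho> h) * (\<rho> h * \<rho> d) = (mat_adjoint (\<rho> h) * \<rho> h) * \<rho> d"
    by (rule assoc_mult_mat[OF H(2,1) D, symmetric])
  then have 2: "mat_adjoint (\<rho> h) * (\<rho> h * \<rho> d) = \<rho> d" unfolding H(4) using D by simp
  show ?thesis
    unfolding trace_char_def
    by (subst 1, subst sum_diag_mult_comm[OF mult_carrier_mat[OF H(1) D] H(2)], subst 2) (rule refl)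
qed

lemma trace_char_sym_rep:
  assumes A: "A \<in> carrier SU2"
  shows "trace_char (Suc n) (sym_rep n) A = of_real (cheb n (trace_SU2 A))"
proof -
  define a where "a = diag_angle (trace_SU2 A)"
  note t = SU2_conjugate_diag[OF A]
  obtain h where h: "h \<in> carrier SU2" "A ** h = h ** diag_SU2 (trace_SU2 A)" using t(2) by blast
  have "trace_char (Suc n) (sym_rep n) A = trace_char (Suc n) (sym_rep n) (diag_SU2 (trace_SU2 A))"
    by (rule trace_char_conjugate[OF sym_rep_unitary A h(1) diag_SU2_in[OF t(1)]]) (simp add: h(2))
  also have "\<dots> = (\<Sum>i\<le>n. sym_rep n (su a 0) $$ (i, i))"
    by (simp only: trace_char_def diag_SU2_def a_def lessThan_Suc_atMost)
  also have "\<dots> = (\<Sum>i\<le>n. a ^ (n - i) * cnj a ^ i)"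
    by (intro sum.cong refl) (simp add: sym_rep_index sym_coeff_diag)
  also have "\<dots> = of_real (cheb n (2 * Re a))"
    by (rule sum_powers_eq_cheb) (simp add: a_def diag_angle_unit[OF t(1)])
  also have "2 * Re a = trace_SU2 A" by (simp add: a_def diag_angle_sel)
  finally show ?thesis .
qed

lemma norm_trace_char_le:
  assumes "unitary_rep K n \<rho>" "g \<in> carrier K"
  shows "norm (trace_char n \<rho> g) \<le> real n"
proof -
  have "norm (trace_char n \<rho> g) \<le> (\<Sum>i<n. norm (\<rho> g $$ (i, i)))" unfolding trace_char_def by (rule norm_sum)
  also have "\<dots> \<le> (\<Sum>i<n. 1)"
    by (intro sum_mono unitary_entry_le_1[OF unitary_repD(1)[OF assms]]) simp_all
  finally show ?thesis by simp
qed

lemma continuous_on_trace_char: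
  "unitary_rep K n \<rho> \<Longrightarrow> continuous_on (carrier K) (trace_char n \<rho>)"
  unfolding trace_char_def[abs_def] by (intro continuous_intros unitary_repD(4)) simp_all

section \<open>Characters of SU(2)^3 as polynomials in three traces\<close>

definition rep3 :: "nat \<times> nat \<times> nat \<Rightarrow> (complex^2^2) \<times> (complex^2^2) \<times> (complex^2^2) \<Rightarrow> complex mat" where
  "rep3 = (\<lambda>(a, b, c). tensor_rep (Suc a) (Suc b * Suc c) (sym_rep a) (tensor_rep (Suc b) (Suc c) (sym_rep b) (sym_rep c)))"

definition deg3 :: "nat \<times> nat \<times> nat \<Rightarrow> nat" where
  "deg3 = (\<lambda>(a, b, c). Suc a * (Suc b * Suc c))"

definition cheb3 :: "nat \<times> nat \<times> nat \<Rightarrow> real \<times> real \<times> real \<Rightarrow> real" where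
  "cheb3 = (\<lambda>(a, b, c) (x, y, z). cheb a x * (cheb b y * cheb c z))"

definition traces :: "(complex^2^2) \<times> (complex^2^2) \<times> (complex^2^2) \<Rightarrow> real \<times> real \<times> real" where
  "traces = (\<lambda>(A, B, C). (trace_SU2 A, trace_SU2 B, trace_SU2 C))"

lemma carrier_SU2_cubed: "carrier SU2_cubed = carrier SU2 \<times> carrier SU2 \<times> carrier SU2"
  by (simp add: SU2_cubed_def)

lemma group_SU2_cubed: "group SU2_cubed"
  unfolding SU2_cubed_def by (intro DirProd_group group_SU2)

lemma rep3_irreducible: "irreducible_unitary_rep SU2_cubed (deg3 p) (rep3 p)"
proof -
  obtain a b c where p: "p = (a, b, c)" by (cases p)
  show ?thesis
    unfolding p rep3_def deg3_def SU2_cubed_def prod.case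
    by (intro weight_rep_irreducible tensor_weight_rep DirProd_group group_SU2 sym_rep_weight)
qed

lemma trace_char_rep3:
  assumes "g \<in> carrier SU2_cubed"
  shows "trace_char (deg3 p) (rep3 p) g = of_real (cheb3 p (traces g))"
proof -
  obtain a b c where p: "p = (a, b, c)" by (cases p)
  obtain A B C where g: "g = (A, B, C)" "A \<in> carrier SU2" "B \<in> carrier SU2" "C \<in> carrier SU2"
    using assms unfolding carrier_SU2_cubed by blast
  have m: "Suc b * Suc c > 0" "Suc c > 0" by simp_all
  show ?thesis
    unfolding p g(1) rep3_def deg3_def prod.case trace_char_tensor[OF m(1)] trace_char_tensor[OF m(2)]
      trace_char_sym_rep[OF g(2)] trace_char_sym_rep[OF g(3)] trace_char_sym_rep[OF g(4)]
    by (simp add: cheb3_def traces_def)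
qed

lemma haar_group_SU2_cubed:
  "normalized_haar_measure SU2 \<mu> \<Longrightarrow> haar_group SU2_cubed (\<mu> \<Otimes>\<^sub>M (\<mu> \<Otimes>\<^sub>M \<mu>))"
  unfolding SU2_cubed_def by (intro haar_group_DirProd haar_group_SU2)

text \<open>
  The characters \<open>cheb3\<close> span an algebra that contains the coordinate functions, hence all polynomials.
\<close>

inductive cheb_span :: "(real \<times> real \<times> real \<Rightarrow> real) \<Rightarrow> bool" where
  base: "cheb_span (cheb3 p)"
| add: "cheb_span f \<Longrightarrow> cheb_span g \<Longrightarrow> cheb_span (\<lambda>x. f x + g x)"
| scale: "cheb_span f \<Longrightarrow> cheb_span (\<lambda>x. r * f x)"

text \<open>The coefficient 0 neutralizes the truncated \<open>n - 1\<close> at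
  \<open>n = 0\<close>, so that one formula covers all \<open>n\<close>.\<close>

lemma mult_cheb: "t * cheb n t = cheb (Suc n) t + (if n = 0 then 0 else 1) * cheb (n - 1) t"
  by (cases n) simp_all

lemma cheb_span_mult_coordinate:
  assumes "cheb_span f"
  shows "cheb_span (\<lambda>x. fst x * f x)" "cheb_span (\<lambda>x. fst (snd x) * f x)" "cheb_span (\<lambda>x. snd (snd x) * f x)"
proof -
  have "cheb_span (\<lambda>x. fst x * f x) \<and> cheb_span (\<lambda>x. fst (snd x) * f x) \<and> cheb_span (\<lambda>x. snd (snd x) * f x)"
    using assms
  proof induction
    case (base p)
    obtain a b c where p: "p = (a, b, c)" by (cases p)
    have 1: "(\<lambda>x. fst x * cheb3 p x) = (\<lambda>x. cheb3 (Suc a, b, c) x + (if a = 0 then 0 else 1) * cheb3 (a - 1, b, c) x)"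
    proof
      fix x :: "real \<times> real \<times> real"
      obtain u v w where x: "x = (u, v, w)" by (cases x)
      have "fst x * cheb3 p x = (u * cheb a u) * (cheb b v * cheb c w)" by (simp add: p x cheb3_def)
      then show "fst x * cheb3 p x = cheb3 (Suc a, b, c) x + (if a = 0 then 0 else 1) * cheb3 (a - 1, b, c) x"
        unfolding mult_cheb by (simp add: x cheb3_def distrib_right)
    qed
    have 2: "(\<lambda>x. fst (snd x) * cheb3 p x) = (\<lambda>x. cheb3 (a, Suc b, c) x + (if b = 0 then 0 else 1) * cheb3 (a, b - 1, c) x)"
    proof
      fix x :: "real \<times> real \<times> real"
      obtain u v w where x: "x = (u, v, w)" by (cases x)
      have "fst (snd x) * cheb3 p x = cheb a u * ((v * cheb b v) * cheb c w)" by (simp add: p x cheb3_def)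
      then show "fst (snd x) * cheb3 p x = cheb3 (a, Suc b, c) x + (if b = 0 then 0 else 1) * cheb3 (a, b - 1, c) x"
        unfolding mult_cheb by (simp add: x cheb3_def distrib_right distrib_left)
    qed
    have 3: "(\<lambda>x. snd (snd x) * cheb3 p x) = (\<lambda>x. cheb3 (a, b, Suc c) x + (if c = 0 then 0 else 1) * cheb3 (a, b, c - 1) x)"
    proof
      fix x :: "real \<times> real \<times> real"
      obtain u v w where x: "x = (u, v, w)" by (cases x)
      have "snd (snd x) * cheb3 p x = cheb a u * (cheb b v * (w * cheb c w))" by (simp add: p x cheb3_def)
      then show "snd (snd x) * cheb3 p x = cheb3 (a, b, Suc c) x + (if c = 0 then 0 else 1) * cheb3 (a, b, c - 1) x"
        unfolding mult_cheb by (simp add: x cheb3_def distrib_left)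
    qed
    show ?case unfolding 1 2 3 by (intro conjI cheb_span.intros)
  next
    case (add f g)
    then show ?case unfolding distrib_left by (intro conjI cheb_span.intros) simp_all
  next
    case (scale f r)
    have "(\<lambda>x. k x * (r * f x)) = (\<lambda>x. r * (k x * f x))" for k by (simp add: fun_eq_iff)
    then show ?case using scale.IH by (simp add: cheb_span.intros)
  qed
  then show "cheb_span (\<lambda>x. fst x * f x)" "cheb_span (\<lambda>x. fst (snd x) * f x)" "cheb_span (\<lambda>x. snd (snd x) * f x)"
    by simp_all
qed

text \<open>Stated for polynomials as multipliers of an arbitrary element of the span: a product of
  two polynomials is then handled by applying them one after the other, and only multiplication by
  coordinates has to be checked.\<close>

lemma polynomial_mult_cheb_span:
  assumes "real_polynomial_function p"
  shows "cheb_span f \<Longrightarrow> cheb_span (\<lambda>x. p x * f x)"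
  using assms
proof (induction p arbitrary: f rule: real_polynomial_function.induct)
  case (linear p)
  interpret p: bounded_linear p by fact
  have "p x * f x = p (1, 0, 0) * (fst x * f x) + (p (0, 1, 0) * (fst (snd x) * f x) + p (0, 0, 1) * (snd (snd x) * f x))" for x
  proof -
    obtain u v w where x: "x = (u, v, w)" by (cases x)
    have "x = u *\<^sub>R (1, 0, 0) + (v *\<^sub>R (0, 1, 0) + w *\<^sub>R (0, 0, 1))" by (simp add: x)
    then have "p x = u * p (1, 0, 0) + (v * p (0, 1, 0) + w * p (0, 0, 1))"
      by (simp only: p.add p.scaleR real_scaleR_def)
    then show ?thesis by (simp add: x algebra_simps)
  qed
  then show ?case
    using linear.prems by (simp only:) (intro cheb_span.add cheb_span.scale cheb_span_mult_coordinate)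
next
  case (const c)
  then show ?case by (rule cheb_span.scale)
next
  case (add p q)
  then show ?case unfolding distrib_right by (intro cheb_span.add) simp_all
next
  case (mult p q)
  then show ?case unfolding mult.assoc by blast
qed

lemma polynomial_cheb_span:
  assumes "real_polynomial_function p"
  shows "cheb_span p"
proof -
  have "(\<lambda>x. p x * cheb3 (0, 0, 0) x) = p" by (simp add: cheb3_def fun_eq_iff split_beta)
  then show ?thesis using polynomial_mult_cheb_span[OF assms cheb_span.base[of "(0, 0, 0)"]] by simp
qed

lemma cheb_span_continuous: "cheb_span f \<Longrightarrow> continuous_on S f"
  by (induction rule: cheb_span.induct)
     (auto simp: cheb3_def split_beta intro!: continuous_intros)

lemma traces_bounded: "g \<in> carrier SU2_cubed \<Longrightarrow> traces g \<in> {-2..2} \<times> {-2..2} \<times> {-2..2}"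
  unfolding carrier_SU2_cubed traces_def using SU2_conjugate_diag(1)
  by (auto simp: abs_le_iff minus_le_iff)

lemma continuous_on_traces: "continuous_on S traces"
  unfolding traces_def split_beta by (intro continuous_intros continuous_on_trace_SU2)

text \<open>A continuous section of \<open>traces\<close> over the cube of side from -2 to 2;
  composing a character with it exhibits the character as a continuous function of the
  traces.\<close>

definition diag3_traces :: "real \<times> real \<times> real \<Rightarrow> (complex^2^2) \<times> (complex^2^2) \<times> (complex^2^2)" where
  "diag3_traces = (\<lambda>(x, y, z). (diag_SU2 x, diag_SU2 y, diag_SU2 z))"

lemma diag3_traces_in: "x \<in> {-2..2} \<times> {-2..2} \<times> {-2..2} \<Longrightarrow> diag3_traces x \<in> carrier SU2_cubed"
  unfolding carrier_SU2_cubed diag3_traces_def by (auto intro!: diag_SU2_in)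

lemma continuous_on_diag3_traces: "continuous_on S diag3_traces"
  unfolding diag3_traces_def split_beta
  by (intro continuous_intros continuous_on_compose2[OF continuous_on_diag_SU2]) auto

lemma trace_char_eq_diag:
  assumes rep: "unitary_rep SU2_cubed n \<rho>" and g: "g \<in> carrier SU2_cubed"
  shows "trace_char n \<rho> g = trace_char n \<rho> (diag3_traces (traces g))"
proof -
  obtain A B C where ABC: "g = (A, B, C)" "A \<in> carrier SU2" "B \<in> carrier SU2" "C \<in> carrier SU2"
    using g unfolding carrier_SU2_cubed by blast
  obtain h k l where h: "h \<in> carrier SU2" "A ** h = h ** diag_SU2 (trace_SU2 A)"
    and k: "k \<in> carrier SU2" "B ** k = k ** diag_SU2 (trace_SU2 B)"
    and l: "l \<in> carrier SU2" "C ** l = l ** diag_SU2 (trace_SU2 C)"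
    using SU2_conjugate_diag(2)[OF ABC(2)] SU2_conjugate_diag(2)[OF ABC(3)] SU2_conjugate_diag(2)[OF ABC(4)] by blast
  show ?thesis
  proof (rule trace_char_conjugate[OF rep g _ diag3_traces_in[OF traces_bounded[OF g]]])
    show "(h, k, l) \<in> carrier SU2_cubed" using h k l by (simp add: carrier_SU2_cubed)
    show "g \<otimes>\<^bsub>SU2_cubed\<^esub> (h, k, l) = (h, k, l) \<otimes>\<^bsub>SU2_cubed\<^esub> diag3_traces (traces g)"
      by (simp add: SU2_cubed_def ABC(1) diag3_traces_def traces_def h k l)
  qed
qed

text \<open>
  A character is a continuous function of the three traces. If it were orthogonal to all \<open>cheb3\<close>,
  then by the Weierstrass theorem it would be orthogonal to itself.
\<close>

lemma irreducible_equivalent_rep3: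
  assumes haar: "normalized_haar_measure SU2 \<mu>" and \<rho>: "irreducible_unitary_rep SU2_cubed n \<rho>"
  shows "\<exists>p. (rep3 p, \<rho>) \<in> rep_equivalence SU2_cubed"
proof (rule ccontr)
  assume "\<not> ?thesis"
  then have ne: "(rep3 p, \<rho>) \<notin> rep_equivalence SU2_cubed" for p by blast
  interpret haar_group SU2_cubed "\<mu> \<Otimes>\<^sub>M (\<mu> \<Otimes>\<^sub>M \<mu>)" by (rule haar_group_SU2_cubed[OF haar])
  let ?M = "\<mu> \<Otimes>\<^sub>M (\<mu> \<Otimes>\<^sub>M \<mu>)"
  let ?T = "{-2..2::real} \<times> {-2..2::real} \<times> {-2..2::real}"
  have rep: "unitary_rep SU2_cubed n \<rho>" using \<rho> by (simp add: irreducible_unitary_rep_def)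
  define \<phi> where "\<phi> = trace_char n \<rho>"
  have \<phi>c: "continuous_on (carrier SU2_cubed) \<phi>" unfolding \<phi>_def by (rule continuous_on_trace_char[OF rep])
  have \<phi>n: "norm (\<phi> g) \<le> real n" if "g \<in> carrier SU2_cubed" for g
    unfolding \<phi>_def by (rule norm_trace_char_le[OF rep that])
  have cT: "compact ?T" by (intro compact_Times compact_Icc)
  have int: "integrable ?M (\<lambda>g. \<phi> g * of_real (f (traces g)))" if f: "continuous_on UNIV f" for f
  proof -
    have "compact (f ` ?T)" by (intro compact_continuous_image cT continuous_on_subset[OF f]) simp
    then have "bounded (f ` ?T)" by (rule compact_imp_bounded)
    then obtain B where "\<forall>y\<in>f ` ?T. norm y \<le> B" unfolding bounded_iff by (rule exE)
    then have B: "norm (f x) \<le> B" if "x \<in> ?T" for x using imageI[OF that, of f] by (rule bspec)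
    show ?thesis
    proof (rule integrable_continuous_bounded[where B = "real n * B"])
      show "continuous_on (carrier SU2_cubed) (\<lambda>g. \<phi> g * of_real (f (traces g)))"
        by (intro continuous_intros \<phi>c continuous_on_compose2[OF f continuous_on_traces]) simp
      fix g assume g: "g \<in> carrier SU2_cubed"
      have "norm (\<phi> g) * norm (f (traces g)) \<le> real n * B"
        using \<phi>n[OF g] B[OF traces_bounded[OF g]] by (intro mult_mono) simp_all
      then show "norm (\<phi> g * of_real (f (traces g))) \<le> real n * B" by (simp add: norm_mult)
    qed
  qed
  have zero: "(\<integral>g. \<phi> g * of_real (f (traces g)) \<partial>?M) = 0" if "cheb_span f" for f
    using that
  proof induction
    case (base p)
    have "(\<integral>g. \<phi> g * of_real (cheb3 p (traces g)) \<partial>?M) = (\<integral>g. \<phi> g * cnj (trace_char (deg3 p) (rep3 p) g) \<partial>?M)"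
      by (rule Bochner_Integration.integral_cong) (simp_all add: space_haar trace_char_rep3)
    also have "\<dots> = 0" unfolding \<phi>_def by (rule char_orthogonal[OF \<rho> rep3_irreducible ne])
    finally show ?case .
  next
    case (add f g)
    note i = int[OF cheb_span_continuous[OF add.hyps(1)]] int[OF cheb_span_continuous[OF add.hyps(2)]]
    show ?case unfolding of_real_add distrib_left Bochner_Integration.integral_add[OF i] add.IH by simp
  next
    case (scale f r)
    have "(\<lambda>g. \<phi> g * complex_of_real (r * f (traces g))) = (\<lambda>g. of_real r * (\<phi> g * of_real (f (traces g))))"
      by (simp add: fun_eq_iff)
    then show ?case using scale.IH by simp
  qed
  define F where "F = (\<lambda>x. \<phi> (diag3_traces x))"
  have F: "\<phi> g = F (traces g)" if "g \<in> carrier SU2_cubed" for g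
    unfolding F_def \<phi>_def by (rule trace_char_eq_diag[OF rep that])
  have "continuous_on ?T F"
    unfolding F_def by (rule continuous_on_compose2[OF \<phi>c continuous_on_diag3_traces]) (use diag3_traces_in in blast)
  then have Fc: "continuous_on ?T (\<lambda>x. Re (F x))" "continuous_on ?T (\<lambda>x. Im (F x))"
    by (intro continuous_intros; assumption)+
  \<comment> \<open>The character is bounded by \<open>n\<close>, and its real and imaginary parts
    are each approximated within \<open>\<epsilon>\<close>; the total error
    \<open>n * 2 * \<epsilon>\<close> then stays below 1.\<close>
  define \<epsilon> where "\<epsilon> = 1 / (4 * (real n + 1))"
  have \<epsilon>: "\<epsilon> > 0" by (simp add: \<epsilon>_def)
  obtain p where p: "real_polynomial_function p" "\<And>x. x \<in> ?T \<Longrightarrow> \<bar>Re (F x) - p x\<bar> < \<epsilon>"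
    using Stone_Weierstrass_real_polynomial_function[OF cT Fc(1) \<epsilon>] by blast
  obtain q where q: "real_polynomial_function q" "\<And>x. x \<in> ?T \<Longrightarrow> \<bar>Im (F x) - q x\<bar> < \<epsilon>"
    using Stone_Weierstrass_real_polynomial_function[OF cT Fc(2) \<epsilon>] by blast
  note ps = polynomial_cheb_span[OF p(1)] and qs = polynomial_cheb_span[OF q(1)]
  note ip = int[OF cheb_span_continuous[OF ps]] and iq = int[OF cheb_span_continuous[OF qs]]
  \<comment> \<open>\<open>p - \<i> q\<close> approximates the conjugate character. The first
    product has integral 1 and the approximating one has integral 0, although their difference is
    uniformly small.\<close>
  let ?D = "\<lambda>g. \<phi> g * cnj (\<phi> g) - (\<phi> g * of_real (p (traces g)) - \<i> * (\<phi> g * of_real (q (traces g))))"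
  have i1: "integrable ?M (\<lambda>g. \<phi> g * cnj (\<phi> g))"
  proof (rule integrable_continuous_bounded[where B = "real n * real n"])
    show "continuous_on (carrier SU2_cubed) (\<lambda>g. \<phi> g * cnj (\<phi> g))" by (intro continuous_intros \<phi>c)
    show "norm (\<phi> g * cnj (\<phi> g)) \<le> real n * real n" if "g \<in> carrier SU2_cubed" for g
      unfolding norm_mult complex_mod_cnj using \<phi>n[OF that] by (intro mult_mono) simp_all
  qed
  have i2: "integrable ?M (\<lambda>g. \<phi> g * of_real (p (traces g)) - \<i> * (\<phi> g * of_real (q (traces g))))"
    by (intro Bochner_Integration.integrable_diff integrable_mult_right ip iq)
  have "(\<integral>g. ?D g \<partial>?M) = (\<integral>g. \<phi> g * cnj (\<phi> g) \<partial>?M) -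
      ((\<integral>g. \<phi> g * of_real (p (traces g)) \<partial>?M) - \<i> * (\<integral>g. \<phi> g * of_real (q (traces g)) \<partial>?M))"
    using ip iq by (subst Bochner_Integration.integral_diff[OF i1 i2], subst Bochner_Integration.integral_diff) simp_all
  also have "\<dots> = 1" unfolding zero[OF ps] zero[OF qs] using char_self[OF \<rho>] by (simp add: \<phi>_def)
  finally have D1: "(\<integral>g. ?D g \<partial>?M) = 1" .
  have "norm (?D g) \<le> real n * (2 * \<epsilon>)" if g: "g \<in> carrier SU2_cubed" for g
  proof -
    define x where "x = traces g"
    have x: "x \<in> ?T" unfolding x_def by (rule traces_bounded[OF g])
    have c: "cnj (F x) = of_real (Re (F x)) - \<i> * of_real (Im (F x))" by (simp add: complex_eq_iff)
    have "?D g = \<phi> g * (of_real (Re (F x) - p x) - \<i> * of_real (Im (F x) - q x))"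
      unfolding F[OF g] x_def[symmetric] c by (simp add: algebra_simps)
    then have n: "norm (?D g) = norm (\<phi> g) * norm (of_real (Re (F x) - p x) - \<i> * of_real (Im (F x) - q x))"
      by (simp only: norm_mult)
    have "norm (of_real (Re (F x) - p x) - \<i> * of_real (Im (F x) - q x)) \<le> \<bar>Re (F x) - p x\<bar> + \<bar>Im (F x) - q x\<bar>"
      by (rule order.trans[OF norm_triangle_ineq4]) (simp only: norm_mult norm_ii norm_of_real mult_1 order_refl)
    also have "\<dots> \<le> 2 * \<epsilon>" using p(2)[OF x] q(2)[OF x] by linarith
    finally show ?thesis unfolding n by (rule mult_mono[OF \<phi>n[OF g]]) simp_all
  qed
  then have "norm (\<integral>g. ?D g \<partial>?M) \<le> real n * (2 * \<epsilon>)"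
    by (intro order.trans[OF integral_norm_bound] integral_le_const integrable_norm Bochner_Integration.integrable_diff i1 i2 AE_I2)
       (simp add: space_haar)
  then have "1 \<le> real n * (2 * \<epsilon>)" unfolding D1 by simp
  also have "\<dots> < 1" by (simp add: \<epsilon>_def field_simps)
  finally show False by simp
qed

section \<open>The diagonal integral\<close>

lemma cheb_2: "cheb n 2 = real (Suc n)"
  by (induction n rule: induct_nat_012) simp_all

text \<open>The Clebsch-Gordan rule on the level of characters. Writing the larger index as
  \<open>d + b\<close> avoids subtraction.\<close>

lemma cheb_mult: "cheb (d + b) t * cheb b t = (\<Sum>k\<le>b. cheb (d + 2 * k) t)"
proof (induction b arbitrary: d rule: induct_nat_012)
  case 1
  show ?case using cheb_step[of t d] by simp
next
  case (ge2 n)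
  \<comment> \<open>The fixed index \<open>d + n + 2\<close> is read as
    \<open>(d + 1) + (n + 1)\<close> here and as \<open>(d + 2) + n\<close> below, which is why the
    induction has \<open>d\<close> arbitrary.\<close>
  have 1: "cheb (Suc (Suc (d + n))) t * cheb (Suc n) t = (\<Sum>k\<le>Suc n. cheb (Suc (d + 2 * k)) t)"
    using ge2.IH(2)[of "Suc d"] by simp
  have 2: "cheb (Suc (Suc (d + n))) t * cheb n t = (\<Sum>k\<le>n. cheb (Suc (Suc (d + 2 * k))) t)"
    using ge2.IH(1)[of "Suc (Suc d)"] by simp
  have 3: "t * (\<Sum>k\<le>Suc n. cheb (Suc (d + 2 * k)) t) =
      (\<Sum>k\<le>Suc n. cheb (Suc (Suc (d + 2 * k))) t) + (\<Sum>k\<le>Suc n. cheb (d + 2 * k) t)"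
    unfolding sum_distrib_left cheb_step sum.distrib ..
  have "cheb (d + Suc (Suc n)) t * cheb (Suc (Suc n)) t =
      t * (cheb (Suc (Suc (d + n))) t * cheb (Suc n) t) - cheb (Suc (Suc (d + n))) t * cheb n t"
    unfolding cheb.simps(3)[of n] add_Suc_right right_diff_distrib by (simp only: mult.left_commute)
  also have "\<dots> = cheb (Suc (Suc (d + 2 * Suc n))) t + (\<Sum>k\<le>Suc n. cheb (d + 2 * k) t)"
    unfolding 1 2 3 sum.atMost_Suc[of "\<lambda>k. cheb (Suc (Suc (d + 2 * k))) t"] by simp
  also have "\<dots> = (\<Sum>k\<le>Suc (Suc n). cheb (d + 2 * k) t)"
    unfolding sum.atMost_Suc[of _ "Suc n"] by (simp add: add.commute)
  finally show ?case .
qed simp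

lemma triangles_swap: "(a, b, c) \<in> triangles \<longleftrightarrow> (b, a, c) \<in> triangles"
proof -
  have "(b, a, c) \<in> triangles" if "(a, b, c) \<in> triangles" for a b c
  proof -
    obtain m1 m2 m3 where "a = m1 + m2" "b = m2 + m3" "c = m3 + m1" using \<open>(a, b, c) \<in> triangles\<close> by (auto simp: triangles_def)
    then show ?thesis unfolding triangles_def by (intro image_eqI[of _ _ "(m3, m2, m1)"]) simp_all
  qed
  then show ?thesis by blast
qed

text \<open>With \<open>k\<close> as the parameter \<open>m3\<close> the triangle condition becomes
  membership of \<open>c\<close> among the indices on the right of \<open>cheb_mult\<close>.\<close>

lemma triangles_iff: "(d + b, b, c) \<in> triangles \<longleftrightarrow> (\<exists>k\<le>b. c = d + 2 * k)"
proof
  assume "(d + b, b, c) \<in> triangles"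
  then obtain m1 m2 m3 where "d + b = m1 + m2" "b = m2 + m3" "c = m3 + m1" by (auto simp: triangles_def)
  then show "\<exists>k\<le>b. c = d + 2 * k" by (intro exI[of _ m3]) simp
next
  assume "\<exists>k\<le>b. c = d + 2 * k"
  then obtain k where "k \<le> b" "c = d + 2 * k" by blast
  then show "(d + b, b, c) \<in> triangles"
    unfolding triangles_def by (intro image_eqI[of _ _ "(d + k, b - k, k)"]) simp_all
qed

definition rep3_class :: "nat \<times> nat \<times> nat \<Rightarrow> ((complex^2^2) \<times> (complex^2^2) \<times> (complex^2^2) \<Rightarrow> complex mat) set" where
  "rep3_class p = rep_equivalence SU2_cubed `` {rep3 p}"

lemma equiv_SU2_cubed: "equiv (irreps SU2_cubed) (rep_equivalence SU2_cubed)"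
  using group.is_monoid[OF group_SU2_cubed] by (rule equiv_rep_equivalence[OF monoid.one_closed])

lemma rep3_in_irreps: "rep3 p \<in> irreps SU2_cubed"
  using rep3_irreducible unfolding irreps_def by blast

section \<open>Integrals of characters over SU(2) and the classes of the dual\<close>

context
  fixes \<mu> :: "(complex^2^2) measure"
  assumes haar: "normalized_haar_measure SU2 \<mu>"
begin

interpretation haar_group SU2 \<mu>
  by (rule haar_group_SU2[OF haar])

lemma integrable_trace_SU2:
  fixes f :: "real \<Rightarrow> real"
  assumes "continuous_on UNIV f"
  shows "integrable \<mu> (\<lambda>h. f (trace_SU2 h))"
proof -
  have "compact (f ` {-2..2})" by (intro compact_continuous_image compact_Icc continuous_on_subset[OF assms]) simp
  then have "bounded (f ` {-2..2})" by (rule compact_imp_bounded)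
  then obtain B where B: "\<forall>y\<in>f ` {-2..2}. norm y \<le> B" unfolding bounded_iff by (rule exE)
  have "integrable \<mu> (\<lambda>h. complex_of_real (f (trace_SU2 h)))"
  proof (rule integrable_continuous_bounded[where B = B])
    show "continuous_on (carrier SU2) (\<lambda>h. complex_of_real (f (trace_SU2 h)))"
      by (intro continuous_intros continuous_on_compose2[OF assms continuous_on_trace_SU2]) simp
    fix h :: "complex^2^2" assume "h \<in> carrier SU2"
    then have "trace_SU2 h \<in> {-2..2}" using SU2_conjugate_diag(1)[of h] by (auto simp: abs_le_iff)
    then show "norm (complex_of_real (f (trace_SU2 h))) \<le> B" using bspec[OF B imageI] by simp
  qed
  then show ?thesis by (simp only: complex_of_real_integrable_eq)
qed

lemma integral_cheb_orthogonal:
  "(\<integral>h. cheb a (trace_SU2 h) * cheb b (trace_SU2 h) \<partial>\<mu>) = (if a = b then 1 else 0)"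
proof -
  note irr = weight_rep_irreducible[OF sym_rep_weight]
  have "complex_of_real (\<integral>h. cheb a (trace_SU2 h) * cheb b (trace_SU2 h) \<partial>\<mu>) =
      (\<integral>h. complex_of_real (cheb a (trace_SU2 h) * cheb b (trace_SU2 h)) \<partial>\<mu>)"
    by (rule integral_complex_of_real[symmetric])
  also have "\<dots> = (\<integral>h. trace_char (Suc a) (sym_rep a) h * cnj (trace_char (Suc b) (sym_rep b) h) \<partial>\<mu>)"
    by (rule Bochner_Integration.integral_cong) (simp_all add: space_haar trace_char_sym_rep)
  also have "\<dots> = of_real (if a = b then 1 else 0)"
  proof (cases "a = b")
    case True
    then show ?thesis using char_self[OF irr[of a]] by simp
  next
    case False
    have "(sym_rep b, sym_rep a) \<notin> rep_equivalence SU2"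
    proof
      assume e: "(sym_rep b, sym_rep a) \<in> rep_equivalence SU2"
      \<comment> \<open>Trace 2 is the identity matrix, where the character equals the degree;
        different degrees exclude equivalence.\<close>
      have d: "diag_SU2 2 \<in> carrier SU2" by (rule diag_SU2_in) simp
      show False
        using rep_equivalence_char[OF e irr irr d] False
        by (simp add: trace_char_sym_rep[OF d] trace_diag_SU2 cheb_2 del: of_nat_Suc)
    qed
    then show ?thesis using False char_orthogonal[OF irr irr] by simp
  qed
  finally show ?thesis by (simp only: of_real_eq_iff)
qed

lemma integral_cheb_triple:
  "(\<integral>h. cheb a (trace_SU2 h) * (cheb b (trace_SU2 h) * cheb c (trace_SU2 h)) \<partial>\<mu>) =
    (if (a, b, c) \<in> triangles then 1 else 0)"
proof -
  have *: "(\<integral>h. cheb (d + b) (trace_SU2 h) * (cheb b (trace_SU2 h) * cheb c (trace_SU2 h)) \<partial>\<mu>) =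
      (if (d + b, b, c) \<in> triangles then 1 else 0)" for d b
  proof -
    have "(\<integral>h. cheb (d + b) (trace_SU2 h) * (cheb b (trace_SU2 h) * cheb c (trace_SU2 h)) \<partial>\<mu>) =
        (\<integral>h. (\<Sum>k\<le>b. cheb (d + 2 * k) (trace_SU2 h) * cheb c (trace_SU2 h)) \<partial>\<mu>)"
      unfolding mult.assoc[symmetric] cheb_mult sum_distrib_right ..
    also have "\<dots> = (\<Sum>k\<le>b. if d + 2 * k = c then 1 else 0)"
      unfolding integral_cheb_orthogonal[symmetric]
      by (intro Bochner_Integration.integral_sum integrable_trace_SU2[of "\<lambda>t. cheb _ t * cheb c t"] continuous_intros)
    also have "\<dots> = (if (d + b, b, c) \<in> triangles then 1 else 0)"
    proof (cases "(d + b, b, c) \<in> triangles")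
      case True
      then obtain k0 where k0: "k0 \<le> b" "c = d + 2 * k0" unfolding triangles_iff by blast
      have "(\<Sum>k\<le>b. if d + 2 * k = c then 1 else 0 :: real) = (\<Sum>k\<le>b. if k = k0 then 1 else 0)"
        by (intro sum.cong refl) (simp add: k0(2))
      then show ?thesis using True k0(1) by simp
    next
      case False
      then have "(\<Sum>k\<le>b. if d + 2 * k = c then 1 else 0 :: real) = 0"
        unfolding triangles_iff by (intro sum.neutral) auto
      then show ?thesis using False by simp
    qed
    finally show ?thesis .
  qed
  show ?thesis
  proof (cases "b \<le> a")
    case True
    then show ?thesis using *[of "a - b" b] by simp
  next
    case False
    then show ?thesis using *[of "b - a" a] triangles_swap[of a b c] by (simp add: mult.left_commute)
  qed
qed

text \<open>Orthogonality excludes proportionality of different characters. Fixing two of three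
  variables at the identity reduces an equality of products of three characters to this
  case.\<close>

lemma cheb_proportional:
  assumes "\<And>h. h \<in> carrier SU2 \<Longrightarrow> cheb a (trace_SU2 h) * x = cheb b (trace_SU2 h) * y" "x \<noteq> 0"
  shows "a = b"
proof (rule ccontr)
  assume "a \<noteq> b"
  have "x = (\<integral>h. cheb a (trace_SU2 h) * cheb a (trace_SU2 h) * x \<partial>\<mu>)"
    by (simp add: integral_cheb_orthogonal)
  also have "\<dots> = (\<integral>h. cheb a (trace_SU2 h) * cheb b (trace_SU2 h) * y \<partial>\<mu>)"
    by (rule Bochner_Integration.integral_cong) (simp_all add: space_haar mult.assoc assms(1))
  also have "\<dots> = 0" using \<open>a \<noteq> b\<close> by (simp add: integral_cheb_orthogonal)
  finally show False using assms(2) by simp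
qed

lemma rep3_inequivalent:
  assumes e: "(rep3 p, rep3 q) \<in> rep_equivalence SU2_cubed"
  shows "p = q"
proof -
  obtain a b c a' b' c' where pq: "p = (a, b, c)" "q = (a', b', c')" by (cases p, cases q)
  have eq: "cheb a (trace_SU2 A) * (cheb b (trace_SU2 B) * cheb c (trace_SU2 C)) =
      cheb a' (trace_SU2 A) * (cheb b' (trace_SU2 B) * cheb c' (trace_SU2 C))"
    if "A \<in> carrier SU2" "B \<in> carrier SU2" "C \<in> carrier SU2" for A B C
  proof -
    have g: "(A, B, C) \<in> carrier SU2_cubed" using that by (simp add: carrier_SU2_cubed)
    have "complex_of_real (cheb3 p (traces (A, B, C))) = of_real (cheb3 q (traces (A, B, C)))"
      using rep_equivalence_char[OF e rep3_irreducible rep3_irreducible g] by (simp only: trace_char_rep3[OF g])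
    then show ?thesis by (simp only: of_real_eq_iff) (simp add: pq cheb3_def traces_def)
  qed
  define d where "d = diag_SU2 2"
  have d: "d \<in> carrier SU2" unfolding d_def by (rule diag_SU2_in) simp
  have t: "cheb n (trace_SU2 d) = real (Suc n)" for n by (simp only: d_def trace_diag_SU2 cheb_2)
  have "a = a'"
  proof (rule cheb_proportional)
    fix h :: "complex^2^2" assume "h \<in> carrier SU2"
    from eq[OF this d d] show "cheb a (trace_SU2 h) * real (Suc b * Suc c) = cheb a' (trace_SU2 h) * real (Suc b' * Suc c')"
      by (simp only: t of_nat_mult)
  qed (simp del: of_nat_Suc)
  moreover have "b = b'"
  proof (rule cheb_proportional)
    fix h :: "complex^2^2" assume "h \<in> carrier SU2"
    from eq[OF d this d] show "cheb b (trace_SU2 h) * real (Suc a * Suc c) = cheb b' (trace_SU2 h) * real (Suc a' * Suc c')"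
      by (simp only: t of_nat_mult mult.left_commute)
  qed (simp del: of_nat_Suc)
  moreover have "c = c'"
  proof (rule cheb_proportional)
    fix h :: "complex^2^2" assume "h \<in> carrier SU2"
    from eq[OF d d this] show "cheb c (trace_SU2 h) * real (Suc a * Suc b) = cheb c' (trace_SU2 h) * real (Suc a' * Suc b')"
      by (simp only: t of_nat_mult mult.assoc mult.commute[of "cheb _ _"])
  qed (simp del: of_nat_Suc)
  ultimately show ?thesis by (simp add: pq)
qed

text \<open>Turns every sum over the dual into a sum over triples of indices.\<close>

lemma bij_betw_rep3_class: "bij_betw rep3_class UNIV (unitary_dual SU2_cubed)"
proof (rule bij_betw_imageI)
  show "inj rep3_class"
  proof (rule injI)
    fix p q assume "rep3_class p = rep3_class q"
    then show "p = q"
      unfolding rep3_class_def by (intro rep3_inequivalent eq_equiv_class[OF _ equiv_SU2_cubed rep3_in_irreps])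
  qed
  show "range rep3_class = unitary_dual SU2_cubed"
  proof (intro equalityI subsetI)
    fix C assume "C \<in> range rep3_class"
    then show "C \<in> unitary_dual SU2_cubed"
      unfolding unitary_dual_def rep3_class_def using rep3_in_irreps by (auto intro: quotientI)
  next
    fix C assume "C \<in> unitary_dual SU2_cubed"
    then obtain \<rho> where \<rho>: "\<rho> \<in> irreps SU2_cubed" "C = rep_equivalence SU2_cubed `` {\<rho>}"
      unfolding unitary_dual_def by (rule quotientE)
    obtain n where "irreducible_unitary_rep SU2_cubed n \<rho>" using \<rho>(1) unfolding irreps_def by blast
    then obtain p where "(rep3 p, \<rho>) \<in> rep_equivalence SU2_cubed" using irreducible_equivalent_rep3[OF haar] by blast
    then have "C = rep3_class p" unfolding \<rho>(2) rep3_class_def by (rule equiv_class_eq[OF equiv_SU2_cubed, symmetric])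
    then show "C \<in> range rep3_class" by blast
  qed
qed

end

section \<open>Degrees, characters and terms of the Witten series\<close>

lemma rep_of_rep3_class:
  "(rep3 p, rep_of (rep3_class p)) \<in> rep_equivalence SU2_cubed"
  "irreducible_unitary_rep SU2_cubed (deg3 p) (rep_of (rep3_class p))"
proof -
  have "rep3 p \<in> rep3_class p" unfolding rep3_class_def by (rule equiv_class_self[OF equiv_SU2_cubed rep3_in_irreps])
  then have "rep_of (rep3_class p) \<in> rep3_class p" unfolding rep_of_def by (rule someI[of "\<lambda>\<rho>. \<rho> \<in> rep3_class p"])
  then show *: "(rep3 p, rep_of (rep3_class p)) \<in> rep_equivalence SU2_cubed" by (simp add: rep3_class_def)
  then obtain n where n: "irreducible_unitary_rep SU2_cubed n (rep3 p)"
      "irreducible_unitary_rep SU2_cubed n (rep_of (rep3_class p))"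
    unfolding rep_equivalence_def by blast
  interpret group SU2_cubed by (rule group_SU2_cubed)
  have "unitary_rep SU2_cubed n (rep3 p)" "unitary_rep SU2_cubed (deg3 p) (rep3 p)"
    using n(1) rep3_irreducible[of p] by (simp_all add: irreducible_unitary_rep_def)
  then have "rep3 p \<one>\<^bsub>SU2_cubed\<^esub> \<in> carrier_mat n n" "rep3 p \<one>\<^bsub>SU2_cubed\<^esub> \<in> carrier_mat (deg3 p) (deg3 p)"
    by (auto intro: unitary_repD(2))
  then have "n = deg3 p" by auto
  then show "irreducible_unitary_rep SU2_cubed (deg3 p) (rep_of (rep3_class p))" using n(2) by simp
qed

lemma class_degree_rep3_class: "class_degree SU2_cubed (rep3_class p) = deg3 p"
  and class_character_rep3_class:
    "k \<in> carrier SU2_cubed \<Longrightarrow> class_character (rep3_class p) k = of_real (cheb3 p (traces k))"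
proof -
  interpret group SU2_cubed by (rule group_SU2_cubed)
  have "unitary_rep SU2_cubed (deg3 p) (rep_of (rep3_class p))"
    using rep_of_rep3_class(2)[of p] by (simp add: irreducible_unitary_rep_def)
  then have c: "rep_of (rep3_class p) g \<in> carrier_mat (deg3 p) (deg3 p)" if "g \<in> carrier SU2_cubed" for g
    using \<open>g \<in> carrier SU2_cubed\<close> by (rule unitary_repD(2))
  show "class_degree SU2_cubed (rep3_class p) = deg3 p"
    using c[OF one_closed] by (simp add: class_degree_def)
  show "class_character (rep3_class p) k = of_real (cheb3 p (traces k))" if k: "k \<in> carrier SU2_cubed"
    using rep_equivalence_char[OF rep_of_rep3_class(1) rep3_irreducible rep_of_rep3_class(2) k] c[OF k]
    by (simp add: class_character_def trace_char_def[symmetric] trace_char_rep3[OF k])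
qed

lemma triple_prod_deg3: "triple_prod u p = of_nat (deg3 p) powr (- u)"
  by (cases p) (simp only: triple_prod_def deg3_def prod.case dirichlet_def powr_of_nat_mult mult.assoc)

lemma witten_term_rep3_class:
  "k \<in> carrier SU2_cubed \<Longrightarrow>
    witten_term SU2_cubed s k (rep3_class p) = of_real (cheb3 p (traces k)) * triple_prod (s + 1) p"
  unfolding witten_term_def class_degree_rep3_class triple_prod_deg3 powr_minus divide_inverse
  by (simp only: class_character_rep3_class)

lemma deg3_pos: "deg3 p > 0"
  by (cases p) (simp add: deg3_def)

text \<open>A character is bounded by the degree, which costs one power: the exponent
  \<open>s + 1\<close> drops to \<open>s\<close>. The majorant is summable for
  \<open>Re s > 1\<close>.\<close>

lemma norm_witten_term_le:
  assumes k: "k \<in> carrier SU2_cubed"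
  shows "norm (complex_of_real (cheb3 p (traces k)) * triple_prod (s + 1) p) \<le> norm (triple_prod s p)"
proof -
  have n: "norm (triple_prod u p) = real (deg3 p) powr (- Re u)" for u
    unfolding triple_prod_deg3 using norm_powr_real_powr[of "of_nat (deg3 p)" "- u"] by simp
  have "norm (complex_of_real (cheb3 p (traces k))) \<le> real (deg3 p)"
    using norm_trace_char_le[of SU2_cubed "deg3 p" "rep3 p" k] rep3_irreducible[of p] k
    by (simp only: trace_char_rep3 irreducible_unitary_rep_def)
  then have "norm (complex_of_real (cheb3 p (traces k)) * triple_prod (s + 1) p) \<le>
      real (deg3 p) * real (deg3 p) powr (- Re (s + 1))"
    unfolding norm_mult n by (rule mult_right_mono) simp
  also have "\<dots> = real (deg3 p) powr (1 + - Re (s + 1))"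
    unfolding powr_add using deg3_pos[of p] by simp
  also have "\<dots> = norm (triple_prod s p)" unfolding n by simp
  finally show ?thesis .
qed

lemma diag3_in_SU2_cubed: "h \<in> carrier SU2 \<Longrightarrow> diag3 h \<in> carrier SU2_cubed"
  by (simp add: diag3_def carrier_SU2_cubed)

theorem theorem4p2:
  fixes \<mu> :: "(complex^2^2) measure"
  assumes haar: "normalized_haar_measure SU2 \<mu>"
  shows "\<exists>(Z :: complex \<Rightarrow> complex) (\<sigma>\<^sub>0 :: real).
     Z meromorphic_on UNIV \<and>
     (\<forall>s. Re s > \<sigma>\<^sub>0 \<longrightarrow>
        (\<forall>k\<in>carrier SU2_cubed. witten_L_converges SU2_cubed s k) \<and>
        integrable \<mu> (\<lambda>h. witten_L SU2_cubed s (diag3 h)) \<and>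
        Z s = diagonal_integral \<mu> s) \<and>
     (\<forall>s. Re s > 0 \<longrightarrow>
        (\<lambda>m. norm (triple_term s m)) summable_on UNIV \<and>
        Z s = (\<Sum>\<^sub>\<infinity>m\<in>UNIV. triple_term s m))"
proof -
  obtain Z where Z: "Z meromorphic_on UNIV" "\<forall>s. Re s > 0 \<longrightarrow> Z s = (\<Sum>\<^sub>\<infinity>m. triple_term s m)"
    using triple_sum_continuation by (rule exE) (erule conjE)
  interpret haar_group SU2 \<mu> by (rule haar_group_SU2[OF haar])
  note bij = bij_betw_rep3_class[OF haar]
  have main: "(\<forall>k\<in>carrier SU2_cubed. witten_L_converges SU2_cubed s k) \<and>
        integrable \<mu> (\<lambda>h. witten_L SU2_cubed s (diag3 h)) \<and>
        Z s = diagonal_integral \<mu> s" if s: "Re s > 1" for s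
  proof -
    define f where "f = (\<lambda>p k. complex_of_real (cheb3 p (traces k)) * triple_prod (s + 1) p)"
    have fw: "witten_term SU2_cubed s k (rep3_class p) = f p k" if "k \<in> carrier SU2_cubed" for k p
      unfolding f_def by (rule witten_term_rep3_class) fact
    have bd: "norm (f p k) \<le> norm (triple_prod s p)" if "k \<in> carrier SU2_cubed" for k p
      unfolding f_def by (rule norm_witten_term_le) fact
    have sm: "(\<lambda>p. norm (f p k)) summable_on UNIV" if "k \<in> carrier SU2_cubed" for k
      by (rule summable_on_comparison_test[OF summable_triple_prod[OF s]]) (simp_all add: bd[OF \<open>k \<in> _\<close>])
    have conv: "witten_L_converges SU2_cubed s k" if k: "k \<in> carrier SU2_cubed" for k
      unfolding witten_L_converges_def summable_on_reindex_bij_betw[OF bij, symmetric] fw[OF k] by (rule sm[OF k])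
    have L: "witten_L SU2_cubed s k = (\<Sum>\<^sub>\<infinity>p. f p k)" if k: "k \<in> carrier SU2_cubed" for k
      unfolding witten_L_def infsum_reindex_bij_betw[OF bij, symmetric] fw[OF k] ..
    have i: "integrable \<mu> (\<lambda>h. cheb3 p (traces (diag3 h)))" for p
      using integrable_trace_SU2[OF haar, of "\<lambda>t. cheb3 p (t, t, t)"]
      by (simp add: cheb3_def split_beta traces_def diag3_def continuous_intros)
    have int: "integrable \<mu> (\<lambda>h. f p (diag3 h))" for p
      unfolding f_def using i[of p] by (intro integrable_mult_left) (simp only: complex_of_real_integrable_eq)
    have val: "(\<integral>h. f p (diag3 h) \<partial>\<mu>) = (if p \<in> triangles then triple_prod (s + 1) p else 0)" for p
    proof -
      obtain a b c where p: "p = (a, b, c)" by (cases p)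
      have "(\<integral>h. cheb3 p (traces (diag3 h)) \<partial>\<mu>) = (if p \<in> triangles then 1 else 0)"
        using integral_cheb_triple[OF haar, of a b c] by (simp add: p cheb3_def traces_def diag3_def)
      then show ?thesis unfolding f_def integral_mult_left_zero integral_complex_of_real by simp
    qed
    have sum: "(\<lambda>p. \<integral>h. norm (f p (diag3 h)) \<partial>\<mu>) summable_on UNIV"
    proof (rule summable_on_comparison_test[OF summable_triple_prod[OF s]])
      show "(\<integral>h. norm (f p (diag3 h)) \<partial>\<mu>) \<le> norm (triple_prod s p)" for p
        by (rule integral_le_const[OF integrable_norm[OF int]], rule AE_I2)
           (simp add: space_haar bd diag3_in_SU2_cubed)
    qed simp
    have inf: "infinite (UNIV :: (nat \<times> nat \<times> nat) set)" by (simp add: finite_prod)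
    have pt: "(\<lambda>p. norm (f p (diag3 h))) summable_on UNIV" if "h \<in> space \<mu>" for h
      using \<open>h \<in> space \<mu>\<close> unfolding space_haar by (intro sm diag3_in_SU2_cubed)
    note F = integral_infsum[of \<mu> "\<lambda>p h. f p (diag3 h)", OF inf int sum pt]
    have c: "integrable \<mu> (\<lambda>h. witten_L SU2_cubed s (diag3 h)) \<longleftrightarrow> integrable \<mu> (\<lambda>h. \<Sum>\<^sub>\<infinity>p. f p (diag3 h))"
      by (rule Bochner_Integration.integrable_cong) (simp_all add: space_haar L diag3_in_SU2_cubed)
    have "diagonal_integral \<mu> s = (\<integral>h. (\<Sum>\<^sub>\<infinity>p. f p (diag3 h)) \<partial>\<mu>)"
      unfolding diagonal_integral_def
      by (rule Bochner_Integration.integral_cong) (simp_all add: space_haar L diag3_in_SU2_cubed)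
    also have "\<dots> = (\<Sum>\<^sub>\<infinity>p. if p \<in> triangles then triple_prod (s + 1) p else 0)" using F(2) by (simp only: val)
    also have "\<dots> = (\<Sum>\<^sub>\<infinity>p\<in>triangles. triple_prod (s + 1) p)" by (rule infsum_cong_neutral) auto
    also have "\<dots> = Z s" using Z(2) triple_term_sums(2)[of s] s by simp
    finally have "Z s = diagonal_integral \<mu> s" ..
    then show ?thesis using conv F(1) c by blast
  qed
  \<comment> \<open>The abscissa 1 is where the majorant of \<open>norm_witten_term_le\<close>
    becomes summable, uniformly over the group.\<close>
  show ?thesis
    using Z main triple_term_sums(1) by (intro exI[of _ Z] exI[of _ 1]) blast
qed

end
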